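(* Let $N\in\{2,3\}$, $\omega>0$, let $\Omega\subset\mathbb R^N$ be a bounded smooth domain carrying the elastic medium $\{\Omega;\mathcal C,\rho\}$, and let $\tilde x=F(x):\Omega\to\tilde\Omega$ be a bi-Lipschitz, orientation-preserving mapping with Jacobian matrix $M=(\partial\tilde x_i/\partial x_j)_{i,j=1}^N$. Define on $\tilde\Omega$ $$\tilde C_{iqkp}(\tilde x)=\frac1{\det M}\Big\{\sum_{l,j=1}^N C_{ijkl}\frac{\partial\tilde x_p}{\partial x_l}\frac{\partial\tilde x_q}{\partial x_j}\Big\}\Big|_{x=F^{-1}(\tilde x)},\qquad \tilde\rho(\tilde x)=\Big(\frac{\rho}{\det M}\Big)\Big|_{x=F^{-1}(\tilde x)} .$$ (i) A function $u\in H^1(\Omega)^N$ is a solution of $\nabla\cdot(\mathcal C:\nabla u)+\omega^2\rho u=0$ in $\Omega$ if and only if $\tilde u:=u\circ F^{-1}\in H^1(\tilde\Omega)^N$ is a solution of $\nabla_{\tilde x}\cdot(\tilde{\mathcal C}:\nabla_{\tilde x}\tilde u)+\omega^2\tilde\rho\,\tilde u=0$ in $\tilde\Omega$. (ii) If $F=\mathrm{Identity}$ on $\partial\Omega$ (so the boundary remains fixed), and the Neumann problem for $\{\Omega;\mathcal C,\rho\}$ at frequency $\omega$ is well-posed, then the Neumann-to-Dirichlet maps satisfy $\Lambda_{\mathcal C,\rho}=\Lambda_{\tilde{\mathcal C},\tilde\rho}$.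
   Context: For a fourth-rank real tensor $\mathcal C=(C_{ijkl})$ and a matrix $A=(a_{ij})$, $(\mathcal C:A)_{ij}=\sum_{k,l}C_{ijkl}a_{kl}$; $\nabla u=(\partial u_k/\partial x_l)_{k,l}$, so the $i$-th component of $\nabla\cdot(\mathcal C:\nabla u)$ is $\sum_{j,k,l}\partial_{x_j}(C_{ijkl}\,\partial_{x_l}u_k)$. Equations are understood in the weak (distributional) sense. The medium $\{\Omega;\mathcal C,\rho\}$ has $C_{ijkl}\in L^\infty(\Omega)$ with $C_{ijkl}=C_{klij}$ and $C_{ijkl}=C_{jikl}=C_{ijlk}$, the uniform Legendre ellipticity condition $\sum C_{ijkl}(x)a_{ij}a_{kl}\ge c_0\sum|a_{ij}|^2$ ($c_0>0$) for all real symmetric $(a_{ij})$ and all $x\in\Omega$, and complex-valued $\rho\in L^\infty(\Omega)$ with $\Re\rho>0$, $\Im\rho\ge0$. Neumann-to-Dirichlet map: for $\psi\in H^{-1/2}(\partial\Omega)^N$ the Neumann problem is to find $u\in H^1(\Omega)^N$ with $\int_\Omega\{\sum C_{ijkl}\,\partial_l u_k\,\partial_j\overline{v_i}-\omega^2\rho\,u\cdot\overline v\}\,dx=\int_{\partial\Omega}\psi\cdot\overline v\,ds$ for all $v\in H^1(\Omega)^N$ (i.e. $\nabla\cdot(\mathcal C:\nabla u)+\omega^2\rho u=0$ in $\Omega$, $\nu\cdot(\mathcal C:\nabla u)=\psi$ on $\partial\Omega$). When it is well-posed, $\Lambda_{\mathcal C,\rho}:H^{-1/2}(\partial\Omega)^N\to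 H^{1/2}(\partial\Omega)^N$ is $\Lambda_{\mathcal C,\rho}\psi=u|_{\partial\Omega}$. *)

theory Defs
  imports "HOL-Analysis.Analysis"
begin

section \<open>Smooth functions, test functions and smooth domains\<close>

definition partial_deriv :: "'n::finite \<Rightarrow> (real^'n \<Rightarrow> real) \<Rightarrow> real^'n \<Rightarrow> real" where
  "partial_deriv i f x = frechet_derivative f (at x) (axis i 1)"

fun iterated_partial :: "'n::finite list \<Rightarrow> (real^'n \<Rightarrow> real) \<Rightarrow> real^'n \<Rightarrow> real" where
  "iterated_partial [] f = f"
| "iterated_partial (i # is) f = partial_deriv i (iterated_partial is f)"

text \<open>For open \<open>S\<close> this is the class of infinitely differentiable functions: since every iterated
  partial derivative is differentiable on \<open>S\<close>, each of them is in particular continuous there.\<close>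

definition smooth_on :: "(real^'n::finite) set \<Rightarrow> (real^'n \<Rightarrow> real) \<Rightarrow> bool" where
  "smooth_on S f \<longleftrightarrow> (\<forall>is. \<forall>x\<in>S. iterated_partial is f differentiable (at x))"

definition test_functions :: "(real^'n::finite) set \<Rightarrow> (real^'n \<Rightarrow> real) set" where
  "test_functions \<Omega> = {\<phi>. smooth_on UNIV \<phi> \<and> compact (closure {x. \<phi> x \<noteq> 0})
                          \<and> closure {x. \<phi> x \<noteq> 0} \<subseteq> \<Omega>}"

text \<open>Bounded domain with \<open>C\<^sup>\<infinity>\<close> boundary, via local defining functions: near each boundary point the
  domain is a sublevel set of a smooth function whose gradient does not vanish.\<close>

definition smooth_bounded_domain :: "(real^'n::finite) set \<Rightarrow> bool" where
  "smooth_bounded_domain \<Omega> \<longleftrightarrow>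
     open \<Omega> \<and> connected \<Omega> \<and> \<Omega> \<noteq> {} \<and> bounded \<Omega> \<and>
     (\<forall>p\<in>frontier \<Omega>. \<exists>r>0. \<exists>h. smooth_on (ball p r) h
         \<and> (\<forall>x\<in>ball p r. \<exists>i. partial_deriv i h x \<noteq> 0)
         \<and> \<Omega> \<inter> ball p r = {x\<in>ball p r. h x < 0})"

section \<open>The Sobolev space \<open>H\<^sup>1(\<Omega>)\<^sup>N\<close>\<close>

text \<open>Elements of \<open>L\<^sup>2\<close>, \<open>H\<^sup>1\<close> etc. are represented by total functions, whose values outside the set
  in question are irrelevant and which are to be identified when they agree almost everywhere.\<close>

definition square_integrable :: "'a measure \<Rightarrow> ('a \<Rightarrow> 'b::euclidean_space) \<Rightarrow> bool" where
  "square_integrable M f \<longleftrightarrow> f \<in> borel_measurable M \<and> integrable M (\<lambda>x. (norm (f x))\<^sup>2)"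

definition essentially_bounded :: "'a measure \<Rightarrow> ('a \<Rightarrow> 'b::euclidean_space) \<Rightarrow> bool" where
  "essentially_bounded M f \<longleftrightarrow> f \<in> borel_measurable M \<and> (\<exists>B. AE x in M. norm (f x) \<le> B)"

definition locally_integrable :: "(real^'n::finite) set \<Rightarrow> (real^'n \<Rightarrow> complex) \<Rightarrow> bool" where
  "locally_integrable \<Omega> f \<longleftrightarrow> (\<forall>K. compact K \<and> K \<subseteq> \<Omega> \<longrightarrow> integrable (lebesgue_on K) f)"

definition has_weak_partial ::
  "(real^'n::finite) set \<Rightarrow> 'n \<Rightarrow> (real^'n \<Rightarrow> complex) \<Rightarrow> (real^'n \<Rightarrow> complex) \<Rightarrow> bool" where
  "has_weak_partial \<Omega> j f g \<longleftrightarrow> locally_integrable \<Omega> f \<and> locally_integrable \<Omega> g \<and>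
     (\<forall>\<phi>\<in>test_functions \<Omega>.
        (LINT x|lebesgue_on \<Omega>. f x * complex_of_real (partial_deriv j \<phi> x))
        = - (LINT x|lebesgue_on \<Omega>. g x * complex_of_real (\<phi> x)))"

text \<open>The weak derivative is unique up to a null set; a representative is chosen.\<close>

definition weak_partial ::
  "(real^'n::finite) set \<Rightarrow> 'n \<Rightarrow> (real^'n \<Rightarrow> complex) \<Rightarrow> real^'n \<Rightarrow> complex" where
  "weak_partial \<Omega> j f = (SOME g. has_weak_partial \<Omega> j f g)"

text \<open>Rows are indexed by the component of \<open>u\<close>, columns by the direction of differentiation:
  \<open>weak_grad \<Omega> u x $ k $ l\<close> is \<open>\<partial>u\<^sub>k/\<partial>x\<^sub>l\<close>.\<close>

definition weak_grad ::
  "(real^'n::finite) set \<Rightarrow> (real^'n \<Rightarrow> complex^'n) \<Rightarrow> real^'n \<Rightarrow> complex^'n^'n" where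
  "weak_grad \<Omega> u x = (\<chi> k l. weak_partial \<Omega> l (\<lambda>y. u y $ k) x)"

definition H1 :: "(real^'n::finite) set \<Rightarrow> (real^'n \<Rightarrow> complex^'n) set" where
  "H1 \<Omega> = {u. square_integrable (lebesgue_on \<Omega>) u \<and>
               (\<forall>k l. \<exists>g. has_weak_partial \<Omega> l (\<lambda>y. u y $ k) g
                          \<and> square_integrable (lebesgue_on \<Omega>) g)}"

definition H1_norm :: "(real^'n::finite) set \<Rightarrow> (real^'n \<Rightarrow> complex^'n) \<Rightarrow> real" where
  "H1_norm \<Omega> u = sqrt ((LINT x|lebesgue_on \<Omega>. (norm (u x))\<^sup>2)
                      + (LINT x|lebesgue_on \<Omega>. (norm (weak_grad \<Omega> u x))\<^sup>2))"

section \<open>Boundary spaces\<close>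

text \<open>Hausdorff measure of dimension \<open>d \<ge> 1\<close>, normalised to agree with Lebesgue measure of dimension \<open>d\<close>
  on flat pieces. Boundedness of the covering sets is required because \<open>diameter\<close> is
  unspecified on unbounded sets.\<close>

definition hausdorff_pre :: "nat \<Rightarrow> real \<Rightarrow> 'a::metric_space set \<Rightarrow> ennreal" where
  "hausdorff_pre d \<delta> A =
     (INF U\<in>{U :: nat \<Rightarrow> 'a set. A \<subseteq> (\<Union>i. U i) \<and> (\<forall>i. bounded (U i) \<and> diameter (U i) \<le> \<delta>)}.
        \<Sum>i. ennreal (unit_ball_vol (real d) * (diameter (U i) / 2) ^ d))"

definition hausdorff_measure :: "nat \<Rightarrow> 'a::metric_space measure" where
  "hausdorff_measure d = measure_of UNIV (sets borel) (\<lambda>A. SUP \<delta>\<in>{0<..}. hausdorff_pre d \<delta> A)"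

definition surface_measure :: "(real^'n::finite) set \<Rightarrow> (real^'n) measure" where
  "surface_measure \<Gamma> = restrict_space (hausdorff_measure (CARD('n) - 1)) \<Gamma>"

text \<open>\<open>H\<^sup>1\<^sup>/\<^sup>2(\<Gamma>)\<^sup>N\<close> with the Sobolev-Slobodeckij norm. The surface \<open>\<Gamma>\<close> has dimension \<open>N - 1\<close>, so the
  exponent in the double integral is \<open>(N - 1) + 2 \<cdot> 1/2 = N\<close>.\<close>

definition slobodeckij :: "(real^'n::finite) set \<Rightarrow> (real^'n \<Rightarrow> complex^'n) \<Rightarrow> ennreal" where
  "slobodeckij \<Gamma> f =
     (\<integral>\<^sup>+x. \<integral>\<^sup>+y. ennreal ((norm (f x - f y))\<^sup>2 / (dist x y) ^ CARD('n))
        \<partial>surface_measure \<Gamma> \<partial>surface_measure \<Gamma>)"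

definition H_half :: "(real^'n::finite) set \<Rightarrow> (real^'n \<Rightarrow> complex^'n) set" where
  "H_half \<Gamma> = {f. square_integrable (surface_measure \<Gamma>) f \<and> slobodeckij \<Gamma> f < \<infinity>}"

definition H_half_norm :: "(real^'n::finite) set \<Rightarrow> (real^'n \<Rightarrow> complex^'n) \<Rightarrow> real" where
  "H_half_norm \<Gamma> f =
     sqrt ((LINT x|surface_measure \<Gamma>. (norm (f x))\<^sup>2) + enn2real (slobodeckij \<Gamma> f))"

text \<open>\<open>H\<^sup>-\<^sup>1\<^sup>/\<^sup>2(\<Gamma>)\<^sup>N\<close> is the dual of \<open>H\<^sup>1\<^sup>/\<^sup>2(\<Gamma>)\<^sup>N\<close>; the value \<open>\<psi> w\<close> stands for the bilinear pairing
  \<open>\<integral>\<^sub>\<Gamma> \<psi> \<cdot> w ds\<close>. Boundedness forces \<open>\<psi>\<close> to respect almost-everywhere equality.\<close>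

definition H_minus_half ::
  "(real^'n::finite) set \<Rightarrow> ((real^'n \<Rightarrow> complex^'n) \<Rightarrow> complex) set" where
  "H_minus_half \<Gamma> = {\<psi>.
     (\<forall>f\<in>H_half \<Gamma>. \<forall>g\<in>H_half \<Gamma>. \<psi> (\<lambda>x. f x + g x) = \<psi> f + \<psi> g) \<and>
     (\<forall>c. \<forall>f\<in>H_half \<Gamma>. \<psi> (\<lambda>x. c *s f x) = c * \<psi> f) \<and>
     (\<exists>K. \<forall>f\<in>H_half \<Gamma>. cmod (\<psi> f) \<le> K * H_half_norm \<Gamma> f)}"

definition H_minus_half_norm ::
  "(real^'n::finite) set \<Rightarrow> ((real^'n \<Rightarrow> complex^'n) \<Rightarrow> complex) \<Rightarrow> real" where
  "H_minus_half_norm \<Gamma> \<psi> = Inf {K. 0 \<le> K \<and> (\<forall>f\<in>H_half \<Gamma>. cmod (\<psi> f) \<le> K * H_half_norm \<Gamma> f)}"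

text \<open>The trace operator is the continuous extension to \<open>H\<^sup>1(\<Omega>)\<close> of the restriction
  \<open>u \<mapsto> u|\<^sub>\<partial>\<^sub>\<Omega>\<close>, initially defined on those \<open>u\<close> in \<open>H\<^sup>1(\<Omega>)\<close> that are continuous up to the boundary.
  The boundary values of \<open>w n\<close> below are its values on \<open>frontier \<Omega>\<close>.\<close>

definition is_trace ::
  "(real^'n::finite) set \<Rightarrow> (real^'n \<Rightarrow> complex^'n) \<Rightarrow> (real^'n \<Rightarrow> complex^'n) \<Rightarrow> bool" where
  "is_trace \<Omega> u g \<longleftrightarrow> square_integrable (surface_measure (frontier \<Omega>)) g \<and>
     (\<exists>w :: nat \<Rightarrow> real^'n \<Rightarrow> complex^'n.
        (\<forall>n. w n \<in> H1 \<Omega> \<and> continuous_on (closure \<Omega>) (w n)) \<and>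
        (\<lambda>n. H1_norm \<Omega> (\<lambda>x. w n x - u x)) \<longlonglongrightarrow> 0 \<and>
        (\<lambda>n. \<integral>\<^sup>+x. ennreal ((norm (w n x - g x))\<^sup>2) \<partial>surface_measure (frontier \<Omega>)) \<longlonglongrightarrow> 0)"

definition trace ::
  "(real^'n::finite) set \<Rightarrow> (real^'n \<Rightarrow> complex^'n) \<Rightarrow> real^'n \<Rightarrow> complex^'n" where
  "trace \<Omega> u = (SOME g. is_trace \<Omega> u g)"

section \<open>Elastic media and the time-harmonic elastic system\<close>

type_synonym 'n tensor_field = "real^'n \<Rightarrow> 'n \<Rightarrow> 'n \<Rightarrow> 'n \<Rightarrow> 'n \<Rightarrow> real"

definition elastic_medium ::
  "(real^'n::finite) set \<Rightarrow> 'n tensor_field \<Rightarrow> (real^'n \<Rightarrow> complex) \<Rightarrow> bool" where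
  "elastic_medium \<Omega> C \<rho> \<longleftrightarrow>
     (\<forall>i j k l. essentially_bounded (lebesgue_on \<Omega>) (\<lambda>x. C x i j k l)) \<and>
     (\<forall>x\<in>\<Omega>. \<forall>i j k l. C x i j k l = C x k l i j \<and> C x i j k l = C x j i k l
                        \<and> C x i j k l = C x i j l k) \<and>
     (\<exists>c0>0. \<forall>x\<in>\<Omega>. \<forall>A :: real^'n^'n. Finite_Cartesian_Product.transpose A = A \<longrightarrow>
        (\<Sum>i\<in>UNIV. \<Sum>j\<in>UNIV. \<Sum>k\<in>UNIV. \<Sum>l\<in>UNIV. C x i j k l * A$i$j * A$k$l)
        \<ge> c0 * (\<Sum>i\<in>UNIV. \<Sum>j\<in>UNIV. \<bar>A$i$j\<bar>\<^sup>2)) \<and>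
     essentially_bounded (lebesgue_on \<Omega>) \<rho> \<and>
     (\<forall>x\<in>\<Omega>. 0 < Re (\<rho> x) \<and> 0 \<le> Im (\<rho> x))"

text \<open>The equation \<open>\<nabla>\<cdot>(C : \<nabla>u) + \<omega>\<^sup>2\<rho>u = 0\<close> in the sense of distributions, component by component.\<close>

definition elastic_eq ::
  "real \<Rightarrow> (real^'n::finite) set \<Rightarrow> 'n tensor_field \<Rightarrow> (real^'n \<Rightarrow> complex)
   \<Rightarrow> (real^'n \<Rightarrow> complex^'n) \<Rightarrow> bool" where
  "elastic_eq \<omega> \<Omega> C \<rho> u \<longleftrightarrow> (\<forall>i. \<forall>\<phi>\<in>test_functions \<Omega>.
     - (LINT x|lebesgue_on \<Omega>. (\<Sum>j\<in>UNIV. \<Sum>k\<in>UNIV. \<Sum>l\<in>UNIV.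
          complex_of_real (C x i j k l) * weak_grad \<Omega> u x $ k $ l
            * complex_of_real (partial_deriv j \<phi> x)))
     + (complex_of_real \<omega>)\<^sup>2 * (LINT x|lebesgue_on \<Omega>. \<rho> x * u x $ i * complex_of_real (\<phi> x)) = 0)"

definition neumann_solution ::
  "real \<Rightarrow> (real^'n::finite) set \<Rightarrow> 'n tensor_field \<Rightarrow> (real^'n \<Rightarrow> complex)
   \<Rightarrow> ((real^'n \<Rightarrow> complex^'n) \<Rightarrow> complex) \<Rightarrow> (real^'n \<Rightarrow> complex^'n) \<Rightarrow> bool" where
  "neumann_solution \<omega> \<Omega> C \<rho> \<psi> u \<longleftrightarrow> u \<in> H1 \<Omega> \<and> (\<forall>v\<in>H1 \<Omega>.
     (LINT x|lebesgue_on \<Omega>.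
        (\<Sum>i\<in>UNIV. \<Sum>j\<in>UNIV. \<Sum>k\<in>UNIV. \<Sum>l\<in>UNIV.
           complex_of_real (C x i j k l) * weak_grad \<Omega> u x $ k $ l * cnj (weak_grad \<Omega> v x $ i $ j))
        - (complex_of_real \<omega>)\<^sup>2 * \<rho> x * (\<Sum>i\<in>UNIV. u x $ i * cnj (v x $ i)))
     = \<psi> (\<lambda>x. \<chi> i. cnj (trace \<Omega> v x $ i)))"

text \<open>Existence, uniqueness and continuous dependence on the data.\<close>

definition neumann_well_posed ::
  "real \<Rightarrow> (real^'n::finite) set \<Rightarrow> 'n tensor_field \<Rightarrow> (real^'n \<Rightarrow> complex) \<Rightarrow> bool" where
  "neumann_well_posed \<omega> \<Omega> C \<rho> \<longleftrightarrow>
     (\<forall>\<psi>\<in>H_minus_half (frontier \<Omega>). \<exists>u. neumann_solution \<omega> \<Omega> C \<rho> \<psi> u) \<and>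
     (\<forall>\<psi>\<in>H_minus_half (frontier \<Omega>). \<forall>u w.
        neumann_solution \<omega> \<Omega> C \<rho> \<psi> u \<longrightarrow> neumann_solution \<omega> \<Omega> C \<rho> \<psi> w \<longrightarrow>
        (AE x in lebesgue_on \<Omega>. u x = w x)) \<and>
     (\<exists>K. \<forall>\<psi>\<in>H_minus_half (frontier \<Omega>). \<forall>u. neumann_solution \<omega> \<Omega> C \<rho> \<psi> u \<longrightarrow>
        H1_norm \<Omega> u \<le> K * H_minus_half_norm (frontier \<Omega>) \<psi>)"

definition neumann_to_dirichlet ::
  "real \<Rightarrow> (real^'n::finite) set \<Rightarrow> 'n tensor_field \<Rightarrow> (real^'n \<Rightarrow> complex)
   \<Rightarrow> ((real^'n \<Rightarrow> complex^'n) \<Rightarrow> complex) \<Rightarrow> real^'n \<Rightarrow> complex^'n" where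
  "neumann_to_dirichlet \<omega> \<Omega> C \<rho> \<psi> = trace \<Omega> (SOME u. neumann_solution \<omega> \<Omega> C \<rho> \<psi> u)"

section \<open>Change of variables\<close>

definition bi_lipschitz ::
  "('a::metric_space \<Rightarrow> 'b::metric_space) \<Rightarrow> 'a set \<Rightarrow> 'b set \<Rightarrow> bool" where
  "bi_lipschitz F S T \<longleftrightarrow> bij_betw F S T \<and> (\<exists>L. L-lipschitz_on S F)
                          \<and> (\<exists>L. L-lipschitz_on T (inv_into S F))"

text \<open>A Lipschitz map on an open set is differentiable almost everywhere (Rademacher), so the
  following says that the Jacobian determinant is positive almost everywhere. The premise keeps the
  unspecified value of \<open>jacobian\<close> at points of non-differentiability out of the condition.\<close>

definition orientation_preserving :: "(real^'n::finite \<Rightarrow> real^'n) \<Rightarrow> (real^'n) set \<Rightarrow> bool" where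
  "orientation_preserving F \<Omega> \<longleftrightarrow>
     (AE x in lebesgue_on \<Omega>. F differentiable (at x) \<longrightarrow> 0 < det (jacobian F (at x)))"

definition push_tensor ::
  "(real^'n::finite \<Rightarrow> real^'n) \<Rightarrow> (real^'n) set \<Rightarrow> 'n tensor_field \<Rightarrow> 'n tensor_field" where
  "push_tensor F \<Omega> C y i q k p =
     (let x = inv_into \<Omega> F y; M = jacobian F (at x)
      in 1 / det M * (\<Sum>l\<in>UNIV. \<Sum>j\<in>UNIV. C x i j k l * M$p$l * M$q$j))"

definition push_density ::
  "(real^'n::finite \<Rightarrow> real^'n) \<Rightarrow> (real^'n) set \<Rightarrow> (real^'n \<Rightarrow> complex) \<Rightarrow> real^'n \<Rightarrow> complex" where
  "push_density F \<Omega> \<rho> y =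
     (let x = inv_into \<Omega> F y in \<rho> x / complex_of_real (det (jacobian F (at x))))"

text \<open>\<open>F\<close> need only be defined on the open set \<open>\<Omega>\<close>; being Lipschitz, it extends continuously to the
  closure, and this says that the extension is the identity on the boundary.\<close>

definition identity_on_boundary :: "('a::metric_space \<Rightarrow> 'a) \<Rightarrow> 'a set \<Rightarrow> bool" where
  "identity_on_boundary F \<Omega> \<longleftrightarrow> (\<forall>p\<in>frontier \<Omega>. (F \<longlongrightarrow> p) (at p within \<Omega>))"

end

(*
  Extend F and its inverse to Lipschitz maps of the whole space. By Rademacher's theorem they are
  differentiable almost everywhere, the chain rule makes their Jacobians mutually inverse at almost
  every point, and the change of variables formula holds for F. Mollification gives the weak chain
  rule for u o F^(-1), so composition with F is an isomorphism of H^1.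

  With h_j = sum_(k,l) C_ijkl d_l u_k, the transformation rule for C says exactly that the flux of
  the pushed-forward medium is the Piola transform (1 / det M) M h of the flux h. The weak divergence
  commutes with the Piola transform once the weak equation is known for compactly supported Lipschitz
  test functions, which is again a mollification argument.

  If F fixes the boundary, composition with F preserves traces, hence transforms the Neumann problem
  for one medium into the one for the other with the same datum, and uniqueness identifies the
  boundary values of the solutions.
*)

theory Submission
  imports Defs
begin

subsection \<open>Mollifiers and test functions\<close>

text \<open>A smooth test function composed with the inverse of \<open>F\<close> is only Lipschitz,
  so it lies outside the class over which the weak equation quantifies; the extension to Lipschitz
  test functions crosses this gap. In the mollification arguments all limits are taken under the
  integral: composition with \<open>F\<close> enlarges L1 norms by at most a constant factor,
  because the Jacobian determinant of the inverse is bounded. Measurability is a second obstacle,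
  since a Lebesgue measurable function composed with a continuous map may fail to be measurable.
  Lipschitz maps preserve null sets, so almost everywhere statements and measurability pass through
  \<open>F\<close> in both directions. The setting is symmetric in \<open>F\<close> and its inverse,
  and reverse implications and bounds come from exchanging the two. The change of variables produces
  the absolute value of the Jacobian determinant; orientation identifies it with the determinant in
  the coefficients. Weak gradients and traces are chosen by \<open>SOME\<close>; congruence lemmas
  show that the choice depends only on the class modulo null sets.\<close>

lemma smooth_on_UNIV_coinduct:
  assumes "P f" "\<And>f x. P f \<Longrightarrow> f differentiable (at x)" "\<And>f i. P f \<Longrightarrow> P (partial_deriv i f)"
  shows "smooth_on UNIV f"
proof -
  have "P (iterated_partial is f)" for "is"
    by (induction "is") (auto simp: assms)
  then show ?thesis
    unfolding smooth_on_def using assms(2) by blast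
qed

text \<open>The classical smooth function \<open>exp (-1/t)\<close>, continued by 0 to nonpositive
  \<open>t\<close>. The polynomial factor in \<open>1/t\<close> makes the family closed under
  differentiation.\<close>

definition flat :: "real poly \<Rightarrow> real \<Rightarrow> real" where
  "flat p t = (if t > 0 then poly p (1/t) * exp (-1/t) else 0)"

lemma poly_times_exp_minus_tendsto_0:
  "((\<lambda>s::real. poly p s * exp (- s)) \<longlongrightarrow> 0) at_top"
proof -
  have "((\<lambda>s::real. \<Sum>i\<le>degree p. coeff p i * (s ^ i / exp s)) \<longlongrightarrow> (\<Sum>i\<le>degree p. coeff p i * 0)) at_top"
    by (intro tendsto_intros tendsto_power_div_exp_0)
  moreover have "(\<lambda>s::real. \<Sum>i\<le>degree p. coeff p i * (s ^ i / exp s)) = (\<lambda>s. poly p s * exp (- s))"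
    by (auto simp: poly_altdef sum_distrib_right exp_minus divide_inverse mult.assoc)
  ultimately show ?thesis by simp
qed

text \<open>With \<open>s = 1/t\<close> the product rule turns \<open>p(s) exp(-s)\<close> into
  \<open>s^2 (p(s) - p'(s)) exp(-s)\<close>, since the derivative of \<open>s\<close> is
  \<open>- s^2\<close>; \<open>[:0,0,1:]\<close> is the polynomial \<open>X^2\<close>.\<close>

lemma flat_has_derivative:
  "(flat p has_real_derivative flat ([:0,0,1:] * (p - pderiv p)) t) (at t)"
proof (cases "t = 0")
  case False
  show ?thesis
  proof (cases "t > 0")
    case True
    have d1: "((\<lambda>t. 1/t) has_real_derivative - (1/t^2)) (at t)"
      using True by (auto intro!: derivative_eq_intros simp: power2_eq_square)
    have d2: "((\<lambda>t. poly p (1/t)) has_real_derivative poly (pderiv p) (1/t) * (- (1/t^2))) (at t)"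
      by (rule DERIV_chain2[OF poly_DERIV d1])
    have d3: "((\<lambda>t. exp (-1/t)) has_real_derivative exp (-1/t) * (1/t^2)) (at t)"
      using DERIV_chain2[OF DERIV_exp DERIV_minus[OF d1]] by simp
    have "((\<lambda>t. poly p (1/t) * exp (-1/t)) has_real_derivative
        poly ([:0,0,1:] * (p - pderiv p)) (1/t) * exp (-1/t)) (at t)"
      by (rule DERIV_cong[OF DERIV_mult[OF d2 d3]]) (simp add: power2_eq_square algebra_simps)
    moreover have "eventually (\<lambda>t. t > 0) (nhds t)"
      using True eventually_nhds_in_open[of "{0<..}" t] by auto
    ultimately show ?thesis
      using True by (subst DERIV_cong_ev[OF refl _ refl, where g="\<lambda>t. poly p (1/t) * exp (-1/t)"])
        (auto simp: flat_def elim!: eventually_mono)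
  next
    case F: False
    with False have "eventually (\<lambda>t. t < 0) (nhds t)"
      using eventually_nhds_in_open[of "{..<0}" t] by auto
    then show ?thesis
      using F False by (subst DERIV_cong_ev[OF refl _ refl, where g="\<lambda>t. 0"])
        (auto simp: flat_def elim!: eventually_mono)
  qed
next
  case True
  have "((\<lambda>h. flat p h / h) \<longlongrightarrow> 0) (at 0)"
  proof (rule filterlim_split_at)
    have "eventually (\<lambda>h::real. h < 0) (at_left 0)"
      by (simp add: eventually_at_filter)
    then have "eventually (\<lambda>h. 0 = flat p h / h) (at_left 0)"
      by eventually_elim (simp add: flat_def)
    then show "((\<lambda>h. flat p h / h) \<longlongrightarrow> 0) (at_left 0)"
      by (rule Lim_transform_eventually[OF tendsto_const])
    \<comment> \<open>For \<open>h > 0\<close> the difference quotient at 0 is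
      \<open>(X p)(1/h) exp(-1/h)\<close>: the polynomial \<open>[:0,1:]\<close> supplies the extra
      factor \<open>1/h\<close>, and the exponential wins.\<close>
    have "((\<lambda>h. poly ([:0,1:] * p) (inverse h) * exp (- inverse h)) \<longlongrightarrow> 0) (at_right (0::real))"
      by (rule filterlim_compose[OF poly_times_exp_minus_tendsto_0 filterlim_inverse_at_top_right])
    moreover have "eventually (\<lambda>h::real. 0 < h) (at_right 0)"
      by (simp add: eventually_at_filter)
    then have "eventually (\<lambda>h. poly ([:0,1:] * p) (inverse h) * exp (- inverse h) = flat p h / h) (at_right 0)"
      by eventually_elim (simp add: flat_def divide_inverse)
    ultimately show "((\<lambda>h. flat p h / h) \<longlongrightarrow> 0) (at_right 0)"
      by (rule Lim_transform_eventually)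
  qed
  then show ?thesis
    using True by (simp add: DERIV_def flat_def)
qed

text \<open>Large enough to contain a bump function, small enough for structural induction.
  Stability under partial derivatives gives smoothness by \<open>smooth_on_UNIV_coinduct\<close>,
  and the affine argument of \<open>flat\<close> gives stability under
  \<open>z \<mapsto> x - z\<close>, the substitution in a convolution kernel.\<close>

inductive elementary_smooth :: "(real^'n::finite \<Rightarrow> real) \<Rightarrow> bool" where
  const: "elementary_smooth (\<lambda>x. c)"
| flat: "elementary_smooth (\<lambda>x. flat p (a * x$i + b))"
| add: "elementary_smooth f \<Longrightarrow> elementary_smooth g \<Longrightarrow> elementary_smooth (\<lambda>x. f x + g x)"
| mult: "elementary_smooth f \<Longrightarrow> elementary_smooth g \<Longrightarrow> elementary_smooth (\<lambda>x. f x * g x)"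

lemma has_derivative_partial_deriv:
  "(f has_derivative f') (at x) \<Longrightarrow> partial_deriv i f x = f' (axis i 1)"
  unfolding partial_deriv_def by (metis frechet_derivative_at)

lemma flat_coordinate_has_derivative:
  "((\<lambda>x::real^'n::finite. flat p (a * x$i + b)) has_derivative
     (\<lambda>h. flat ([:0,0,1:] * (p - pderiv p)) (a * x$i + b) * (a * h$i))) (at x)"
  by (rule has_derivative_compose[OF _ flat_has_derivative[unfolded has_field_derivative_def]])
     (auto intro!: derivative_eq_intros bounded_linear_imp_has_derivative bounded_linear_vec_nth)

lemma elementary_smooth_differentiable:
  "elementary_smooth f \<Longrightarrow> f differentiable (at x)"
  by (induction rule: elementary_smooth.induct)
     (auto intro: differentiableI[OF flat_coordinate_has_derivative])

lemma elementary_smooth_partial_deriv: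
  "elementary_smooth f \<Longrightarrow> elementary_smooth (partial_deriv j f)"
proof (induction rule: elementary_smooth.induct)
  case (const c)
  have "partial_deriv j (\<lambda>x. c) = (\<lambda>x. 0)"
    by (auto simp: partial_deriv_def)
  then show ?case by (simp add: elementary_smooth.const)
next
  case (flat p a i b)
  have "partial_deriv j (\<lambda>x. flat p (a * x$i + b))
      = (\<lambda>x. flat ([:0,0,1:] * (p - pderiv p)) (a * x$i + b) * (a * (axis j 1)$i))"
    by (auto simp: has_derivative_partial_deriv[OF flat_coordinate_has_derivative])
  then show ?case
    by (simp only:) (intro elementary_smooth.intros)
next
  case (add f g)
  have "partial_deriv j (\<lambda>x. f x + g x) = (\<lambda>x. partial_deriv j f x + partial_deriv j g x)"
  proof
    fix x
    have "((\<lambda>x. f x + g x) has_derivative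
       (\<lambda>h. frechet_derivative f (at x) h + frechet_derivative g (at x) h)) (at x)"
      using add elementary_smooth_differentiable[of f x] elementary_smooth_differentiable[of g x]
      by (intro has_derivative_add) (auto simp: frechet_derivative_works)
    from has_derivative_partial_deriv[OF this]
    show "partial_deriv j (\<lambda>x. f x + g x) x = partial_deriv j f x + partial_deriv j g x"
      by (simp add: partial_deriv_def)
  qed
  then show ?case using add by (simp add: elementary_smooth.add)
next
  case (mult f g)
  have "partial_deriv j (\<lambda>x. f x * g x) = (\<lambda>x. f x * partial_deriv j g x + partial_deriv j f x * g x)"
  proof
    fix x
    have "((\<lambda>x. f x * g x) has_derivative
       (\<lambda>h. f x * frechet_derivative g (at x) h + frechet_derivative f (at x) h * g x)) (at x)"
      using mult elementary_smooth_differentiable[of f x] elementary_smooth_differentiable[of g x]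
      by (intro has_derivative_mult) (auto simp: frechet_derivative_works)
    from has_derivative_partial_deriv[OF this]
    show "partial_deriv j (\<lambda>x. f x * g x) x = f x * partial_deriv j g x + partial_deriv j f x * g x"
      by (simp add: partial_deriv_def)
  qed
  then show ?case using mult by (simp add: elementary_smooth.intros)
qed

lemma elementary_smooth_imp_smooth: "elementary_smooth f \<Longrightarrow> smooth_on UNIV f"
  by (rule smooth_on_UNIV_coinduct[where P=elementary_smooth])
     (auto intro: elementary_smooth_differentiable elementary_smooth_partial_deriv)

lemma elementary_smooth_reflect:
  "elementary_smooth f \<Longrightarrow> elementary_smooth (\<lambda>z. f (x - z))"
proof (induction rule: elementary_smooth.induct)
  case (flat p a i b)
  have "(\<lambda>z. flat p (a * (x - z)$i + b)) = (\<lambda>z. flat p ((-a) * z$i + (a * x$i + b)))"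
    by (auto simp: algebra_simps)
  then show ?case by (simp only: elementary_smooth.flat)
qed (auto intro: elementary_smooth.intros)

lemma elementary_smooth_prod:
  "(\<And>i. i \<in> A \<Longrightarrow> elementary_smooth (f i)) \<Longrightarrow> elementary_smooth (\<lambda>x. \<Prod>i\<in>A. f i x)"
  by (induction A rule: infinite_finite_induct) (auto intro: elementary_smooth.intros)

lemma elementary_smooth_continuous: "elementary_smooth f \<Longrightarrow> continuous_on S f"
  by (meson continuous_at_imp_continuous_on differentiable_imp_continuous_within elementary_smooth_differentiable)

text \<open>For \<open>r > 0\<close> the two factors of coordinate \<open>i\<close> vanish together
  unless \<open>\<bar>x$i\<bar> < r / CARD('n)\<close>, and they change places under
  \<open>x \<mapsto> - x\<close>. Dividing by the dimension puts this cube inside the ball of radius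
  \<open>r\<close>, because the Euclidean norm is at most the sum of the absolute values of the
  coordinates.\<close>

definition bump :: "real \<Rightarrow> real^'n::finite \<Rightarrow> real" where
  "bump r x = (\<Prod>i\<in>UNIV. flat 1 ((real CARD('n) / r) * x$i + 1) * flat 1 (-(real CARD('n) / r) * x$i + 1))"

lemma bump_elementary: "elementary_smooth (bump r)"
  unfolding bump_def by (intro elementary_smooth_prod elementary_smooth.intros)

lemma bump_nonneg: "0 \<le> bump r x"
  unfolding bump_def by (intro prod_nonneg) (auto simp: flat_def)

lemma bump_0: "0 < bump r 0"
  unfolding bump_def by (intro prod_pos) (auto simp: flat_def)

lemma bump_minus: "bump r (- x) = bump r x"
  unfolding bump_def by (simp add: mult.commute)

lemma bump_support:
  assumes "0 < r" "bump r x \<noteq> 0" shows "norm (x::real^'n::finite) \<le> r"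
proof -
  have n: "real CARD('n) > 0" by simp
  have "\<bar>x$i\<bar> \<le> r / real CARD('n)" for i
  proof -
    have "flat 1 ((real CARD('n) / r) * x$i + 1) \<noteq> 0" "flat 1 (-(real CARD('n) / r) * x$i + 1) \<noteq> 0"
      using assms(2) unfolding bump_def by auto
    then have "(real CARD('n) / r) * x$i + 1 > 0" "-(real CARD('n) / r) * x$i + 1 > 0"
      by (auto simp: flat_def split: if_splits)
    then have "\<bar>(real CARD('n) / r) * x$i\<bar> \<le> 1" by linarith
    then show ?thesis using assms(1) n by (simp add: abs_mult field_simps)
  qed
  then have "(\<Sum>i\<in>UNIV. \<bar>x$i\<bar>) \<le> (\<Sum>i\<in>(UNIV::'n set). r / real CARD('n))"
    by (intro sum_mono) auto
  with norm_le_l1_cart[of x] show ?thesis by simp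
qed

lemma bump_integrable: assumes "0 < r" shows "integrable lborel (bump r :: real^'n::finite \<Rightarrow> real)"
proof -
  have "integrable lborel (\<lambda>x. indicator (cball 0 r) x *\<^sub>R (bump r x :: real))" for r :: real
    by (rule borel_integrable_compact) (auto intro: elementary_smooth_continuous bump_elementary)
  moreover have "(\<lambda>x. indicator (cball 0 r) x *\<^sub>R (bump r x :: real)) = (bump r :: real^'n \<Rightarrow> real)"
    using bump_support[OF assms] by (fastforce simp: indicator_def)
  ultimately show ?thesis by metis
qed

text \<open>A nonnegative function with integral 0 vanishes almost everywhere. The zero set of
  \<open>bump r\<close> is closed, so it would be the whole space, against
  \<open>bump_0\<close>.\<close>

lemma bump_integral_pos: assumes "0 < r" shows "0 < integral\<^sup>L lborel (bump r :: real^'n::finite \<Rightarrow> real)"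
proof (rule ccontr)
  assume "\<not> ?thesis"
  moreover have "0 \<le> integral\<^sup>L lborel (bump r :: real^'n::finite \<Rightarrow> real)"
    by (intro Bochner_Integration.integral_nonneg bump_nonneg)
  ultimately have "integral\<^sup>L lborel (bump r :: real^'n::finite \<Rightarrow> real) = 0" by linarith
  then have "AE x in lborel. (bump r :: real^'n::finite \<Rightarrow> real) x = 0"
    using integral_nonneg_eq_0_iff_AE[OF bump_integrable[OF assms]] bump_nonneg by auto
  then have "AE x in lebesgue. x \<in> {x :: real^'n. bump r x = 0}"
    by (auto intro: AE_completion)
  moreover have "closed {x :: real^'n. bump r x = 0}"
    by (intro closed_Collect_eq continuous_on_const elementary_smooth_continuous bump_elementary)
  ultimately have "(0::real^'n) \<in> {x. bump r x = 0}"
    using mem_closed_if_AE_lebesgue by blast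
  then show False using bump_0[of r, where 'a='n] by auto
qed

definition mollifier :: "real \<Rightarrow> real^'n::finite \<Rightarrow> real" where
  "mollifier r x = bump r x / integral\<^sup>L lborel (bump r :: real^'n \<Rightarrow> real)"

lemma mollifier_elementary: "elementary_smooth (mollifier r :: real^'n::finite \<Rightarrow> real)"
proof -
  have "mollifier r = (\<lambda>x::real^'n. bump r x * inverse (integral\<^sup>L lborel (bump r :: real^'n \<Rightarrow> real)))"
    by (auto simp: mollifier_def divide_inverse)
  moreover have "elementary_smooth (\<lambda>x::real^'n. bump r x * inverse (integral\<^sup>L lborel (bump r :: real^'n \<Rightarrow> real)))"
    by (intro elementary_smooth.intros bump_elementary)
  ultimately show ?thesis by simp
qed

lemma mollifier_nonneg: "0 < r \<Longrightarrow> 0 \<le> mollifier r x"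
  by (simp add: mollifier_def bump_nonneg bump_integral_pos less_imp_le)

lemma mollifier_minus: "mollifier r (- x) = mollifier r x"
  by (simp add: mollifier_def bump_minus)

lemma mollifier_support: "0 < r \<Longrightarrow> mollifier r x \<noteq> 0 \<Longrightarrow> norm x \<le> r"
  by (auto simp: mollifier_def intro: bump_support)

lemma mollifier_integrable: "0 < r \<Longrightarrow> integrable lborel (mollifier r)"
  unfolding mollifier_def using bump_integrable by auto

lemma mollifier_integral: "0 < r \<Longrightarrow> integral\<^sup>L lborel (mollifier r :: real^'n::finite \<Rightarrow> real) = 1"
  using bump_integral_pos[of r, where 'n='n] unfolding mollifier_def by simp

lemma frechet_derivative_eq_sum_partial_deriv:
  fixes f :: "real^'n::finite \<Rightarrow> real"
  assumes "f differentiable (at x)"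
  shows "frechet_derivative f (at x) v = (\<Sum>i\<in>UNIV. v$i * partial_deriv i f x)"
proof -
  have lin: "linear (frechet_derivative f (at x))"
    by (rule linear_frechet_derivative[OF assms])
  have "frechet_derivative f (at x) v = frechet_derivative f (at x) (\<Sum>i\<in>UNIV. v$i *s axis i 1)"
    by (simp add: basis_expansion)
  also have "\<dots> = (\<Sum>i\<in>UNIV. v$i * partial_deriv i f x)"
    by (simp add: linear_sum[OF lin] linear_cmul[OF lin] partial_deriv_def scalar_mult_eq_scaleR)
  finally show ?thesis .
qed

lemma test_functions_mono: "\<Omega> \<subseteq> \<Omega>' \<Longrightarrow> test_functions \<Omega> \<subseteq> test_functions \<Omega>'"
  by (auto simp: test_functions_def)

lemma zero_test_function: "(\<lambda>x. 0) \<in> test_functions \<Omega>"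
  by (simp add: test_functions_def elementary_smooth_imp_smooth elementary_smooth.const)

lemma smooth_on_partial_deriv: "smooth_on S f \<Longrightarrow> smooth_on S (partial_deriv i f)"
proof -
  have "iterated_partial is (partial_deriv i f) = iterated_partial (is @ [i]) f" for "is"
    by (induction "is") auto
  then show "smooth_on S f \<Longrightarrow> smooth_on S (partial_deriv i f)"
    by (auto simp: smooth_on_def)
qed

lemma smooth_on_differentiable: "smooth_on S f \<Longrightarrow> x \<in> S \<Longrightarrow> f differentiable (at x)"
  unfolding smooth_on_def by (metis iterated_partial.simps(1))

lemma test_differentiable: "\<phi> \<in> test_functions \<Omega> \<Longrightarrow> \<phi> differentiable (at x)"
  by (auto simp: test_functions_def intro: smooth_on_differentiable)

lemma test_zero_outside: "x \<notin> closure {x. \<phi> x \<noteq> 0} \<Longrightarrow> \<phi> x = 0"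
  using closure_subset[of "{x. \<phi> x \<noteq> 0}"] by auto

lemma partial_deriv_zero_outside:
  assumes "x \<notin> closure {x. \<phi> x \<noteq> 0}" shows "partial_deriv i \<phi> x = 0"
proof -
  have "(\<phi> has_derivative (\<lambda>h. 0)) (at x)"
    by (rule has_derivative_transform_within_open[where f="\<lambda>x. 0" and s="- closure {x. \<phi> x \<noteq> 0}"])
       (use assms in \<open>auto dest: test_zero_outside\<close>)
  then show ?thesis by (simp add: has_derivative_partial_deriv)
qed

lemma partial_deriv_test_function:
  assumes "\<phi> \<in> test_functions \<Omega>" shows "partial_deriv i \<phi> \<in> test_functions \<Omega>"
proof -
  have "{x. partial_deriv i \<phi> x \<noteq> 0} \<subseteq> closure {x. \<phi> x \<noteq> 0}"
    using partial_deriv_zero_outside by blast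
  then have *: "closure {x. partial_deriv i \<phi> x \<noteq> 0} \<subseteq> closure {x. \<phi> x \<noteq> 0}"
    by (simp add: closure_minimal)
  then have "compact (closure {x. partial_deriv i \<phi> x \<noteq> 0})"
    using assms compact_Int_closed[of "closure {x. \<phi> x \<noteq> 0}" "closure {x. partial_deriv i \<phi> x \<noteq> 0}"]
    by (simp add: test_functions_def Int_absorb1)
  with * assms show ?thesis
    by (auto simp: test_functions_def smooth_on_partial_deriv)
qed

lemma test_continuous: "\<phi> \<in> test_functions \<Omega> \<Longrightarrow> continuous_on S \<phi>"
  by (meson continuous_at_imp_continuous_on differentiable_imp_continuous_within test_differentiable)

lemma test_bounded:
  assumes "\<phi> \<in> test_functions \<Omega>" obtains B where "0 \<le> B" "\<And>x. \<bar>\<phi> x\<bar> \<le> B"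
proof -
  have "compact (\<phi> ` closure {x. \<phi> x \<noteq> 0})"
    using assms by (intro compact_continuous_image test_continuous) (auto simp: test_functions_def)
  then obtain B where B: "\<And>y. y \<in> \<phi> ` closure {x. \<phi> x \<noteq> 0} \<Longrightarrow> norm y \<le> B"
    by (meson bounded_iff compact_imp_bounded)
  have "\<bar>\<phi> x\<bar> \<le> max B 0" for x
    using B[of "\<phi> x"] test_zero_outside[of x \<phi>] by fastforce
  then show ?thesis using that[of "max B 0"] by auto
qed

lemma test_lipschitz:
  assumes "\<phi> \<in> test_functions \<Omega>" obtains L where "L-lipschitz_on UNIV \<phi>"
proof -
  have "\<forall>i. \<exists>B\<ge>0. \<forall>x. \<bar>partial_deriv i \<phi> x\<bar> \<le> B"
    using partial_deriv_test_function[OF assms] test_bounded by metis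
  then obtain B where B: "\<And>i. 0 \<le> B i" "\<And>i x. \<bar>partial_deriv i \<phi> x\<bar> \<le> B i" by metis
  have "(\<Sum>i\<in>UNIV. B i)-lipschitz_on UNIV \<phi>"
  proof (rule bounded_derivative_imp_lipschitz)
    show "(\<phi> has_derivative frechet_derivative \<phi> (at x)) (at x within UNIV)" for x
      using frechet_derivative_works test_differentiable[OF assms] by blast
    show "onorm (frechet_derivative \<phi> (at x)) \<le> (\<Sum>i\<in>UNIV. B i)" for x
    proof (rule onorm_le)
      fix v
      have "norm (frechet_derivative \<phi> (at x) v) \<le> (\<Sum>i\<in>UNIV. \<bar>v$i * partial_deriv i \<phi> x\<bar>)"
        unfolding frechet_derivative_eq_sum_partial_deriv[OF test_differentiable[OF assms]]
        by (simp add: sum_abs)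
      also have "\<dots> \<le> (\<Sum>i\<in>UNIV. norm v * B i)"
        using B component_le_norm_cart by (intro sum_mono) (auto simp: abs_mult intro!: mult_mono)
      finally show "norm (frechet_derivative \<phi> (at x) v) \<le> (\<Sum>i\<in>UNIV. B i) * norm v"
        by (simp add: sum_distrib_left mult.commute)
    qed
  qed (auto intro: sum_nonneg B)
  then show ?thesis using that by blast
qed

text \<open>This is the kernel of the convolution at \<open>x\<close>, as a function of the
  integration variable. Testing a weak identity with it turns the identity into a statement about
  mollifications.\<close>

lemma mollifier_shift_test_function:
  assumes "0 < r" "cball x r \<subseteq> \<Omega>"
  shows "(\<lambda>z. mollifier r (x - z)) \<in> test_functions \<Omega>"
proof -
  have "{z. mollifier r (x - z) \<noteq> 0} \<subseteq> cball x r"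
    using mollifier_support[OF assms(1)] by (auto simp: dist_norm)
  then have c: "closure {z. mollifier r (x - z) \<noteq> 0} \<subseteq> cball x r"
    by (simp add: closure_minimal)
  then have "compact (closure {z. mollifier r (x - z) \<noteq> 0})"
    by (meson bounded_cball bounded_subset closed_closure compact_eq_bounded_closed)
  with c assms show ?thesis
    by (auto simp: test_functions_def intro!: elementary_smooth_imp_smooth elementary_smooth_reflect mollifier_elementary)
qed

lemma mollifier_test_function: "0 < r \<Longrightarrow> mollifier r \<in> test_functions UNIV"
  using mollifier_shift_test_function[of r 0 UNIV] by (simp add: mollifier_minus)

subsection \<open>Rademacher's theorem\<close>

text \<open>Differentiability comes from the Radon-Nikodym theorem. Adding
  \<open>(L + 1) * x\<close> to \<open>f\<close> gives an increasing \<open>F\<close> with slopes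
  between 1 and \<open>2 * L + 1\<close>, hence a bijection with 1-Lipschitz inverse
  \<open>G\<close>. The image of Lebesgue measure under \<open>G\<close> assigns to \<open>A\<close>
  the measure of its image under \<open>F\<close>, and is absolutely continuous because
  \<open>F\<close> is Lipschitz. Its density has integral \<open>F d - F c\<close> over
  \<open>{c..d}\<close>, and the Lebesgue differentiation theorem recovers the slope.\<close>

lemma lipschitz_real_right_derivative:
  fixes f :: "real \<Rightarrow> real"
  assumes L: "L-lipschitz_on UNIV f"
  shows "\<exists>N. negligible N \<and> (\<forall>x. x \<notin> N \<longrightarrow> (\<exists>D. ((\<lambda>t. (f (x + t) - f x) / t) \<longlongrightarrow> D) (at_right 0)))"
proof -
  have fL: "\<bar>f x - f y\<bar> \<le> L * \<bar>x - y\<bar>" for x y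
    using lipschitz_onD[OF L, of x y] by (simp add: dist_real_def)
  define F where "F x = f x + (L + 1) * x" for x
  have F_low: "y - x \<le> F y - F x" and F_up: "F y - F x \<le> (2 * L + 1) * (y - x)" if "x \<le> y" for x y
    using fL[of y x] that by (auto simp: F_def algebra_simps)
  have F_iff: "F x \<le> F y \<longleftrightarrow> x \<le> y" for x y
    using F_low[of x y] F_low[of y x] by linarith
  have F_inj: "F x = F y \<longleftrightarrow> x = y" for x y
    using F_iff[of x y] F_iff[of y x] by auto
  have F_cont: "continuous_on A F" for A
    unfolding F_def using lipschitz_on_continuous_on[OF L]
    by (auto intro!: continuous_intros intro: continuous_on_subset)
  have "\<exists>x. F x = y" for y
  proof -
    let ?b = "\<bar>y - F 0\<bar>"
    have "F (- ?b) \<le> y" "y \<le> F ?b"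
      using F_low[of "- ?b" 0] F_low[of 0 ?b] by linarith+
    then show ?thesis
      using IVT'[of F "- ?b" y ?b] F_cont by auto
  qed
  then obtain G where FG: "F (G y) = y" for y by metis
  have GF: "G (F x) = x" for x using FG F_inj by metis
  have "1-lipschitz_on UNIV G"
  proof (rule lipschitz_onI)
    fix u v show "dist (G u) (G v) \<le> 1 * dist u v"
      using F_low[of "G u" "G v"] F_low[of "G v" "G u"]
      by (cases "G u \<le> G v") (auto simp: FG dist_real_def)
  qed simp
  then have G_meas[measurable]: "G \<in> borel_measurable borel"
    by (intro borel_measurable_continuous_onI lipschitz_on_continuous_on)
  have vim: "G -` A = F ` A" for A
    using FG GF by (auto simp: image_iff) metis
  let ?\<mu> = "distr lborel borel G"
  have ac: "absolutely_continuous lborel ?\<mu>"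
    unfolding absolutely_continuous_def
  proof
    fix A :: "real set" assume A: "A \<in> null_sets lborel"
    then have Ab: "A \<in> sets borel" by auto
    have "negligible (F ` A)"
    proof (rule negligible_locally_Lipschitz_image)
      show "negligible A"
        using A null_sets_completionI by (auto simp: negligible_iff_null_sets)
      show "\<exists>T B. open T \<and> x \<in> T \<and> (\<forall>y\<in>A \<inter> T. norm (F y - F x) \<le> B * norm (y - x))" for x
      proof (intro exI[of _ UNIV] exI[of _ "2 * L + 1"] conjI ballI)
        show "norm (F y - F x) \<le> (2 * L + 1) * norm (y - x)" for y
          using F_low[of x y] F_up[of x y] F_low[of y x] F_up[of y x] by (cases "x \<le> y") auto
      qed auto
    qed simp
    moreover have "F ` A \<in> sets borel"
      using measurable_sets[OF G_meas Ab] by (simp add: vim)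
    ultimately have "emeasure lborel (F ` A) = 0"
      by (simp add: negligible_iff_null_sets null_sets_def)
    then show "A \<in> null_sets ?\<mu>"
      using Ab by (auto simp: null_sets_def emeasure_distr vim)
  qed
  obtain g where g[measurable]: "g \<in> borel_measurable lborel" and dens: "density lborel g = ?\<mu>"
    using sigma_finite_measure.Radon_Nikodym[OF sigma_finite_lborel ac] by auto
  have int_g: "(\<integral>\<^sup>+x. g x * indicator {c..d} x \<partial>lborel) = ennreal (F d - F c)" if "c \<le> d" for c d
  proof -
    have "(\<integral>\<^sup>+x. g x * indicator {c..d} x \<partial>lborel) = emeasure (density lborel g) {c..d}"
      by (simp add: emeasure_density)
    also have "\<dots> = emeasure lborel (G -` {c..d})"
      by (simp add: dens emeasure_distr)
    also have "G -` {c..d} = {F c..F d}"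
      using F_iff FG by auto (metis F_iff FG)+
    finally show ?thesis using F_iff that by simp
  qed
  \<comment> \<open>The density is finite almost everywhere because its integral over every bounded
    interval is; this justifies its replacement by a real function.\<close>
  have fin: "AE x in lborel. g x \<noteq> \<infinity>"
  proof -
    have "AE x in lborel. \<forall>n::nat. g x * indicator {-real n..real n} x \<noteq> \<infinity>"
      unfolding AE_all_countable
      by (intro allI nn_integral_noteq_infinite) (auto simp: int_g)
    then show ?thesis
    proof (eventually_elim)
      fix x assume *: "\<forall>n::nat. g x * indicator {-real n..real n} x \<noteq> \<infinity>"
      obtain n :: nat where "\<bar>x\<bar> \<le> real n" using real_arch_simple by blast
      then have "x \<in> {-real n..real n}" by auto
      with * show "g x \<noteq> \<infinity>" by (metis indicator_simps(1) mult.right_neutral)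
    qed
  qed
  define k where "k x = enn2real (g x)" for x
  have [measurable]: "k \<in> borel_measurable borel"
    using g unfolding k_def by simp
  have k_int: "(k has_integral (F d - F c)) {c..d}" if "c \<le> d" for c d
  proof -
    have "(\<integral>\<^sup>+x. ennreal (if x \<in> {c..d} then k x else 0) \<partial>lborel) = (\<integral>\<^sup>+x. g x * indicator {c..d} x \<partial>lborel)"
      using fin by (intro nn_integral_cong_AE) (auto simp: k_def less_top)
    then have "((\<lambda>x. if x \<in> {c..d} then k x else 0) has_integral (F d - F c)) UNIV"
      using F_iff that by (intro nn_integral_has_integral) (auto simp: k_def[abs_def] int_g simp del: atLeastAtMost_iff)
    then show ?thesis by (simp add: has_integral_restrict_UNIV del: atLeastAtMost_iff)
  qed
  have "k integrable_on cbox a b" for a b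
    using k_int[of a b] by (cases "a \<le> b") (auto simp: integrable_on_def)
  \<comment> \<open>The averages are taken over \<open>{x..x + h}\<close> with \<open>x\<close> at
    the left end, which is why right derivatives come out.\<close>
  then obtain N where N: "negligible N" "\<And>x e. \<lbrakk>x \<notin> N; 0 < e\<rbrakk> \<Longrightarrow>
      \<exists>d>0. \<forall>h. 0 < h \<and> h < d \<longrightarrow> norm (integral (cbox x (x + h *\<^sub>R One)) k /\<^sub>R h ^ DIM(real) - k x) < e"
    using integrable_ccontinuous_explicit[of k] by metis
  have "((\<lambda>t. (f (x + t) - f x) / t) \<longlongrightarrow> k x - (L + 1)) (at_right 0)" if x: "x \<notin> N" for x
  proof (rule tendstoI)
    fix e :: real assume "0 < e"
    from N(2)[OF x this] obtain d where d: "d > 0"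
      "\<And>h. 0 < h \<Longrightarrow> h < d \<Longrightarrow> \<bar>integral {x..x + h} k / h - k x\<bar> < e" by (auto simp: field_simps)
    have "dist ((f (x + h) - f x) / h) (k x - (L + 1)) < e" if h: "0 < h" "h < d" for h
    proof -
      have "integral {x..x + h} k = F (x + h) - F x"
        using k_int[of x "x + h"] h by (simp add: integral_unique)
      then have "integral {x..x + h} k / h = (f (x + h) - f x) / h + (L + 1)"
        using h by (simp add: F_def field_simps)
      with d(2)[OF h] show ?thesis by (simp add: dist_real_def)
    qed
    with d(1) show "\<forall>\<^sub>F t in at_right 0. dist ((f (x + t) - f x) / t) (k x - (L + 1)) < e"
      by (auto simp: eventually_at_right_field)
  qed
  with N(1) show ?thesis by blast
qed

text \<open>In the Cauchy form the limit quantifiers range over natural numbers and the inequality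
  is not strict. For a quotient that depends continuously on a parameter, each inner condition is
  closed, so the set of parameters with a limit is Borel.\<close>

lemma tendsto_at_right_0_Cauchy_iff:
  fixes g :: "real \<Rightarrow> real"
  shows "(\<exists>D. (g \<longlongrightarrow> D) (at_right 0)) \<longleftrightarrow>
    (\<forall>n::nat. \<exists>m::nat. \<forall>s t. 0 < s \<and> s < 1 / Suc m \<and> 0 < t \<and> t < 1 / Suc m \<longrightarrow> \<bar>g s - g t\<bar> \<le> 1 / Suc n)"
  (is "?l \<longleftrightarrow> ?r")
proof
  assume ?l
  then obtain D where D: "(g \<longlongrightarrow> D) (at_right 0)" by blast
  show ?r
  proof
    fix n :: nat
    have "\<forall>\<^sub>F t in at_right 0. dist (g t) D < 1 / (2 * Suc n)"
      by (rule tendstoD[OF D]) auto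
    then obtain b where b: "b > 0" "\<And>t. 0 < t \<Longrightarrow> t < b \<Longrightarrow> \<bar>g t - D\<bar> < 1 / (2 * Suc n)"
      by (auto simp: eventually_at_right_field dist_real_def)
    obtain m :: nat where m: "1 / Suc m < b"
      using b(1) nat_approx_posE by blast
    have "\<bar>g s - g t\<bar> \<le> 1 / Suc n" if "0 < s" "s < 1 / Suc m" "0 < t" "t < 1 / Suc m" for s t
    proof -
      have "\<bar>g s - g t\<bar> \<le> 2 * (1 / (2 * Suc n))"
        using b(2)[of s] b(2)[of t] that m by linarith
      moreover have "2 * (1 / real (2 * Suc n)) = 1 / Suc n" by (simp add: field_simps)
      ultimately show ?thesis by metis
    qed
    then show "\<exists>m::nat. \<forall>s t. 0 < s \<and> s < 1 / Suc m \<and> 0 < t \<and> t < 1 / Suc m \<longrightarrow> \<bar>g s - g t\<bar> \<le> 1 / Suc n"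
      by blast
  qed
next
  assume r: ?r
  have small: "\<exists>m::nat. \<forall>s t. 0 < s \<and> s < 1 / Suc m \<and> 0 < t \<and> t < 1 / Suc m \<longrightarrow> \<bar>g s - g t\<bar> < e"
    if e: "e > 0" for e
  proof -
    obtain n :: nat where n: "1 / Suc n < e" using e nat_approx_posE by blast
    from r obtain m :: nat where "\<forall>s t. 0 < s \<and> s < 1 / Suc m \<and> 0 < t \<and> t < 1 / Suc m \<longrightarrow> \<bar>g s - g t\<bar> \<le> 1 / Suc n"
      by blast
    then show ?thesis using n by (intro exI[of _ m]) fastforce
  qed
  \<comment> \<open>The sequence runs through \<open>1 / (k + 2)\<close>, which lies strictly below
    \<open>1 / (m + 1)\<close> for all \<open>k \<ge> m\<close>, as the strict bounds
    demand.\<close>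
  have lt: "1 / real (Suc (Suc k)) < 1 / Suc m" if "m \<le> k" for m k
    using that by (simp add: field_simps)
  have "Cauchy (\<lambda>k::nat. g (1 / Suc (Suc k)))"
  proof (rule metric_CauchyI)
    fix e :: real assume "0 < e"
    then obtain m :: nat where m: "\<And>s t. 0 < s \<Longrightarrow> s < 1 / Suc m \<Longrightarrow> 0 < t \<Longrightarrow> t < 1 / Suc m \<Longrightarrow> \<bar>g s - g t\<bar> < e"
      using small by blast
    then show "\<exists>M. \<forall>k\<ge>M. \<forall>l\<ge>M. dist (g (1 / Suc (Suc k))) (g (1 / Suc (Suc l))) < e"
      using lt by (intro exI[of _ m]) (simp add: dist_real_def del: of_nat_Suc)
  qed
  then obtain D where D: "(\<lambda>k::nat. g (1 / Suc (Suc k))) \<longlonglongrightarrow> D"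
    using Cauchy_convergent_iff convergent_def by blast
  have "(g \<longlongrightarrow> D) (at_right 0)"
  proof (rule tendstoI)
    fix e :: real assume e: "0 < e"
    then obtain m :: nat where m: "\<And>s t. 0 < s \<Longrightarrow> s < 1 / Suc m \<Longrightarrow> 0 < t \<Longrightarrow> t < 1 / Suc m \<Longrightarrow> \<bar>g s - g t\<bar> < e / 2"
      using small[of "e/2"] by auto
    have "dist (g t) D < e" if t: "0 < t" "t < 1 / Suc m" for t
    proof -
      have "\<bar>g t - D\<bar> \<le> e / 2"
      proof (rule LIMSEQ_le_const2)
        show "(\<lambda>k. \<bar>g t - g (1 / Suc (Suc k))\<bar>) \<longlonglongrightarrow> \<bar>g t - D\<bar>"
          by (intro tendsto_intros D)
        show "\<exists>N. \<forall>k\<ge>N. \<bar>g t - g (1 / Suc (Suc k))\<bar> \<le> e / 2"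
          using m[OF t] lt by (intro exI[of _ m]) (simp add: less_imp_le del: of_nat_Suc)
      qed
      then show ?thesis using e by (simp add: dist_real_def)
    qed
    then show "\<forall>\<^sub>F t in at_right 0. dist (g t) D < e"
      unfolding eventually_at_right_field by (intro exI[of _ "1 / Suc m"]) (auto simp del: of_nat_Suc)
  qed
  then show ?l by blast
qed

text \<open>By the one-dimensional result each line in direction \<open>v\<close> meets the
  exceptional Borel set \<open>N\<close> in a null set of parameters. Coordinates adapted to
  \<open>v\<close> are avoided by translation invariance: the measure of \<open>N\<close> is its
  average over the translates by multiples \<open>t\<close> of \<open>v\<close> with
  \<open>t\<close> in \<open>{0..1}\<close>, and exchanging the integrals leaves the measure of the
  bad parameters on each line, which is 0.\<close>

lemma lipschitz_directional_derivative_AE: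
  fixes f :: "'a::euclidean_space \<Rightarrow> real"
  assumes L: "L-lipschitz_on UNIV f"
  shows "AE x in lborel. \<exists>D. ((\<lambda>t. (f (x + t *\<^sub>R v) - f x) / t) \<longlongrightarrow> D) (at_right 0)"
proof -
  define q where "q x t = (f (x + t *\<^sub>R v) - f x) / t" for x t
  define good where "good = {x. \<exists>D. (q x \<longlongrightarrow> D) (at_right 0)}"
  have contf: "continuous_on UNIV f" using L by (rule lipschitz_on_continuous_on)
  have contq: "continuous_on UNIV (\<lambda>x. q x t)" for t
  proof -
    have "continuous_on UNIV (\<lambda>x. f (x + t *\<^sub>R v))"
      by (rule continuous_on_compose2[OF contf]) (auto intro!: continuous_intros)
    then show ?thesis unfolding q_def divide_inverse using contf by (intro continuous_intros)
  qed
  have "good = (\<Inter>n::nat. \<Union>m::nat. \<Inter>s\<in>{0<..<1 / Suc m}. \<Inter>t\<in>{0<..<1 / Suc m}. {x. \<bar>q x s - q x t\<bar> \<le> 1 / Suc n})"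
    unfolding good_def tendsto_at_right_0_Cauchy_iff
    by (rule set_eqI) (simp only: mem_Collect_eq INT_iff UN_iff Ball_def Bex_def UNIV_I simp_thms greaterThanLessThan_iff, blast)
  moreover have "(\<Inter>s\<in>{0<..<1 / Suc m}. \<Inter>t\<in>{0<..<1 / Suc m}. {x. \<bar>q x s - q x t\<bar> \<le> 1 / Suc n}) \<in> sets borel"
    for m n :: nat
    by (intro borel_closed closed_INT ballI closed_Collect_le continuous_intros contq)
  ultimately have good[measurable]: "good \<in> sets borel" by auto
  define N where "N = - good"
  have N[measurable]: "N \<in> sets borel" by (auto simp: N_def)
  have line: "AE t in lborel. x + t *\<^sub>R v \<notin> N" for x
  proof -
    have "(L * norm v)-lipschitz_on UNIV (\<lambda>t. f (x + t *\<^sub>R v))"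
    proof (rule lipschitz_onI)
      fix s t :: real
      have "dist (f (x + s *\<^sub>R v)) (f (x + t *\<^sub>R v)) \<le> L * dist (x + s *\<^sub>R v) (x + t *\<^sub>R v)"
        using L by (rule lipschitz_onD) auto
      also have "dist (x + s *\<^sub>R v) (x + t *\<^sub>R v) = norm v * dist s t"
        by (simp add: dist_norm flip: scaleR_diff_left)
      finally show "dist (f (x + s *\<^sub>R v)) (f (x + t *\<^sub>R v)) \<le> L * norm v * dist s t" by simp
    qed (use lipschitz_on_nonneg[OF L] in auto)
    from lipschitz_real_right_derivative[OF this] obtain M where M: "negligible M" "\<And>t. t \<notin> M \<Longrightarrow>
      \<exists>D. ((\<lambda>h. (f (x + (t + h) *\<^sub>R v) - f (x + t *\<^sub>R v)) / h) \<longlongrightarrow> D) (at_right 0)"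
      by blast
    have "x + t *\<^sub>R v \<notin> N" if "t \<notin> M" for t
      using M(2)[OF that] by (simp add: N_def good_def q_def[abs_def] scaleR_add_left add.assoc)
    then have "AE t in lebesgue. x + t *\<^sub>R v \<notin> N"
      using M(1) by (intro AE_I'[of M]) (auto simp: negligible_iff_null_sets)
    then show ?thesis by (subst (asm) AE_completion_iff) auto
  qed
  have shift: "(\<integral>\<^sup>+x. indicator N (x + t *\<^sub>R v) \<partial>lborel) = emeasure lborel N" for t
  proof -
    have "(\<integral>\<^sup>+x. indicator N (t *\<^sub>R v + x) \<partial>lborel) = (\<integral>\<^sup>+x. indicator N x \<partial>distr lborel borel ((+) (t *\<^sub>R v)))"
      by (subst nn_integral_distr) auto
    also have "\<dots> = emeasure lborel N"
      unfolding lborel_distr_plus by simp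
    finally show ?thesis by (simp add: add.commute)
  qed
  have "emeasure lborel N = (\<integral>\<^sup>+t. emeasure lborel N * indicator {0..1::real} t \<partial>lborel)"
    by (simp add: nn_integral_cmult)
  also have "\<dots> = (\<integral>\<^sup>+t. (\<integral>\<^sup>+x. indicator N (x + t *\<^sub>R v) * indicator {0..1::real} t \<partial>lborel) \<partial>lborel)"
    by (simp add: nn_integral_multc shift)
  also have "\<dots> = (\<integral>\<^sup>+x. (\<integral>\<^sup>+t. indicator N (x + t *\<^sub>R v) * indicator {0..1::real} t \<partial>lborel) \<partial>lborel)"
    by (rule lborel_pair.Fubini') measurable
  also have "\<dots> = (\<integral>\<^sup>+x. 0 \<partial>(lborel::'a measure))"
  proof (rule nn_integral_cong)
    fix x
    have "AE t in lborel. indicator N (x + t *\<^sub>R v) * indicator {0..1::real} t = (0::ennreal)"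
      using line[of x] by eventually_elim simp
    then show "(\<integral>\<^sup>+t. indicator N (x + t *\<^sub>R v) * indicator {0..1::real} t \<partial>lborel) = 0"
      by (subst nn_integral_0_iff_AE) auto
  qed
  finally have "N \<in> null_sets lborel" by auto
  then show ?thesis
    by (intro AE_I'[of N]) (auto simp: N_def good_def q_def[abs_def])
qed

section \<open>Integration by parts for Lipschitz functions\<close>

lemma integrable_continuous_bounded_support:
  fixes g :: "'a::euclidean_space \<Rightarrow> 'b::euclidean_space"
  assumes "continuous_on UNIV g" "\<And>x. norm x > R \<Longrightarrow> g x = 0"
  shows "integrable lborel g"
proof -
  have "integrable lborel (\<lambda>x. indicator (cball 0 R) x *\<^sub>R g x)"
    by (rule borel_integrable_compact) (auto intro: continuous_on_subset[OF assms(1)])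
  moreover have "(\<lambda>x. indicator (cball 0 R) x *\<^sub>R g x) = g"
    using assms(2) by (force simp: indicator_def)
  ultimately show ?thesis by simp
qed

lemma test_bounded_support:
  assumes "\<phi> \<in> test_functions \<Omega>" obtains R where "0 < R" "\<And>x. norm x > R \<Longrightarrow> \<phi> x = 0"
proof -
  have "bounded (closure {x. \<phi> x \<noteq> 0})"
    using assms compact_imp_bounded by (auto simp: test_functions_def)
  then obtain R where R: "\<And>x. x \<in> closure {x. \<phi> x \<noteq> 0} \<Longrightarrow> norm x \<le> R"
    by (auto simp: bounded_iff)
  have "\<phi> x = 0" if "norm x > max R 1" for x
    using R[of x] test_zero_outside[of x \<phi>] that by fastforce
  then show ?thesis using that[of "max R 1"] by auto
qed

lemma integral_lborel_translate:
  fixes g :: "'a::euclidean_space \<Rightarrow> 'b::{banach, second_countable_topology}"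
  assumes "g \<in> borel_measurable borel"
  shows "(LINT x|lborel. g (x + c)) = integral\<^sup>L lborel g"
proof -
  have "integral\<^sup>L lborel g = integral\<^sup>L (distr lborel borel ((+) c)) g"
    by (simp add: lborel_distr_plus)
  also have "\<dots> = (LINT x|lborel. g (c + x))"
    using assms by (subst integral_distr) auto
  finally show ?thesis by (simp add: add.commute)
qed

text \<open>Derivatives are read off along the step sizes \<open>1 / (k + 1)\<close> only. A
  sequence is what dominated convergence takes, and it exhibits the derivative as a limit of Borel
  functions.\<close>

lemma has_derivative_imp_quotient_limit:
  assumes "(f has_derivative f') (at x)"
  shows "(\<lambda>k. real (Suc k) *\<^sub>R (f (x + (1 / real (Suc k)) *\<^sub>R v) - f x)) \<longlonglongrightarrow> f' v"
proof -
  have "((\<lambda>t. f (x + t *\<^sub>R v)) has_derivative (\<lambda>t. f' (t *\<^sub>R v))) (at 0)"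
    by (rule has_derivative_compose[where g=f and f="\<lambda>t. x + t *\<^sub>R v", simplified])
       (auto intro!: derivative_eq_intros assms)
  moreover have "(\<lambda>t. f' (t *\<^sub>R v)) = (\<lambda>t. t *\<^sub>R f' v)"
    using has_derivative_bounded_linear[OF assms] by (auto simp: bounded_linear.linear linear_cmul)
  ultimately have "((\<lambda>t. f (x + t *\<^sub>R v)) has_vector_derivative f' v) (at 0)"
    by (simp add: has_vector_derivative_def)
  then have "((\<lambda>h. (f (x + h *\<^sub>R v) - f x - h *\<^sub>R f' v) /\<^sub>R \<bar>h\<bar>) \<longlongrightarrow> 0) (at 0)"
    by (simp add: has_vector_derivative_def has_derivative_at_within)
  then have "((\<lambda>h. norm ((f (x + h *\<^sub>R v) - f x - h *\<^sub>R f' v) /\<^sub>R \<bar>h\<bar>)) \<longlongrightarrow> 0) (at 0)"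
    by (rule tendsto_norm_zero)
  moreover have "\<forall>\<^sub>F h in at 0. norm ((f (x + h *\<^sub>R v) - f x - h *\<^sub>R f' v) /\<^sub>R \<bar>h\<bar>)
      = norm ((f (x + h *\<^sub>R v) - f x) /\<^sub>R h - f' v)"
  proof (rule eventually_at_topological[THEN iffD2], intro exI[of _ UNIV] conjI ballI impI)
    fix h :: real assume "h \<noteq> 0"
    then have "(f (x + h *\<^sub>R v) - f x) /\<^sub>R h - f' v = (f (x + h *\<^sub>R v) - f x - h *\<^sub>R f' v) /\<^sub>R h"
      by (simp add: scaleR_diff_right)
    then show "norm ((f (x + h *\<^sub>R v) - f x - h *\<^sub>R f' v) /\<^sub>R \<bar>h\<bar>) = norm ((f (x + h *\<^sub>R v) - f x) /\<^sub>R h - f' v)"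
      by simp
  qed auto
  ultimately have "((\<lambda>h. norm ((f (x + h *\<^sub>R v) - f x) /\<^sub>R h - f' v)) \<longlongrightarrow> 0) (at 0)"
    by (rule Lim_transform_eventually)
  then have "((\<lambda>h. (f (x + h *\<^sub>R v) - f x) /\<^sub>R h) \<longlongrightarrow> f' v) (at 0)"
    by (simp add: tendsto_norm_zero_iff LIM_zero_iff)
  moreover have "filterlim (\<lambda>k. 1 / real (Suc k)) (at 0) sequentially"
    unfolding filterlim_at using LIMSEQ_inverse_real_of_nat by (auto simp: inverse_eq_divide)
  ultimately have "(\<lambda>k. (f (x + (1 / real (Suc k)) *\<^sub>R v) - f x) /\<^sub>R (1 / real (Suc k))) \<longlonglongrightarrow> f' v"
    by (rule filterlim_compose)
  then show ?thesis by simp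
qed

lemma lipschitz_quotient_bound:
  assumes L: "L-lipschitz_on UNIV f"
  shows "norm (real (Suc k) *\<^sub>R (f (x + (1 / real (Suc k)) *\<^sub>R v) - f x)) \<le> L * norm v"
proof -
  have "norm (f (x + (1 / real (Suc k)) *\<^sub>R v) - f x) \<le> L * norm ((1 / real (Suc k)) *\<^sub>R v)"
    using lipschitz_on_normD[OF L, of "x + (1 / real (Suc k)) *\<^sub>R v" x] by simp
  also have "\<dots> = L * norm v / real (Suc k)" by simp
  finally have "real (Suc k) * norm (f (x + (1 / real (Suc k)) *\<^sub>R v) - f x) \<le> L * norm v"
    by (simp add: pos_le_divide_eq mult.commute del: of_nat_Suc)
  then show ?thesis by (simp only: norm_scaleR abs_of_nat)
qed

text \<open>Discrete integration by parts: a difference quotient is moved from \<open>f\<close> to \<open>\<phi>\<close> by translation.\<close>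

lemma lipschitz_integration_by_parts:
  fixes f :: "real^'n::finite \<Rightarrow> 'b::euclidean_space"
  assumes L: "L-lipschitz_on UNIV f" and \<phi>: "\<phi> \<in> test_functions \<Omega>"
    and D: "AE x in lebesgue. (\<lambda>k. real (Suc k) *\<^sub>R (f (x + (1 / real (Suc k)) *\<^sub>R v) - f x)) \<longlonglongrightarrow> D x"
  shows "D \<in> borel_measurable lebesgue"
    and "integrable lebesgue (\<lambda>x. \<phi> x *\<^sub>R D x)"
    and "(LINT x|lebesgue. \<phi> x *\<^sub>R D x) = - (LINT x|lebesgue. frechet_derivative \<phi> (at x) v *\<^sub>R f x)"
proof -
  define q where "q k x = real (Suc k) *\<^sub>R (f (x + (1 / real (Suc k)) *\<^sub>R v) - f x)" for k x
  have contf: "continuous_on UNIV f" using L by (rule lipschitz_on_continuous_on)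
  have cont_shift: "continuous_on UNIV (\<lambda>x. f (x + c))" for c
    by (rule continuous_on_compose2[OF contf]) (auto intro!: continuous_intros)
  have [measurable]: "f \<in> borel_measurable borel" "\<phi> \<in> borel_measurable borel"
    using contf test_continuous[OF \<phi>] by (auto intro: borel_measurable_continuous_onI)
  have q_meas[measurable]: "q k \<in> borel_measurable borel" for k
    unfolding q_def by measurable
  have q_bound: "norm (q k x) \<le> L * norm v" for k x
    unfolding q_def by (rule lipschitz_quotient_bound[OF L])
  have limD: "AE x in lebesgue. (\<lambda>k. q k x) \<longlonglongrightarrow> D x" using D by (simp add: q_def)
  \<comment> \<open>\<open>D\<close> agrees almost everywhere with the pointwise \<open>lim\<close>
    of Borel functions, and Lebesgue measure is complete; thus measurability of \<open>D\<close> is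
    a conclusion and not a premise.\<close>
  have "AE x in lebesgue. lim (\<lambda>k. q k x) = D x"
    using limD by eventually_elim (rule limI)
  moreover have "(\<lambda>x. lim (\<lambda>k. q k x)) \<in> borel_measurable lebesgue"
    by (intro borel_measurable_lim_metric measurable_completion) measurable
  ultimately show Dm: "D \<in> borel_measurable lebesgue"
    by (rule borel_measurable_AE[rotated])
  obtain R where R: "0 < R" "\<And>x. norm x > R \<Longrightarrow> \<phi> x = 0" using test_bounded_support[OF \<phi>] by blast
  obtain B where B: "0 \<le> B" "\<And>x. \<bar>\<phi> x\<bar> \<le> B" using test_bounded[OF \<phi>] by blast
  obtain M where M: "M-lipschitz_on UNIV \<phi>" using test_lipschitz[OF \<phi>] .
  have \<phi>int: "integrable lebesgue \<phi>"
    using integrable_continuous_bounded_support[OF test_continuous[OF \<phi>] R(2)]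
    by (simp add: integrable_completion)
  then have dom1: "integrable lebesgue (\<lambda>x. \<bar>\<phi> x\<bar> * (L * norm v))"
    by auto
  have bnd1: "AE x in lebesgue. norm (\<phi> x *\<^sub>R q k x) \<le> \<bar>\<phi> x\<bar> * (L * norm v)" for k
    using q_bound by (auto intro!: mult_left_mono)
  have lim1: "AE x in lebesgue. (\<lambda>k. \<phi> x *\<^sub>R q k x) \<longlonglongrightarrow> \<phi> x *\<^sub>R D x"
    using limD by eventually_elim (intro tendsto_intros)
  have meas1: "(\<lambda>x. \<phi> x *\<^sub>R q k x) \<in> borel_measurable lebesgue" for k
    by (intro measurable_completion) measurable
  have meas2: "(\<lambda>x. \<phi> x *\<^sub>R D x) \<in> borel_measurable lebesgue"
    using Dm \<phi>int by (intro borel_measurable_scaleR) auto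
  show "integrable lebesgue (\<lambda>x. \<phi> x *\<^sub>R D x)"
    by (rule integrable_dominated_convergence[OF meas2 meas1 dom1 lim1 bnd1])
  have conv1: "(\<lambda>k. LINT x|lebesgue. \<phi> x *\<^sub>R q k x) \<longlonglongrightarrow> (LINT x|lebesgue. \<phi> x *\<^sub>R D x)"
    by (rule integral_dominated_convergence[OF meas2 meas1 dom1 lim1 bnd1])
  \<comment> \<open>The difference quotient after the translation: it now acts on \<phi>, with the
    step reversed, and converges to minus the derivative of \<phi> along \<open>v\<close>.\<close>
  define p where "p k x = (real (Suc k) * (\<phi> (x - (1 / real (Suc k)) *\<^sub>R v) - \<phi> x)) *\<^sub>R f x" for k x
  have eq: "(LINT x|lebesgue. \<phi> x *\<^sub>R q k x) = (LINT x|lebesgue. p k x)" for k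
  proof -
    let ?c = "(1 / real (Suc k)) *\<^sub>R v"
    have i1: "integrable lborel (\<lambda>x. \<phi> x *\<^sub>R f (x + ?c))"
      using R(2) by (intro integrable_continuous_bounded_support[of _ R] continuous_intros test_continuous[OF \<phi>] cont_shift) auto
    have i2: "integrable lborel (\<lambda>x. \<phi> x *\<^sub>R f x)"
      using R(2) by (intro integrable_continuous_bounded_support[of _ R] continuous_intros test_continuous[OF \<phi>] contf) auto
    have i3: "integrable lborel (\<lambda>x. \<phi> (x - ?c) *\<^sub>R f x)"
    proof (rule integrable_continuous_bounded_support[of _ "R + norm ?c"])
      show "continuous_on UNIV (\<lambda>x. \<phi> (x - ?c) *\<^sub>R f x)"
        by (intro continuous_intros contf continuous_on_compose2[OF test_continuous[OF \<phi>, of UNIV]]) auto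
      show "\<phi> (x - ?c) *\<^sub>R f x = 0" if "norm x > R + norm ?c" for x
        using R(2)[of "x - ?c"] norm_triangle_ineq2[of x ?c] that by auto
    qed
    have sh: "(LINT x|lborel. \<phi> x *\<^sub>R f (x + ?c)) = (LINT x|lborel. \<phi> (x - ?c) *\<^sub>R f x)"
      using integral_lborel_translate[of "\<lambda>x. \<phi> (x - ?c) *\<^sub>R f x" ?c] by simp
    have "(LINT x|lebesgue. \<phi> x *\<^sub>R q k x) = (LINT x|lborel. \<phi> x *\<^sub>R q k x)"
      by (rule integral_completion) measurable
    also have "\<dots> = (LINT x|lborel. real (Suc k) *\<^sub>R (\<phi> x *\<^sub>R f (x + ?c) - \<phi> x *\<^sub>R f x))"
      by (simp add: q_def scaleR_diff_right mult.commute)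
    also have "\<dots> = real (Suc k) *\<^sub>R ((LINT x|lborel. \<phi> x *\<^sub>R f (x + ?c)) - (LINT x|lborel. \<phi> x *\<^sub>R f x))"
      using i1 i2 by simp
    also have "\<dots> = real (Suc k) *\<^sub>R ((LINT x|lborel. \<phi> (x - ?c) *\<^sub>R f x) - (LINT x|lborel. \<phi> x *\<^sub>R f x))"
      by (simp only: sh)
    also have "\<dots> = (LINT x|lborel. real (Suc k) *\<^sub>R (\<phi> (x - ?c) *\<^sub>R f x - \<phi> x *\<^sub>R f x))"
      using i3 i2 by simp
    also have "\<dots> = (LINT x|lborel. p k x)"
      by (simp add: p_def scaleR_diff_right right_diff_distrib scaleR_diff_left)
    also have "\<dots> = (LINT x|lebesgue. p k x)"
      unfolding p_def by (rule integral_completion[symmetric]) measurable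
    finally show ?thesis .
  qed
  have lim2: "(\<lambda>k. p k x) \<longlonglongrightarrow> - (frechet_derivative \<phi> (at x) v *\<^sub>R f x)" for x
  proof -
    have "(\<phi> has_derivative frechet_derivative \<phi> (at x)) (at x)"
      using test_differentiable[OF \<phi>] by (simp add: frechet_derivative_works)
    from has_derivative_imp_quotient_limit[OF this, of "- v"]
    have "(\<lambda>k. p k x) \<longlonglongrightarrow> frechet_derivative \<phi> (at x) (- v) *\<^sub>R f x"
      unfolding p_def by (intro tendsto_intros) simp
    then show ?thesis
      by (simp add: linear_neg[OF linear_frechet_derivative[OF test_differentiable[OF \<phi>]]])
  qed
  obtain C where C: "\<And>x. x \<in> cball 0 (R + norm v) \<Longrightarrow> norm (f x) \<le> C"
    using compact_imp_bounded[OF compact_continuous_image[OF continuous_on_subset[OF contf] compact_cball[of 0 "R + norm v"]]]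
    unfolding bounded_iff by blast
  \<comment> \<open>All steps \<open>1 / (k + 1)\<close> are at most 1, so every translated support
    stays within distance \<open>norm v\<close> of the ball of radius \<open>R\<close>.\<close>
  have bnd2: "norm (p k x) \<le> indicator (cball 0 (R + norm v)) x * (M * norm v * C)" for k x
  proof (cases "x \<in> cball 0 (R + norm v)")
    case True
    have h1: "real (Suc k) * \<bar>\<phi> (x - (1 / real (Suc k)) *\<^sub>R v) - \<phi> x\<bar> \<le> M * norm v"
      using lipschitz_quotient_bound[OF M, of k x "- v"] by (simp add: abs_mult)
    have "0 \<le> M * norm v" using lipschitz_on_nonneg[OF M] by auto
    then have "norm (p k x) \<le> M * norm v * C"
      using mult_mono[OF h1 C[OF True] _ norm_ge_zero] by (simp only: p_def norm_scaleR abs_mult abs_of_nat)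
    then show ?thesis using True by simp
  next
    case False
    then have x: "norm x > R + norm v" by simp
    moreover have "norm ((1 / real (Suc k)) *\<^sub>R v) \<le> norm v" by (simp add: field_simps)
    ultimately have "norm (x - (1 / real (Suc k)) *\<^sub>R v) > R" "norm x > R"
      using norm_triangle_ineq2[of x "(1 / real (Suc k)) *\<^sub>R v"] norm_ge_zero[of v] by linarith+
    then show ?thesis using R(2) False by (simp add: p_def)
  qed
  have "(\<lambda>k. LINT x|lebesgue. p k x) \<longlonglongrightarrow> (LINT x|lebesgue. - (frechet_derivative \<phi> (at x) v *\<^sub>R f x))"
  proof (rule integral_dominated_convergence)
    show "integrable lebesgue (\<lambda>x. indicator (cball 0 (R + norm v)) x * (M * norm v * C))"
      by (intro integrable_mult_left)
         (auto intro!: integrable_real_indicator simp: emeasure_lborel_cball_finite[unfolded infinity_ennreal_def])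
    show pm: "p k \<in> borel_measurable lebesgue" for k
      unfolding p_def by (intro measurable_completion) measurable
    show "(\<lambda>x. - (frechet_derivative \<phi> (at x) v *\<^sub>R f x)) \<in> borel_measurable lebesgue"
      by (rule borel_measurable_LIMSEQ_metric[OF pm lim2])
  qed (auto intro: lim2 bnd2)
  with conv1 show "(LINT x|lebesgue. \<phi> x *\<^sub>R D x) = - (LINT x|lebesgue. frechet_derivative \<phi> (at x) v *\<^sub>R f x)"
    using LIMSEQ_unique by (auto simp: eq)
qed

section \<open>Continuity of translations in L1 and mollification\<close>

lemma lebesgue_measurable_borel_representative:
  fixes f :: "'a::euclidean_space \<Rightarrow> 'b::euclidean_space"
  assumes "f \<in> borel_measurable lebesgue"
  obtains g where "g \<in> borel_measurable borel" "AE x in lebesgue. f x = g x"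
proof -
  have "\<exists>g. g \<in> borel_measurable borel \<and> (AE x in lborel. f x \<bullet> b = g x)" for b
    using completion_ex_borel_measurable_real[of "\<lambda>x. f x \<bullet> b" lborel] assms by auto
  then obtain g where g: "\<And>b. g b \<in> borel_measurable borel" "\<And>b. AE x in lborel. f x \<bullet> b = g b x" by metis
  show ?thesis
  proof
    show "(\<lambda>x. \<Sum>b\<in>Basis. g b x *\<^sub>R b) \<in> borel_measurable borel"
      using g(1) by measurable
    have "AE x in lborel. \<forall>b\<in>Basis. f x \<bullet> b = g b x"
      using g(2) by (intro AE_finite_allI) auto
    then have "AE x in lborel. f x = (\<Sum>b\<in>Basis. g b x *\<^sub>R b)"
      by eventually_elim (metis (mono_tags, lifting) euclidean_representation sum.cong)
    then show "AE x in lebesgue. f x = (\<Sum>b\<in>Basis. g b x *\<^sub>R b)"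
      by (simp add: AE_completion_iff)
  qed
qed

lemma borel_finite_measure_compact_open:
  fixes A :: "'a::euclidean_space set"
  assumes A: "A \<in> sets borel" "emeasure lborel A < \<infinity>" and e: "0 < (e::real)"
  obtains K U where "compact K" "open U" "K \<subseteq> A" "A \<subseteq> U" "emeasure lborel (U - K) < e"
proof -
  have "\<exists>U. open U \<and> A \<subseteq> U \<and> emeasure lborel (U - A) < ennreal (e/2)"
    by (rule outer_regular_lborel[OF A(1) half_gt_zero[OF e]]) blast
  then obtain U where U: "open U" "A \<subseteq> U" "emeasure lborel (U - A) < ennreal (e/2)"
    by blast
  have "A \<in> sets lebesgue" using A by simp
  then have "\<exists>T. closed T \<and> T \<subseteq> A \<and> emeasure lebesgue (A - T) < ennreal (e/2)"
    by (rule sets_lebesgue_inner_closed[OF _ half_gt_zero[OF e]]) blast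
  then obtain T where T: "closed T" "T \<subseteq> A" "emeasure lebesgue (A - T) < ennreal (e/2)"
    by blast
  \<comment> \<open>Inner regularity yields a closed set \<open>T\<close>. Intersecting it with
    growing balls makes it compact, and the loss \<open>X n\<close> decreases to
    \<open>A - T\<close>, which has small measure.\<close>
  define X where "X n = A - T \<inter> cball 0 (real n)" for n :: nat
  have Xm: "X n \<in> sets borel" for n using A T unfolding X_def by auto
  have "(\<lambda>n. emeasure lborel (X n)) \<longlonglongrightarrow> emeasure lborel (\<Inter>n. X n)"
  proof (rule Lim_emeasure_decseq)
    show "decseq X" unfolding X_def decseq_def by auto
    show "emeasure lborel (X i) \<noteq> \<infinity>" for i
      using emeasure_mono[of "X i" A lborel] A by (auto simp: X_def top_unique)
  qed (use Xm in auto)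
  moreover have "(\<Inter>n. X n) = A - T"
    using real_arch_simple by (auto simp: X_def)
  ultimately have "(\<lambda>n. emeasure lborel (X n)) \<longlonglongrightarrow> emeasure lborel (A - T)" by simp
  moreover have "emeasure lborel (A - T) < ennreal (e/2)"
    using T A by simp
  ultimately have "eventually (\<lambda>n. emeasure lborel (X n) < ennreal (e/2)) sequentially"
    by (rule order_tendstoD)
  then obtain n where n: "emeasure lborel (X n) < ennreal (e/2)" by (auto simp: eventually_sequentially)
  show ?thesis
  proof
    show "compact (T \<inter> cball 0 (real n))" using T by (simp add: closed_Int_compact)
    show "T \<inter> cball 0 (real n) \<subseteq> A" using T by auto
    have "emeasure lborel (U - T \<inter> cball 0 (real n)) \<le> emeasure lborel ((U - A) \<union> X n)"
      using A U Xm by (intro emeasure_mono) (auto simp: X_def)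
    also have "\<dots> \<le> emeasure lborel (U - A) + emeasure lborel (X n)"
      using A U Xm by (intro emeasure_subadditive) auto
    also have "\<dots> < ennreal (e/2) + ennreal (e/2)"
      using U(3) n by (rule add_strict_mono)
    also have "\<dots> = e" using e by (simp flip: ennreal_plus)
    finally show "emeasure lborel (U - T \<inter> cball 0 (real n)) < e" .
  qed (use U in auto)
qed

lemma nn_integral_lborel_translate:
  fixes g :: "'a::euclidean_space \<Rightarrow> ennreal"
  assumes "g \<in> borel_measurable borel"
  shows "(\<integral>\<^sup>+x. g (x + c) \<partial>lborel) = (\<integral>\<^sup>+x. g x \<partial>lborel)"
proof -
  have "(\<integral>\<^sup>+x. g x \<partial>lborel) = (\<integral>\<^sup>+x. g x \<partial>distr lborel borel ((+) c))"
    by (simp add: lborel_distr_plus)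
  also have "\<dots> = (\<integral>\<^sup>+x. g (c + x) \<partial>lborel)"
    using assms by (subst nn_integral_distr) auto
  finally show ?thesis by (simp add: add.commute)
qed

text \<open>Induction over integrable functions. For an indicator, \<open>A\<close> is enclosed
  between a compact \<open>K\<close> and an open \<open>U\<close>; a shift that keeps
  \<open>K\<close> inside \<open>U\<close> in both directions changes the indicator only where
  \<open>x\<close> or \<open>x + z\<close> lies in the thin set \<open>U - K\<close>. A sum costs
  two errors, a dominated limit three.\<close>

lemma L1_translation_continuous:
  fixes f :: "'a::euclidean_space \<Rightarrow> 'b::euclidean_space"
  assumes "integrable lborel f"
  shows "\<forall>e>0. \<exists>\<delta>>0. \<forall>z. norm z < \<delta> \<longrightarrow> (\<integral>\<^sup>+x. ennreal (norm (f (x + z) - f x)) \<partial>lborel) \<le> ennreal e"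
  using assms
proof (induction rule: integrable_induct)
  case (base A c)
  then have A: "A \<in> sets borel" "emeasure lborel A < \<infinity>" by auto
  show ?case
  proof (intro allI impI)
    fix e :: real assume "0 < e"
    \<comment> \<open>The summand 1 avoids division by zero for \<open>c = 0\<close>; the final
      bound is \<open>2 * norm c * e'\<close>.\<close>
    define e' where "e' = e / 2 / (norm c + 1)"
    have e': "0 < e'" using \<open>0 < e\<close> unfolding e'_def
      by (intro divide_pos_pos mult_pos_pos add_nonneg_pos) auto
    have e'': "2 * (norm c * e') \<le> e"
    proof -
      have "norm c + 1 \<noteq> 0" using norm_ge_zero[of c] by linarith
      then have "(norm c + 1) * e' = e / 2" unfolding e'_def by (metis nonzero_mult_div_cancel_left times_divide_eq_right)
      moreover have "norm c * e' \<le> (norm c + 1) * e'" using e' by simp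
      ultimately show ?thesis by linarith
    qed
    obtain K U where KU: "compact K" "open U" "K \<subseteq> A" "A \<subseteq> U" "emeasure lborel (U - K) < ennreal e'"
      using borel_finite_measure_compact_open[OF A e'] by blast
    obtain \<delta> where \<delta>: "\<delta> > 0" "(\<Union>x\<in>K. ball x \<delta>) \<subseteq> U"
      using compact_subset_open_imp_ball_epsilon_subset[of K U] KU by blast
    have m: "U - K \<in> sets borel" using KU by (auto intro: borel_compact)
    have "(\<integral>\<^sup>+x. ennreal (norm (indicator A (x + z) *\<^sub>R c - indicator A x *\<^sub>R c)) \<partial>lborel) \<le> ennreal e"
      if z: "norm z < \<delta>" for z
    proof -
      have "(\<integral>\<^sup>+x. ennreal (norm (indicator A (x + z) *\<^sub>R c - indicator A x *\<^sub>R c)) \<partial>lborel)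
          \<le> (\<integral>\<^sup>+x. ennreal (norm c) * (indicator (U - K) x + indicator (U - K) (x + z)) \<partial>lborel)"
      proof (rule nn_integral_mono)
        fix x
        have shift: "x \<in> K \<Longrightarrow> x + z \<in> U" "x + z \<in> K \<Longrightarrow> x \<in> U"
          using \<delta>(2) z by (force simp: dist_norm)+
        show "ennreal (norm (indicator A (x + z) *\<^sub>R c - indicator A x *\<^sub>R c))
           \<le> ennreal (norm c) * (indicator (U - K) x + indicator (U - K) (x + z))"
          using KU shift
          by (cases "x \<in> A"; cases "x + z \<in> A"; cases "x \<in> K"; cases "x + z \<in> K")
             (auto simp: indicator_def distrib_left subset_iff)
      qed
      also have "\<dots> = ennreal (norm c) * (emeasure lborel (U - K) + emeasure lborel (U - K))"
        using m nn_integral_lborel_translate[of "indicator (U - K)" z]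
        by (simp add: nn_integral_cmult nn_integral_add)
      also have "\<dots> \<le> ennreal (norm c) * (ennreal e' + ennreal e')"
        using KU(5) by (intro mult_left_mono add_mono) auto
      also have "\<dots> = ennreal (2 * (norm c * e'))"
        using e' by (simp flip: ennreal_plus ennreal_mult add: algebra_simps)
      also have "\<dots> \<le> ennreal e" using e'' by (rule ennreal_leI)
      finally show ?thesis .
    qed
    with \<delta>(1) show "\<exists>\<delta>>0. \<forall>z. norm z < \<delta> \<longrightarrow>
       (\<integral>\<^sup>+x. ennreal (norm (indicator A (x + z) *\<^sub>R c - indicator A x *\<^sub>R c)) \<partial>lborel) \<le> ennreal e"
      by blast
  qed
next
  case (add f g)
  note [measurable] = borel_measurable_integrable[OF add.hyps(1), simplified] borel_measurable_integrable[OF add.hyps(2), simplified]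
  show ?case
  proof (intro allI impI)
    fix e :: real assume "0 < e"
    then have e2: "0 < e/2" by simp
    obtain d1 where d1: "d1 > 0"
      "\<And>z. norm z < d1 \<Longrightarrow> (\<integral>\<^sup>+x. ennreal (norm (f (x + z) - f x)) \<partial>lborel) \<le> ennreal (e/2)"
      using add.IH(1)[rule_format, OF e2] by blast
    obtain d2 where d2: "d2 > 0"
      "\<And>z. norm z < d2 \<Longrightarrow> (\<integral>\<^sup>+x. ennreal (norm (g (x + z) - g x)) \<partial>lborel) \<le> ennreal (e/2)"
      using add.IH(2)[rule_format, OF e2] by blast
    note d = d1 d2
    have "(\<integral>\<^sup>+x. ennreal (norm ((f (x + z) + g (x + z)) - (f x + g x))) \<partial>lborel) \<le> ennreal e"
      if "norm z < min d1 d2" for z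
    proof -
      have "(\<integral>\<^sup>+x. ennreal (norm ((f (x + z) + g (x + z)) - (f x + g x))) \<partial>lborel)
         \<le> (\<integral>\<^sup>+x. ennreal (norm (f (x + z) - f x)) + ennreal (norm (g (x + z) - g x)) \<partial>lborel)"
        by (intro nn_integral_mono) (auto simp flip: ennreal_plus intro!: ennreal_leI norm_diff_triangle_ineq)
      also have "\<dots> = (\<integral>\<^sup>+x. ennreal (norm (f (x + z) - f x)) \<partial>lborel) + (\<integral>\<^sup>+x. ennreal (norm (g (x + z) - g x)) \<partial>lborel)"
        by (rule nn_integral_add) measurable
      also have "\<dots> \<le> ennreal (e/2) + ennreal (e/2)"
        using d that by (intro add_mono) auto
      also have "\<dots> = ennreal e" using \<open>0 < e\<close> by (simp flip: ennreal_plus)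
      finally show ?thesis .
    qed
    then show "\<exists>\<delta>>0. \<forall>z. norm z < \<delta> \<longrightarrow>
       (\<integral>\<^sup>+x. ennreal (norm ((f (x + z) + g (x + z)) - (f x + g x))) \<partial>lborel) \<le> ennreal e"
      using d by (intro exI[of _ "min d1 d2"]) auto
  qed
next
  case (lim f s)
  note [measurable] = borel_measurable_integrable[OF lim.hyps(4), simplified] borel_measurable_integrable[OF lim.hyps(1), simplified]
  show ?case
  proof (intro allI impI)
    fix e :: real assume "0 < e"
    have "(\<lambda>i. \<integral>\<^sup>+x. ennreal (norm (f x - s i x)) \<partial>lborel) \<longlonglongrightarrow> 0"
    proof (rule nn_integral_dominated_convergence_norm[where w="\<lambda>x. 2 * norm (f x)"])
      show "integral\<^sup>N lborel (\<lambda>x. ennreal (2 * norm (f x))) < \<infinity>"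
        using lim.hyps(4)
        by (simp add: integrable_iff_bounded ennreal_mult nn_integral_cmult ennreal_mult_less_top)
    qed (use lim.hyps in auto)
    then have "eventually (\<lambda>i. (\<integral>\<^sup>+x. ennreal (norm (f x - s i x)) \<partial>lborel) < ennreal (e/3)) sequentially"
      using \<open>0 < e\<close> by (intro order_tendstoD) auto
    then have "eventually (\<lambda>i. (\<integral>\<^sup>+x. ennreal (norm (s i x - f x)) \<partial>lborel) < ennreal (e/3)) sequentially"
      by (simp only: norm_minus_commute)
    then obtain i where i: "(\<integral>\<^sup>+x. ennreal (norm (s i x - f x)) \<partial>lborel) < ennreal (e/3)"
      by (auto simp: eventually_sequentially)
    have e3: "0 < e/3" using \<open>0 < e\<close> by simp
    obtain d where d: "d > 0"
      "\<And>z. norm z < d \<Longrightarrow> (\<integral>\<^sup>+x. ennreal (norm (s i (x + z) - s i x)) \<partial>lborel) \<le> ennreal (e/3)"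
      using lim.IH[of i, rule_format, OF e3] by blast
    have "(\<integral>\<^sup>+x. ennreal (norm (f (x + z) - f x)) \<partial>lborel) \<le> ennreal e" if "norm z < d" for z
    proof -
      have "(\<integral>\<^sup>+x. ennreal (norm (f (x + z) - f x)) \<partial>lborel)
         \<le> (\<integral>\<^sup>+x. ennreal (norm (s i (x + z) - f (x + z))) + (ennreal (norm (s i (x + z) - s i x))
               + ennreal (norm (s i x - f x))) \<partial>lborel)"
      proof (intro nn_integral_mono)
        fix x
        have "f (x + z) - f x = - (s i (x + z) - f (x + z)) + ((s i (x + z) - s i x) + (s i x - f x))" by simp
        then have "norm (f (x + z) - f x) \<le> norm (s i (x + z) - f (x + z)) + (norm (s i (x + z) - s i x) + norm (s i x - f x))"
          by (metis norm_minus_cancel norm_triangle_mono norm_triangle_ineq order_refl)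
        then show "ennreal (norm (f (x + z) - f x)) \<le> ennreal (norm (s i (x + z) - f (x + z))) + (ennreal (norm (s i (x + z) - s i x))
               + ennreal (norm (s i x - f x)))"
          by (simp flip: ennreal_plus add: ennreal_leI)
      qed
      also have "\<dots> = (\<integral>\<^sup>+x. ennreal (norm (s i (x + z) - f (x + z))) \<partial>lborel) + ((\<integral>\<^sup>+x. ennreal (norm (s i (x + z) - s i x)) \<partial>lborel)
               + (\<integral>\<^sup>+x. ennreal (norm (s i x - f x)) \<partial>lborel))"
        by (simp add: nn_integral_add)
      also have "(\<integral>\<^sup>+x. ennreal (norm (s i (x + z) - f (x + z))) \<partial>lborel) = (\<integral>\<^sup>+x. ennreal (norm (s i x - f x)) \<partial>lborel)"
        by (rule nn_integral_lborel_translate) measurable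
      also have "\<dots> + ((\<integral>\<^sup>+x. ennreal (norm (s i (x + z) - s i x)) \<partial>lborel) + (\<integral>\<^sup>+x. ennreal (norm (s i x - f x)) \<partial>lborel))
          \<le> ennreal (e/3) + (ennreal (e/3) + ennreal (e/3))"
        using i d(2)[OF that] by (intro add_mono) auto
      also have "\<dots> = ennreal e" using \<open>0 < e\<close> by (simp flip: ennreal_plus)
      finally show ?thesis .
    qed
    with d(1) show "\<exists>\<delta>>0. \<forall>z. norm z < \<delta> \<longrightarrow> (\<integral>\<^sup>+x. ennreal (norm (f (x + z) - f x)) \<partial>lborel) \<le> ennreal e"
      by blast
  qed
qed

text \<open>The kernel is an argument because derivatives fall on it: a partial derivative of a
  mollification is a mollification of the same \<open>f\<close> with a differentiated kernel, which
  is the invariant for the coinductive proof of smoothness.\<close>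

definition mollify :: "(real^'n::finite \<Rightarrow> real) \<Rightarrow> (real^'n \<Rightarrow> 'b::euclidean_space) \<Rightarrow> real^'n \<Rightarrow> 'b" where
  "mollify \<eta> f x = (LINT z|lebesgue. \<eta> (x - z) *\<^sub>R f z)"

lemma test_borel_measurable: "\<phi> \<in> test_functions \<Omega> \<Longrightarrow> \<phi> \<in> borel_measurable borel"
  by (intro borel_measurable_continuous_onI test_continuous)

lemma mollify_integrable:
  fixes f :: "real^'n::finite \<Rightarrow> 'b::euclidean_space"
  assumes \<eta>: "\<eta> \<in> test_functions UNIV" and f: "integrable lebesgue f"
  shows "integrable lebesgue (\<lambda>z. \<eta> (x - z) *\<^sub>R f z)"
proof -
  obtain B where B: "0 \<le> B" "\<And>x. \<bar>\<eta> x\<bar> \<le> B" using test_bounded[OF \<eta>] by blast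
  have [measurable]: "\<eta> \<in> borel_measurable borel" using \<eta> by (rule test_borel_measurable)
  have "(\<lambda>z. \<eta> (x - z)) \<in> borel_measurable lebesgue"
    by (intro measurable_completion) measurable
  then have m: "(\<lambda>z. \<eta> (x - z) *\<^sub>R f z) \<in> borel_measurable lebesgue"
    using f by (intro borel_measurable_scaleR) auto
  have b: "norm (\<eta> (x - z) *\<^sub>R f z) \<le> norm (B *\<^sub>R f z)" for z
    using B by (auto intro!: mult_right_mono)
  have i: "integrable lebesgue (\<lambda>z. B *\<^sub>R f z)" using f by simp
  show ?thesis
    by (rule Bochner_Integration.integrable_bound[OF i m AE_I2[OF b]])
qed

lemma mollify_lipschitz:
  fixes f :: "real^'n::finite \<Rightarrow> 'b::euclidean_space"
  assumes \<eta>: "\<eta> \<in> test_functions UNIV" and f: "integrable lebesgue f"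
  obtains L where "L-lipschitz_on UNIV (mollify \<eta> f)"
proof -
  obtain M where M: "M-lipschitz_on UNIV \<eta>" using test_lipschitz[OF \<eta>] by blast
  have "(M * (LINT z|lebesgue. norm (f z)))-lipschitz_on UNIV (mollify \<eta> f)"
  proof (rule lipschitz_onI)
    fix x y
    have i: "integrable lebesgue (\<lambda>z. \<eta> (x - z) *\<^sub>R f z)" "integrable lebesgue (\<lambda>z. \<eta> (y - z) *\<^sub>R f z)"
      using mollify_integrable[OF \<eta> f] by auto
    have "dist (mollify \<eta> f x) (mollify \<eta> f y) = norm (LINT z|lebesgue. (\<eta> (x - z) - \<eta> (y - z)) *\<^sub>R f z)"
      unfolding mollify_def dist_norm using i by (simp add: scaleR_diff_left)
    also have "\<dots> \<le> (LINT z|lebesgue. (M * dist x y) * norm (f z))"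
    proof (rule Bochner_Integration.integral_norm_bound_integral)
      show "integrable lebesgue (\<lambda>z. (\<eta> (x - z) - \<eta> (y - z)) *\<^sub>R f z)"
        using i by (simp add: scaleR_diff_left)
      show "norm ((\<eta> (x - z) - \<eta> (y - z)) *\<^sub>R f z) \<le> (M * dist x y) * norm (f z)" for z
        using lipschitz_onD[OF M, of "x - z" "y - z"] by (auto simp: dist_norm intro!: mult_right_mono)
    qed (use f in auto)
    also have "\<dots> = M * (LINT z|lebesgue. norm (f z)) * dist x y"
      by (simp add: mult_ac)
    finally show "dist (mollify \<eta> f x) (mollify \<eta> f y) \<le> M * (LINT z|lebesgue. norm (f z)) * dist x y" .
  qed (use lipschitz_on_nonneg[OF M] in auto)
  then show ?thesis using that by blast
qed

text \<open>Differentiation under the integral, for the total derivative. The remainder quotient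
  \<open>r k z\<close> tends to 0 for each \<open>z\<close> and is bounded, uniformly in
  \<open>z\<close>, by the Lipschitz constant of \<eta> plus the bounds of its partial derivatives,
  so a multiple of \<open>norm (f z)\<close> dominates.\<close>

lemma mollify_has_derivative:
  fixes f :: "real^'n::finite \<Rightarrow> 'b::euclidean_space"
  assumes \<eta>: "\<eta> \<in> test_functions UNIV" and f: "integrable lebesgue f"
  shows "(mollify \<eta> f has_derivative (\<lambda>v. \<Sum>i\<in>UNIV. v$i *\<^sub>R mollify (partial_deriv i \<eta>) f x)) (at x)"
proof -
  let ?D = "\<lambda>v. \<Sum>i\<in>UNIV. v$i *\<^sub>R mollify (partial_deriv i \<eta>) f x"
  obtain M where M: "M-lipschitz_on UNIV \<eta>" using test_lipschitz[OF \<eta>] by blast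
  have "\<forall>i. \<exists>B\<ge>0. \<forall>x. \<bar>partial_deriv i \<eta> x\<bar> \<le> B"
    using partial_deriv_test_function[OF \<eta>] test_bounded by metis
  then obtain B where B: "\<And>i. 0 \<le> B i" "\<And>i x. \<bar>partial_deriv i \<eta> x\<bar> \<le> B i" by metis
  define E where "E y v = (\<Sum>i\<in>UNIV. v$i * partial_deriv i \<eta> y)" for y v
  have E: "(\<eta> has_derivative E y) (at y)" for y
  proof -
    have "frechet_derivative \<eta> (at y) = E y"
      using frechet_derivative_eq_sum_partial_deriv[OF test_differentiable[OF \<eta>]] by (auto simp: E_def)
    then show ?thesis
      using test_differentiable[OF \<eta>, of y] unfolding frechet_derivative_works by simp
  qed
  have E_bound: "\<bar>E y v\<bar> \<le> sum B UNIV * norm v" for y v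
  proof -
    have "\<bar>E y v\<bar> \<le> (\<Sum>i\<in>UNIV. \<bar>v$i * partial_deriv i \<eta> y\<bar>)" unfolding E_def by (rule sum_abs)
    also have "\<dots> \<le> (\<Sum>i\<in>UNIV. norm v * B i)"
      using B component_le_norm_cart by (intro sum_mono) (auto simp: abs_mult intro!: mult_mono)
    finally show ?thesis by (simp add: sum_distrib_left mult.commute)
  qed
  have int_i: "integrable lebesgue (\<lambda>z. partial_deriv i \<eta> (x - z) *\<^sub>R f z)" for i
    using mollify_integrable[OF partial_deriv_test_function[OF \<eta>] f] .
  have D_eq: "?D v = (LINT z|lebesgue. E (x - z) v *\<^sub>R f z)" for v
  proof -
    have "?D v = (\<Sum>i\<in>UNIV. LINT z|lebesgue. (v$i * partial_deriv i \<eta> (x - z)) *\<^sub>R f z)"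
      unfolding mollify_def by (simp flip: scaleR_scaleR)
    also have "\<dots> = (LINT z|lebesgue. (\<Sum>i\<in>UNIV. (v$i * partial_deriv i \<eta> (x - z)) *\<^sub>R f z))"
      using int_i by (subst Bochner_Integration.integral_sum) (auto simp flip: scaleR_scaleR)
    finally show ?thesis by (simp add: E_def scaleR_sum_left)
  qed
  have int_E: "integrable lebesgue (\<lambda>z. E (x - z) v *\<^sub>R f z)" for v
    unfolding E_def scaleR_sum_left using int_i by (auto simp flip: scaleR_scaleR)
  have "((\<lambda>h. norm (mollify \<eta> f (x + h) - mollify \<eta> f x - ?D h) / norm h) \<longlongrightarrow> 0) (at 0)"
    unfolding tendsto_at_iff_sequentially comp_def
  proof (intro allI impI)
    fix X :: "nat \<Rightarrow> real^'n" assume X0: "\<forall>i. X i \<in> UNIV - {0}" and X: "X \<longlonglongrightarrow> 0"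
    define r where "r k z = (\<eta> (x + X k - z) - \<eta> (x - z) - E (x - z) (X k)) / norm (X k)" for k z
    have r_int: "integrable lebesgue (\<lambda>z. r k z *\<^sub>R f z)" for k
    proof -
      have "integrable lebesgue (\<lambda>z. (1 / norm (X k)) *\<^sub>R (\<eta> (x + X k - z) *\<^sub>R f z - \<eta> (x - z) *\<^sub>R f z - E (x - z) (X k) *\<^sub>R f z))"
        using mollify_integrable[OF \<eta> f] int_E by (intro integrable_scaleR_right Bochner_Integration.integrable_diff) auto
      then show ?thesis by (simp add: r_def scaleR_diff_left divide_inverse mult.commute flip: scaleR_scaleR)
    qed
    have r_eq: "norm (mollify \<eta> f (x + X k) - mollify \<eta> f x - ?D (X k)) / norm (X k) = norm (LINT z|lebesgue. r k z *\<^sub>R f z)" for k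
    proof -
      have "mollify \<eta> f (x + X k) - mollify \<eta> f x - ?D (X k)
         = (LINT z|lebesgue. \<eta> (x + X k - z) *\<^sub>R f z - \<eta> (x - z) *\<^sub>R f z - E (x - z) (X k) *\<^sub>R f z)"
        unfolding D_eq unfolding mollify_def using mollify_integrable[OF \<eta> f] int_E by simp
      also have "\<dots> = (LINT z|lebesgue. norm (X k) *\<^sub>R (r k z *\<^sub>R f z))"
        using X0 by (intro Bochner_Integration.integral_cong) (auto simp: r_def scaleR_diff_left)
      also have "\<dots> = norm (X k) *\<^sub>R (LINT z|lebesgue. r k z *\<^sub>R f z)"
        by (rule Bochner_Integration.integral_scaleR_right)
      finally show ?thesis using X0 by simp
    qed
    have r_bound: "\<bar>r k z\<bar> \<le> M + sum B UNIV" for k z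
    proof -
      have n: "norm (X k) > 0" using X0 by simp
      have "\<bar>\<eta> (x + X k - z) - \<eta> (x - z)\<bar> \<le> M * norm (X k)"
        using lipschitz_on_normD[OF M, of "x + X k - z" "x - z"] by simp
      then have "\<bar>\<eta> (x + X k - z) - \<eta> (x - z) - E (x - z) (X k)\<bar> \<le> (M + sum B UNIV) * norm (X k)"
        using E_bound[of "x - z" "X k"] by (simp add: algebra_simps)
      then show ?thesis using n by (simp add: r_def field_simps)
    qed
    have r_lim: "(\<lambda>k. r k z) \<longlonglongrightarrow> 0" for z
    proof -
      have "((\<lambda>h. norm (\<eta> (x - z + h) - \<eta> (x - z) - E (x - z) h) / norm h) \<longlongrightarrow> 0) (at 0)"
        using E[of "x - z"] unfolding has_derivative_at by blast
      then have "(\<lambda>k. norm (\<eta> (x - z + X k) - \<eta> (x - z) - E (x - z) (X k)) / norm (X k)) \<longlonglongrightarrow> 0"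
        using X0 X unfolding tendsto_at_iff_sequentially comp_def by blast
      then have "(\<lambda>k. \<bar>r k z\<bar>) \<longlonglongrightarrow> 0" by (simp add: r_def algebra_simps)
      then show ?thesis by (rule tendsto_rabs_zero_cancel)
    qed
    have "(\<lambda>k. LINT z|lebesgue. r k z *\<^sub>R f z) \<longlonglongrightarrow> (LINT z|(lebesgue::(real^'n) measure). (0::'b))"
    proof (rule integral_dominated_convergence)
      show "integrable lebesgue (\<lambda>z. (M + sum B UNIV) * norm (f z))" using f by simp
      show "AE z in lebesgue. (\<lambda>k. r k z *\<^sub>R f z) \<longlonglongrightarrow> 0"
        using r_lim tendsto_scaleR[OF r_lim tendsto_const] by (auto intro!: AE_I2)
      show "AE z in lebesgue. norm (r k z *\<^sub>R f z) \<le> (M + sum B UNIV) * norm (f z)" for k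
        using r_bound by (auto intro!: AE_I2 mult_right_mono)
    qed (use r_int borel_measurable_integrable in auto)
    then have "(\<lambda>k. norm (LINT z|lebesgue. r k z *\<^sub>R f z)) \<longlonglongrightarrow> 0"
      using tendsto_norm by fastforce
    then show "(\<lambda>k. norm (mollify \<eta> f (x + X k) - mollify \<eta> f x - ?D (X k)) / norm (X k)) \<longlonglongrightarrow> 0"
      unfolding r_eq .
  qed
  moreover have "bounded_linear ?D"
    by (intro bounded_linear_sum bounded_linear_compose[OF bounded_linear_scaleR_left bounded_linear_vec_nth])
  ultimately show ?thesis unfolding has_derivative_at by blast
qed

lemma mollify_partial_deriv:
  fixes f :: "real^'n::finite \<Rightarrow> real"
  assumes "\<eta> \<in> test_functions UNIV" and "integrable lebesgue f"
  shows "partial_deriv i (mollify \<eta> f) = mollify (partial_deriv i \<eta>) f"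
  using has_derivative_partial_deriv[OF mollify_has_derivative[OF assms], of i]
  by (auto simp: fun_eq_iff axis_def if_distrib[of "\<lambda>x. x * _"] cong: if_cong)

lemma mollify_smooth:
  fixes f :: "real^'n::finite \<Rightarrow> real"
  assumes "\<eta> \<in> test_functions UNIV" and "integrable lebesgue f"
  shows "smooth_on UNIV (mollify \<eta> f)"
proof (rule smooth_on_UNIV_coinduct[where P="\<lambda>h. \<exists>\<eta>\<in>test_functions UNIV. h = mollify \<eta> f"])
  show "\<exists>\<eta>'\<in>test_functions UNIV. mollify \<eta> f = mollify \<eta>' f" using assms by blast
next
  fix h and x :: "real^'n" assume "\<exists>\<eta>\<in>test_functions UNIV. h = mollify \<eta> f"
  then show "h differentiable at x"
    using mollify_has_derivative[OF _ assms(2)] by (auto intro: differentiableI)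
next
  fix h and i :: 'n assume "\<exists>\<eta>\<in>test_functions UNIV. h = mollify \<eta> f"
  then show "\<exists>\<eta>\<in>test_functions UNIV. partial_deriv i h = mollify \<eta> f"
    using mollify_partial_deriv[OF _ assms(2)] partial_deriv_test_function by blast
qed

lemma mollify_support:
  assumes "0 < r" "\<And>z. z \<in> cball x r \<Longrightarrow> f z = 0"
  shows "mollify (mollifier r) f x = 0"
proof -
  have "mollifier r (x - z) *\<^sub>R f z = 0" for z
    using mollifier_support[OF assms(1), of "x - z"] assms(2)[of z] by (auto simp: dist_norm)
  then show ?thesis unfolding mollify_def by (simp only:) simp
qed

lemma mollify_test_function:
  fixes f :: "real^'n::finite \<Rightarrow> real"
  assumes r: "0 < r" and f: "integrable lebesgue f" and K: "compact K" "\<And>x. x \<notin> K \<Longrightarrow> f x = 0"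
    and sub: "(\<Union>x\<in>K. cball x r) \<subseteq> \<Omega>"
  shows "mollify (mollifier r) f \<in> test_functions \<Omega>"
proof -
  have c: "compact (\<Union>x\<in>K. cball x r)" using K(1) by (rule compact_minkowski_sum_cball)
  have "mollify (mollifier r) f x = 0" if "x \<notin> (\<Union>x\<in>K. cball x r)" for x
    using that by (intro mollify_support[OF r] K(2)) (auto simp: dist_commute)
  then have "{x. mollify (mollifier r) f x \<noteq> 0} \<subseteq> (\<Union>x\<in>K. cball x r)"
    by blast
  then have "closure {x. mollify (mollifier r) f x \<noteq> 0} \<subseteq> (\<Union>x\<in>K. cball x r)"
    by (intro closure_minimal compact_imp_closed c)
  moreover from this have "compact (closure {x. mollify (mollifier r) f x \<noteq> 0})"
    using c by (meson bounded_subset closed_closure compact_eq_bounded_closed)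
  ultimately show ?thesis
    using sub mollify_smooth[OF mollifier_test_function[OF r] f] by (auto simp: test_functions_def)
qed

lemma mollify_AE_cong:
  assumes "AE z in lebesgue. f z = g z" "f \<in> borel_measurable lebesgue" "g \<in> borel_measurable lebesgue"
    and \<eta>: "\<eta> \<in> test_functions UNIV"
  shows "mollify \<eta> f = mollify \<eta> g"
proof
  fix x
  have [measurable]: "\<eta> \<in> borel_measurable borel" using \<eta> by (rule test_borel_measurable)
  have "(\<lambda>z. \<eta> (x - z)) \<in> borel_measurable lebesgue"
    by (intro measurable_completion) measurable
  then show "mollify \<eta> f x = mollify \<eta> g x"
    unfolding mollify_def using assms by (intro integral_cong_AE borel_measurable_scaleR) auto
qed

text \<open>Since the kernel is even with integral 1, the error at \<open>x\<close> is an average of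
  \<open>g (y + x) - g x\<close> over \<open>norm y \<le> r\<close>. Exchanging the integrals bounds
  its L1 norm by the translation error of \<open>g\<close>. The Borel representative
  \<open>g\<close> makes the integrand measurable on the product space.\<close>

lemma mollify_L1_convergence:
  fixes f :: "real^'n::finite \<Rightarrow> 'b::euclidean_space"
  assumes f: "integrable lebesgue f" and e: "0 < (e::real)"
  shows "\<exists>\<delta>>0. \<forall>r. 0 < r \<and> r < \<delta> \<longrightarrow>
    (\<integral>\<^sup>+x. ennreal (norm (mollify (mollifier r) f x - f x)) \<partial>lebesgue) \<le> ennreal e"
proof -
  obtain g where g[measurable]: "g \<in> borel_measurable borel" and fg: "AE x in lebesgue. f x = g x"
    using lebesgue_measurable_borel_representative[of f] f by auto
  have gl: "g \<in> borel_measurable lebesgue" by (intro measurable_completion) simp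
  have gi: "integrable lebesgue g"
    using integrable_cong_AE[OF _ gl fg] f by auto
  then have gb: "integrable lborel g" by (subst (asm) integrable_completion) auto
  obtain \<delta> where \<delta>: "\<delta> > 0" "\<And>z. norm z < \<delta> \<Longrightarrow> (\<integral>\<^sup>+x. ennreal (norm (g (x + z) - g x)) \<partial>lborel) \<le> ennreal e"
    using L1_translation_continuous[OF gb] e by blast
  have "(\<integral>\<^sup>+x. ennreal (norm (mollify (mollifier r) f x - f x)) \<partial>lebesgue) \<le> ennreal e"
    if r: "0 < r" "r < \<delta>" for r
  proof -
    let ?\<eta> = "mollifier r :: real^'n \<Rightarrow> real"
    have \<eta>: "?\<eta> \<in> test_functions UNIV" using r mollifier_test_function by blast
    have [measurable]: "?\<eta> \<in> borel_measurable borel" using \<eta> by (rule test_borel_measurable)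
    have nn: "0 \<le> ?\<eta> y" for y by (rule mollifier_nonneg[OF r(1)])
    have m: "mollify ?\<eta> f = mollify ?\<eta> g"
      using fg f gl \<eta> by (intro mollify_AE_cong) auto
    have pw: "ennreal (norm (mollify ?\<eta> g x - g x)) \<le> (\<integral>\<^sup>+y. ennreal (?\<eta> y) * ennreal (norm (g (y + x) - g x)) \<partial>lborel)" for x
    proof -
      have i1: "integrable lborel (\<lambda>z. ?\<eta> (z - x) *\<^sub>R g z)"
        using mollify_integrable[OF \<eta> gi, of x] mollifier_minus[of r "x - z" for z]
        by (subst (asm) integrable_completion) auto
      have eq1: "mollify ?\<eta> g x = (LINT z|lborel. ?\<eta> (z - x) *\<^sub>R g z)"
        unfolding mollify_def using mollifier_minus[of r "x - z" for z]
        by (subst integral_completion) auto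
      have i2: "integrable lborel (\<lambda>z. ?\<eta> (z - x))"
      proof -
        have "integrable (distr lborel borel ((+) (- x))) ?\<eta>"
          using mollifier_integrable[OF r(1)] by (simp add: lborel_distr_plus)
        then show ?thesis by (subst (asm) integrable_distr_eq) auto
      qed
      have "(LINT z|lborel. ?\<eta> (z - x)) = 1"
        using integral_lborel_translate[of ?\<eta> "- x"] mollifier_integral[OF r(1)] by simp
      then have "mollify ?\<eta> g x - g x = (LINT z|lborel. ?\<eta> (z - x) *\<^sub>R g z) - (LINT z|lborel. ?\<eta> (z - x) *\<^sub>R g x)"
        using i2 by (simp add: eq1)
      also have "\<dots> = (LINT z|lborel. ?\<eta> (z - x) *\<^sub>R g z - ?\<eta> (z - x) *\<^sub>R g x)"
        using i1 i2 by (intro Bochner_Integration.integral_diff[symmetric]) auto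
      also have "ennreal (norm \<dots>) \<le> (\<integral>\<^sup>+z. ennreal (norm (?\<eta> (z - x) *\<^sub>R g z - ?\<eta> (z - x) *\<^sub>R g x)) \<partial>lborel)"
        using i1 i2 by (intro integral_norm_bound_ennreal) auto
      also have "\<dots> = (\<integral>\<^sup>+z. ennreal (?\<eta> (z - x)) * ennreal (norm (g z - g x)) \<partial>lborel)"
        by (intro nn_integral_cong) (simp add: ennreal_mult nn flip: scaleR_diff_right)
      also have "\<dots> = (\<integral>\<^sup>+y. ennreal (?\<eta> y) * ennreal (norm (g (y + x) - g x)) \<partial>lborel)"
        by (subst nn_integral_lborel_translate[of _ x, symmetric]) auto
      finally show ?thesis .
    qed
    have "(\<integral>\<^sup>+x. ennreal (norm (mollify ?\<eta> f x - f x)) \<partial>lebesgue) = (\<integral>\<^sup>+x. ennreal (norm (mollify ?\<eta> g x - g x)) \<partial>lebesgue)"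
      unfolding m using fg by (intro nn_integral_cong_AE) auto
    also have "\<dots> = (\<integral>\<^sup>+x. ennreal (norm (mollify ?\<eta> g x - g x)) \<partial>lborel)"
      by (rule nn_integral_completion)
    also have "\<dots> \<le> (\<integral>\<^sup>+x. (\<integral>\<^sup>+y. ennreal (?\<eta> y) * ennreal (norm (g (y + x) - g x)) \<partial>lborel) \<partial>lborel)"
      by (intro nn_integral_mono pw)
    also have "\<dots> = (\<integral>\<^sup>+y. (\<integral>\<^sup>+x. ennreal (?\<eta> y) * ennreal (norm (g (y + x) - g x)) \<partial>lborel) \<partial>lborel)"
      by (rule lborel_pair.Fubini') measurable
    also have "\<dots> \<le> (\<integral>\<^sup>+y. ennreal (?\<eta> y) * ennreal e \<partial>lborel)"
    proof (rule nn_integral_mono)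
      fix y :: "real^'n"
      have "(\<integral>\<^sup>+x. ennreal (?\<eta> y) * ennreal (norm (g (y + x) - g x)) \<partial>lborel)
          = ennreal (?\<eta> y) * (\<integral>\<^sup>+x. ennreal (norm (g (x + y) - g x)) \<partial>lborel)"
        by (subst nn_integral_cmult) (auto simp: add.commute)
      also have "\<dots> \<le> ennreal (?\<eta> y) * ennreal e"
      proof (cases "?\<eta> y = 0")
        case False
        then have "norm y < \<delta>" using mollifier_support[OF r(1)] r(2) by fastforce
        then show ?thesis using \<delta>(2) by (intro mult_left_mono) auto
      qed simp
      finally show "(\<integral>\<^sup>+x. ennreal (?\<eta> y) * ennreal (norm (g (y + x) - g x)) \<partial>lborel) \<le> ennreal (?\<eta> y) * ennreal e" .
    qed
    also have "\<dots> = (\<integral>\<^sup>+y. ennreal (?\<eta> y) \<partial>lborel) * ennreal e"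
      by (rule nn_integral_multc) measurable
    also have "(\<integral>\<^sup>+y. ennreal (?\<eta> y) \<partial>lborel) = 1"
      using mollifier_integrable[OF r(1)] mollifier_integral[OF r(1)] mollifier_nonneg[OF r(1)]
      by (subst nn_integral_eq_integral) auto
    finally show ?thesis by simp
  qed
  with \<delta>(1) show ?thesis by blast
qed

section \<open>From weak identities to total differentiability\<close>

text \<open>Let \<open>X\<close> be a compact box inside \<Omega>. For \<open>r < \<epsilon>\<close>
  the mollification of the truncated \<open>g\<close> at a point of \<open>X\<close> is
  \<open>g\<close> tested against an admissible function, hence 0. L1 convergence forces
  \<open>g\<close> to vanish almost everywhere on \<open>X\<close>, and countably many boxes cover
  \<Omega>.\<close>

lemma fundamental_lemma:
  fixes g :: "real^'n::finite \<Rightarrow> complex"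
  assumes op: "open \<Omega>" and g: "locally_integrable \<Omega> g"
    and z: "\<And>\<phi>. \<phi> \<in> test_functions \<Omega> \<Longrightarrow> (LINT x|lebesgue_on \<Omega>. g x * complex_of_real (\<phi> x)) = 0"
  shows "AE x in lebesgue. x \<in> \<Omega> \<longrightarrow> g x = 0"
proof -
  have om: "\<Omega> \<in> sets lebesgue" using op by auto
  obtain \<D> where \<D>: "countable \<D>" "\<D> \<subseteq> Pow \<Omega>" "\<And>X. X \<in> \<D> \<Longrightarrow> \<exists>a b. X = cbox a b" "\<Union>\<D> = \<Omega>"
    using open_countable_Union_open_cbox[OF op] by blast
  have "AE x in lebesgue. x \<in> X \<longrightarrow> g x = 0" if X: "X \<in> \<D>" for X
  proof -
    have Xc: "compact X" and Xs: "X \<subseteq> \<Omega>" using \<D> X by force+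
    obtain \<epsilon> where \<epsilon>: "\<epsilon> > 0" "(\<Union>x\<in>X. cball x \<epsilon>) \<subseteq> \<Omega>"
      using compact_subset_open_imp_cball_epsilon_subset[OF Xc op Xs] by blast
    define A where "A = (\<Union>x\<in>X. cball x \<epsilon>)"
    have Ac: "compact A" using Xc unfolding A_def by (rule compact_minkowski_sum_cball)
    define f where "f x = indicator A x *\<^sub>R g x" for x
    have "integrable (lebesgue_on A) g" using g Ac \<epsilon>(2) by (auto simp: locally_integrable_def A_def)
    then have f: "integrable lebesgue f"
      using Ac unfolding f_def by (subst (asm) integrable_restrict_space) (auto intro: lmeasurable_compact fmeasurableD)
    have moll0: "mollify (mollifier r) f x = 0" if r: "0 < r" "r < \<epsilon>" and x: "x \<in> X" for r x
    proof -
      have cb: "cball x r \<subseteq> A" using r x by (force simp: A_def)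
      have "mollify (mollifier r) f x = (LINT z|lebesgue. indicator \<Omega> z *\<^sub>R (g z * complex_of_real (mollifier r (x - z))))"
        unfolding mollify_def
      proof (intro Bochner_Integration.integral_cong refl)
        fix z
        show "mollifier r (x - z) *\<^sub>R f z = indicator \<Omega> z *\<^sub>R (g z * complex_of_real (mollifier r (x - z)))"
        proof (cases "mollifier r (x - z) = 0")
          case False
          then have "z \<in> cball x r" using mollifier_support[OF r(1)] by (auto simp: dist_norm)
          then have "z \<in> A" using cb by blast
          moreover from this have "z \<in> \<Omega>" using \<epsilon>(2) unfolding A_def by blast
          ultimately
          show ?thesis by (simp add: f_def scaleR_conv_of_real mult.commute)
        qed simp
      qed
      also have "\<dots> = (LINT z|lebesgue_on \<Omega>. g z * complex_of_real (mollifier r (x - z)))"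
        using om by (subst integral_restrict_space) auto
      also have "\<dots> = 0"
        using cb \<epsilon>(2) by (intro z mollifier_shift_test_function r(1)) (simp add: A_def)
      finally show ?thesis .
    qed
    have Xm: "X \<in> sets lebesgue" using Xc by (auto intro: lmeasurable_compact fmeasurableD)
    have le: "(\<integral>\<^sup>+x. ennreal (norm (f x)) * indicator X x \<partial>lebesgue) \<le> ennreal e" if e: "0 < e" for e
    proof -
      obtain \<delta> where \<delta>: "\<delta> > 0" "\<And>r. 0 < r \<and> r < \<delta> \<Longrightarrow>
          (\<integral>\<^sup>+x. ennreal (norm (mollify (mollifier r) f x - f x)) \<partial>lebesgue) \<le> ennreal e"
        using mollify_L1_convergence[OF f e] by blast
      let ?r = "min \<delta> \<epsilon> / 2"
      have r: "0 < ?r" "?r < \<delta>" "?r < \<epsilon>" using \<delta> \<epsilon> by auto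
      have "(\<integral>\<^sup>+x. ennreal (norm (f x)) * indicator X x \<partial>lebesgue)
         \<le> (\<integral>\<^sup>+x. ennreal (norm (mollify (mollifier ?r) f x - f x)) \<partial>lebesgue)"
        using moll0[OF r(1,3)] by (intro nn_integral_mono) (auto simp: indicator_def)
      also have "\<dots> \<le> ennreal e" using r by (intro \<delta>(2)) auto
      finally show ?thesis .
    qed
    have "(\<integral>\<^sup>+x. ennreal (norm (f x)) * indicator X x \<partial>lebesgue) = 0"
    proof -
      have "(\<integral>\<^sup>+x. ennreal (norm (f x)) * indicator X x \<partial>lebesgue) \<le> 0"
        by (rule ennreal_le_epsilon) (use le in auto)
      then show ?thesis by simp
    qed
    then have "AE x in lebesgue. ennreal (norm (f x)) * indicator X x = 0"
      using f Xm by (subst (asm) nn_integral_0_iff_AE) auto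
    then show ?thesis
    proof eventually_elim
      case (elim x)
      show ?case
      proof
        assume x: "x \<in> X"
        then have "x \<in> A" using \<epsilon> by (auto simp: A_def intro!: bexI[of _ x])
        with elim x show "g x = 0" by (simp add: f_def ennreal_eq_0_iff)
      qed
    qed
  qed
  then have "AE x in lebesgue. \<forall>X\<in>\<D>. x \<in> X \<longrightarrow> g x = 0"
    using AE_ball_countable[OF \<D>(1), where M=lebesgue and P="\<lambda>x X. x \<in> X \<longrightarrow> g x = 0"] by blast
  then show ?thesis using \<D>(4) by (auto elim!: eventually_mono)
qed

text \<open>Outside one null set the directional derivatives exist for a countable dense set of
  directions and depend linearly on the direction. Linearity is proved weakly: integration by parts
  moves it to the derivative of a test function, where it is clear, and the fundamental lemma brings
  it back. The Lipschitz bound and a finite net of directions then make the limits uniform over the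
  unit sphere.\<close>

lemma lipschitz_differentiable_AE_real:
  fixes f :: "real^'n::finite \<Rightarrow> real"
  assumes L: "L-lipschitz_on UNIV f"
  shows "AE x in lebesgue. f differentiable (at x)"
proof -
  define Dv where "Dv v x = lim (\<lambda>k. real (Suc k) *\<^sub>R (f (x + (1 / real (Suc k)) *\<^sub>R v) - f x))" for v x
  have lim: "AE x in lebesgue. ((\<lambda>t. (f (x + t *\<^sub>R v) - f x) / t) \<longlongrightarrow> Dv v x) (at_right 0) \<and>
     (\<lambda>k. real (Suc k) *\<^sub>R (f (x + (1 / real (Suc k)) *\<^sub>R v) - f x)) \<longlonglongrightarrow> Dv v x" for v
  proof -
    have "AE x in lebesgue. \<exists>D. ((\<lambda>t. (f (x + t *\<^sub>R v) - f x) / t) \<longlongrightarrow> D) (at_right 0)"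
      using lipschitz_directional_derivative_AE[OF L, of v] by (simp add: AE_completion_iff)
    then show ?thesis
    proof eventually_elim
      case (elim x)
      then obtain D where D: "((\<lambda>t. (f (x + t *\<^sub>R v) - f x) / t) \<longlongrightarrow> D) (at_right 0)" by blast
      have "filterlim (\<lambda>k. 1 / real (Suc k)) (at_right 0) sequentially"
        unfolding filterlim_at using LIMSEQ_inverse_real_of_nat by (auto simp: inverse_eq_divide)
      from filterlim_compose[OF D this]
      have *: "(\<lambda>k. real (Suc k) *\<^sub>R (f (x + (1 / real (Suc k)) *\<^sub>R v) - f x)) \<longlonglongrightarrow> D"
        by (simp add: mult.commute)
      then have "Dv v x = D" unfolding Dv_def by (rule limI)
      with D * show ?case by simp
    qed
  qed
  have limseq: "AE x in lebesgue. (\<lambda>k. real (Suc k) *\<^sub>R (f (x + (1 / real (Suc k)) *\<^sub>R v) - f x)) \<longlonglongrightarrow> Dv v x" for v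
    using lim[of v] by eventually_elim simp
  \<comment> \<open>The zero function serves as test function, since only the measurability part is
    wanted.\<close>
  have Dv_meas: "Dv v \<in> borel_measurable lebesgue" for v
    by (rule lipschitz_integration_by_parts(1)[OF L zero_test_function limseq])
  have Dv_bound: "AE x in lebesgue. \<bar>Dv v x\<bar> \<le> L * norm v" for v
    using limseq[of v]
  proof eventually_elim
    case (elim x)
    have "norm (Dv v x) \<le> L * norm v"
      using lipschitz_quotient_bound[OF L] by (intro LIMSEQ_le_const2[OF tendsto_norm[OF elim]]) blast
    then show ?case by simp
  qed
  have linear: "AE x in lebesgue. Dv v x = (\<Sum>i\<in>UNIV. v$i * Dv (axis i 1) x)" for v
  proof -
    define g where "g x = Dv v x - (\<Sum>i\<in>UNIV. v$i * Dv (axis i 1) x)" for x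
    have g_meas: "g \<in> borel_measurable lebesgue"
      unfolding g_def using Dv_meas by (intro borel_measurable_diff borel_measurable_sum borel_measurable_times) auto
    have "AE x in lebesgue. \<forall>i\<in>UNIV. \<bar>Dv (axis i 1) x\<bar> \<le> L * norm (axis i 1 :: real^'n)"
      by (rule AE_finite_allI[OF finite]) (rule Dv_bound)
    with Dv_bound[of v] have g_bound: "AE x in lebesgue. norm (complex_of_real (g x)) \<le> L * norm v + (\<Sum>i\<in>UNIV. \<bar>v$i\<bar> * L)"
    proof eventually_elim
      case (elim x)
      have "\<bar>\<Sum>i\<in>UNIV. v$i * Dv (axis i 1) x\<bar> \<le> (\<Sum>i\<in>UNIV. \<bar>v$i * Dv (axis i 1) x\<bar>)" by (rule sum_abs)
      also have "\<dots> \<le> (\<Sum>i\<in>UNIV. \<bar>v$i\<bar> * L)"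
        using elim(2) by (intro sum_mono) (auto simp: abs_mult norm_axis_1 intro!: mult_left_mono)
      finally show ?case using elim(1) unfolding norm_of_real g_def by linarith
    qed
    have loc: "locally_integrable UNIV (\<lambda>x. complex_of_real (g x))"
      unfolding locally_integrable_def
    proof (intro allI impI)
      fix K :: "(real^'n) set" assume K: "compact K \<and> K \<subseteq> UNIV"
      interpret finite_measure "lebesgue_on K"
        using K by (intro finite_measure_lebesgue_on lmeasurable_compact) auto
      show "integrable (lebesgue_on K) (\<lambda>x. complex_of_real (g x))"
      proof (rule integrable_const_bound)
        show "AE x in lebesgue_on K. norm (complex_of_real (g x)) \<le> L * norm v + (\<Sum>i\<in>UNIV. \<bar>v$i\<bar> * L)"
          using g_bound K by (subst AE_restrict_space_iff) (auto intro: lmeasurable_compact fmeasurableD)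
        have "(\<lambda>x. complex_of_real (g x)) \<in> borel_measurable lebesgue" using g_meas by measurable
        then show "(\<lambda>x. complex_of_real (g x)) \<in> borel_measurable (lebesgue_on K)"
          by (rule measurable_restrict_space1)
      qed
    qed
    have "(LINT x|lebesgue_on UNIV. complex_of_real (g x) * complex_of_real (\<phi> x)) = 0"
      if \<phi>: "\<phi> \<in> test_functions UNIV" for \<phi> :: "real^'n \<Rightarrow> real"
    proof -
      note ibp = lipschitz_integration_by_parts[OF L \<phi> limseq]
      have fi: "integrable lebesgue (\<lambda>x. partial_deriv i \<phi> x * f x)" for i
      proof -
        obtain R where R: "\<And>x. norm x > R \<Longrightarrow> partial_deriv i \<phi> x = 0"
          using test_bounded_support[OF partial_deriv_test_function[OF \<phi>]] by blast
        have "integrable lborel (\<lambda>x. partial_deriv i \<phi> x * f x)"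
          using R by (intro integrable_continuous_bounded_support[of _ R] continuous_intros
            test_continuous[OF partial_deriv_test_function[OF \<phi>]] lipschitz_on_continuous_on[OF L]) auto
        then show ?thesis by (simp add: integrable_completion)
      qed
      have ii: "integrable lebesgue (\<lambda>x. v$i * (\<phi> x * Dv (axis i 1) x))" for i
        using ibp(2)[of "axis i 1"] by simp
      have ax: "(LINT x|lebesgue. \<phi> x * Dv (axis i 1) x) = - (LINT x|lebesgue. partial_deriv i \<phi> x * f x)" for i
        using ibp(3)[of "axis i 1"] by (simp add: partial_deriv_def)
      have "(LINT x|lebesgue. \<phi> x * Dv v x) = - (LINT x|lebesgue. frechet_derivative \<phi> (at x) v * f x)"
        using ibp(3)[of v] by simp
      also have "\<dots> = - (LINT x|lebesgue. (\<Sum>i\<in>UNIV. v$i * (partial_deriv i \<phi> x * f x)))"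
        by (simp add: frechet_derivative_eq_sum_partial_deriv[OF test_differentiable[OF \<phi>]] sum_distrib_right mult.assoc)
      also have "\<dots> = - (\<Sum>i\<in>UNIV. v$i * (LINT x|lebesgue. partial_deriv i \<phi> x * f x))"
        using fi by (subst Bochner_Integration.integral_sum) auto
      also have "\<dots> = (\<Sum>i\<in>UNIV. v$i * (LINT x|lebesgue. \<phi> x * Dv (axis i 1) x))"
        by (simp add: ax sum_negf)
      also have "\<dots> = (LINT x|lebesgue. (\<Sum>i\<in>UNIV. v$i * (\<phi> x * Dv (axis i 1) x)))"
        using ii by (subst Bochner_Integration.integral_sum) auto
      finally have eq: "(LINT x|lebesgue. \<phi> x * Dv v x) = (LINT x|lebesgue. (\<Sum>i\<in>UNIV. v$i * (\<phi> x * Dv (axis i 1) x)))" .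
      have "(LINT x|lebesgue. g x * \<phi> x) = (LINT x|lebesgue. \<phi> x * Dv v x - (\<Sum>i\<in>UNIV. v$i * (\<phi> x * Dv (axis i 1) x)))"
        by (intro Bochner_Integration.integral_cong) (auto simp: g_def algebra_simps sum_distrib_left)
      also have "\<dots> = 0"
        using ibp(2)[of v] ii by (subst Bochner_Integration.integral_diff) (auto simp: eq)
      finally show ?thesis by (simp add: lebesgue_on_UNIV_eq flip: of_real_mult)
    qed
    from fundamental_lemma[OF open_UNIV loc this] have "AE x in lebesgue. g x = 0" by simp
    then show ?thesis by (simp add: g_def)
  qed
  obtain Q :: "(real^'n) set" where Q: "countable Q" "\<And>X. open X \<Longrightarrow> X \<noteq> {} \<Longrightarrow> \<exists>d\<in>Q. d \<in> X"
    using countable_dense_setE by blast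
  have "AE x in lebesgue. \<forall>v\<in>Q. ((\<lambda>t. (f (x + t *\<^sub>R v) - f x) / t) \<longlongrightarrow> (\<Sum>i\<in>UNIV. v$i * Dv (axis i 1) x)) (at_right 0)"
  proof (rule AE_ball_countable[OF Q(1), THEN iffD2], rule ballI)
    fix v
    show "AE x in lebesgue. ((\<lambda>t. (f (x + t *\<^sub>R v) - f x) / t) \<longlongrightarrow> (\<Sum>i\<in>UNIV. v$i * Dv (axis i 1) x)) (at_right 0)"
      using lim[of v] linear[of v] by eventually_elim simp
  qed
  then show ?thesis
  proof eventually_elim
    case (elim x)
    define A where "A h = (\<Sum>i\<in>UNIV. h$i * Dv (axis i 1) x)" for h :: "real^'n"
    define M where "M = (\<Sum>i\<in>UNIV. \<bar>Dv (axis i 1) x\<bar>)"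
    have blA: "bounded_linear A"
      unfolding A_def by (intro bounded_linear_sum bounded_linear_compose[OF bounded_linear_mult_left bounded_linear_vec_nth])
    then have linA: "linear A" by (rule bounded_linear.linear)
    have A_bound: "\<bar>A h\<bar> \<le> M * norm h" for h
    proof -
      have "\<bar>A h\<bar> \<le> (\<Sum>i\<in>UNIV. \<bar>h$i * Dv (axis i 1) x\<bar>)" unfolding A_def by (rule sum_abs)
      also have "\<dots> \<le> (\<Sum>i\<in>UNIV. norm h * \<bar>Dv (axis i 1) x\<bar>)"
        using component_le_norm_cart by (intro sum_mono) (auto simp: abs_mult intro!: mult_right_mono)
      finally show ?thesis by (simp add: M_def sum_distrib_left mult.commute)
    qed
    have M0: "0 \<le> M" unfolding M_def by (intro sum_nonneg) auto
    have L0: "0 \<le> L" by (rule lipschitz_on_nonneg[OF L])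
    have "(f has_derivative A) (at x)"
      unfolding has_derivative_within_alt2
    proof (intro conjI allI impI blA)
      fix e :: real assume e: "0 < e"
      \<comment> \<open>Replacing a unit direction \<open>u\<close> by a direction \<open>v\<close>
        within \<open>e'\<close> costs, per unit of length, \<open>L * e'\<close> in the increment
        of \<open>f\<close> and \<open>M * e'\<close> in the linear map. Together they stay within
        \<open>e / 2\<close>; the directional limit spends the other half.\<close>
      define e' where "e' = e / 2 / (L + M + 1)"
      have e': "0 < e'" "(L + M) * e' \<le> e / 2"
      proof -
        have p: "L + M + 1 > 0" using L0 M0 by linarith
        show "0 < e'" using e p unfolding e'_def by simp
        moreover have "(L + M + 1) * e' = e / 2"
          using p unfolding e'_def by (metis less_irrefl nonzero_mult_div_cancel_left times_divide_eq_right)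
        ultimately show "(L + M) * e' \<le> e / 2" by (simp add: distrib_right)
      qed
      have c: "compact (sphere (0::real^'n) 1)" by simp
      have s: "sphere (0::real^'n) 1 \<subseteq> (\<Union>v\<in>Q. ball v e')"
      proof
        fix u :: "real^'n"
        obtain v where "v \<in> Q" "v \<in> ball u e'" using Q(2)[of "ball u e'"] e' by auto
        then show "u \<in> (\<Union>v\<in>Q. ball v e')" by (auto simp: dist_commute)
      qed
      have "\<exists>S\<subseteq>Q. finite S \<and> sphere (0::real^'n) 1 \<subseteq> (\<Union>v\<in>S. ball v e')"
        by (rule compactE_image[OF c _ s]) auto
      then obtain S where S: "S \<subseteq> Q" "finite S" "sphere (0::real^'n) 1 \<subseteq> (\<Union>v\<in>S. ball v e')"
        by blast
      have "\<exists>d>0. \<forall>t. 0 < t \<and> t < d \<longrightarrow> \<bar>f (x + t *\<^sub>R v) - f x - t * A v\<bar> \<le> e / 2 * t" if "v \<in> S" for v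
      proof -
        have "((\<lambda>t. (f (x + t *\<^sub>R v) - f x) / t) \<longlongrightarrow> A v) (at_right 0)"
          using elim that S unfolding A_def by blast
        then have "\<forall>\<^sub>F t in at_right 0. dist ((f (x + t *\<^sub>R v) - f x) / t) (A v) < e / 2"
          using e by (intro tendstoD) auto
        then obtain d where d: "d > 0" "\<And>t. 0 < t \<Longrightarrow> t < d \<Longrightarrow> \<bar>(f (x + t *\<^sub>R v) - f x) / t - A v\<bar> < e / 2"
          by (auto simp: eventually_at_right_field dist_real_def)
        have "\<bar>f (x + t *\<^sub>R v) - f x - t * A v\<bar> \<le> e / 2 * t" if t: "0 < t" "t < d" for t
        proof -
          have "f (x + t *\<^sub>R v) - f x - t * A v = t * ((f (x + t *\<^sub>R v) - f x) / t - A v)"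
            using t by (simp add: field_simps)
          then have "\<bar>f (x + t *\<^sub>R v) - f x - t * A v\<bar> = t * \<bar>(f (x + t *\<^sub>R v) - f x) / t - A v\<bar>"
            using t by (simp add: abs_mult)
          also have "\<dots> \<le> t * (e / 2)" using d(2)[OF t] t by (intro mult_left_mono) auto
          finally show ?thesis by (simp add: mult.commute)
        qed
        with d(1) show ?thesis by blast
      qed
      then obtain d where d: "\<And>v. v \<in> S \<Longrightarrow> d v > 0"
        "\<And>v t. v \<in> S \<Longrightarrow> 0 < t \<Longrightarrow> t < d v \<Longrightarrow> \<bar>f (x + t *\<^sub>R v) - f x - t * A v\<bar> \<le> e / 2 * t" by metis
      define dm where "dm = Min (insert 1 (d ` S))"
      have dm: "dm > 0" "\<And>v. v \<in> S \<Longrightarrow> dm \<le> d v"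
        using S(2) d(1) by (auto simp: dm_def)
      have "norm (f y - f x - A (y - x)) \<le> e * norm (y - x)" if y: "norm (y - x) < dm" for y
      proof (cases "y = x")
        case True then show ?thesis using linA by (simp add: linear_0)
      next
        case False
        define t where "t = norm (y - x)"
        define u where "u = (1 / t) *\<^sub>R (y - x)"
        have t: "0 < t" using False by (simp add: t_def)
        then have "u \<in> sphere 0 1" by (simp add: u_def t_def)
        then obtain v where v: "v \<in> S" "norm (u - v) < e'"
          using S(3) by (auto simp: dist_norm norm_minus_commute)
        have y_eq: "y = x + t *\<^sub>R u" using t by (simp add: u_def)
        have 1: "\<bar>f (x + t *\<^sub>R u) - f (x + t *\<^sub>R v)\<bar> \<le> L * (t * e')"
        proof -
          have "\<bar>f (x + t *\<^sub>R u) - f (x + t *\<^sub>R v)\<bar> \<le> L * norm ((x + t *\<^sub>R u) - (x + t *\<^sub>R v))"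
            using lipschitz_on_normD[OF L, of "x + t *\<^sub>R u" "x + t *\<^sub>R v"] by simp
          also have "norm ((x + t *\<^sub>R u) - (x + t *\<^sub>R v)) = t * norm (u - v)"
            using t by (simp flip: scaleR_diff_right)
          also have "L * (t * norm (u - v)) \<le> L * (t * e')"
            using v t L0 by (intro mult_left_mono) auto
          finally show ?thesis .
        qed
        have 2: "\<bar>f (x + t *\<^sub>R v) - f x - t * A v\<bar> \<le> e / 2 * t"
          using d(2)[OF v(1) t] dm(2)[OF v(1)] y by (simp add: t_def)
        have 3: "\<bar>t * A v - t * A u\<bar> \<le> M * (t * e')"
        proof -
          have "\<bar>t * A v - t * A u\<bar> = t * \<bar>A (v - u)\<bar>"
            using t by (simp add: linear_diff[OF linA] abs_mult flip: right_diff_distrib)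
          also have "\<dots> \<le> t * (M * norm (v - u))" using A_bound t by (intro mult_left_mono) auto
          also have "\<dots> \<le> t * (M * e')" using v t M0 by (intro mult_left_mono) (auto simp: norm_minus_commute)
          finally show ?thesis by (simp add: mult_ac)
        qed
        have A_eq: "A (y - x) = t * A u" using y_eq linA by (simp add: linear_cmul)
        have "\<bar>f y - f x - A (y - x)\<bar> \<le> L * (t * e') + e / 2 * t + M * (t * e')"
          using 1 2 3 unfolding A_eq unfolding y_eq by linarith
        also have "\<dots> = t * ((L + M) * e') + e / 2 * t" by (simp add: algebra_simps)
        also have "\<dots> \<le> t * (e / 2) + e / 2 * t" using e'(2) t by (intro add_right_mono mult_left_mono) auto
        finally show ?thesis by (simp add: t_def mult.commute)
      qed
      then show "\<forall>\<^sub>F y in at x. norm (f y - f x - A (y - x)) \<le> e * norm (y - x)"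
        using dm(1) by (auto simp: eventually_at dist_norm)
    qed
    then show ?case by (rule differentiableI)
  qed
qed

lemma lipschitz_on_inner_Basis:
  assumes "L-lipschitz_on S f" "b \<in> Basis"
  shows "L-lipschitz_on S (\<lambda>x. f x \<bullet> b)"
proof (rule lipschitz_onI)
  fix x y assume "x \<in> S" "y \<in> S"
  have "dist (f x \<bullet> b) (f y \<bullet> b) = \<bar>(f x - f y) \<bullet> b\<bar>" by (simp add: dist_real_def inner_diff_left)
  also have "\<dots> \<le> norm (f x - f y)" using assms(2) by (rule Basis_le_norm)
  also have "\<dots> \<le> L * dist x y"
    using lipschitz_onD[OF assms(1) \<open>x \<in> S\<close> \<open>y \<in> S\<close>] by (simp add: dist_norm)
  finally show "dist (f x \<bullet> b) (f y \<bullet> b) \<le> L * dist x y" .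
qed (rule lipschitz_on_nonneg[OF assms(1)])

theorem Rademacher:
  fixes f :: "real^'n::finite \<Rightarrow> 'b::euclidean_space"
  assumes L: "L-lipschitz_on UNIV f"
  shows "AE x in lebesgue. f differentiable (at x)"
proof -
  have "AE x in lebesgue. (\<lambda>x. f x \<bullet> b) differentiable (at x)" if "b \<in> Basis" for b
    by (rule lipschitz_differentiable_AE_real[OF lipschitz_on_inner_Basis[OF L that]])
  then have "AE x in lebesgue. \<forall>b\<in>Basis. (\<lambda>x. f x \<bullet> b) differentiable (at x)"
    by (intro AE_finite_allI) auto
  then show ?thesis
    by eventually_elim (subst differentiable_componentwise_within, simp)
qed

subsection \<open>Change of variables for bi-Lipschitz maps\<close>

text \<open>McShane's formula: the infimum of the cones \<open>f z + L * dist x z\<close> with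
  vertices on the graph. The Lipschitz bound on \<open>S\<close> makes the infimum finite and equal
  to \<open>f\<close> on \<open>S\<close>.\<close>

lemma lipschitz_extension_real:
  fixes f :: "'a::metric_space \<Rightarrow> real"
  assumes L: "L-lipschitz_on S f"
  shows "\<exists>g. L-lipschitz_on UNIV g \<and> (\<forall>x\<in>S. g x = f x)"
proof (cases "S = {}")
  case True
  then show ?thesis using lipschitz_on_nonneg[OF L]
    by (intro exI[of _ "\<lambda>x. 0"]) (auto intro!: lipschitz_onI)
next
  case False
  define g where "g x = (INF z\<in>S. f z + L * dist x z)" for x
  have L0: "0 \<le> L" by (rule lipschitz_on_nonneg[OF L])
  have fL: "f z \<le> f w + L * dist w z" if "z \<in> S" "w \<in> S" for z w
    using lipschitz_onD[OF L that] by (auto simp: dist_real_def dist_commute)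
  have bdd: "bdd_below ((\<lambda>z. f z + L * dist x z) ` S)" for x
  proof -
    obtain w where w: "w \<in> S" using False by blast
    have "f w - L * dist x w \<le> f z + L * dist x z" if z: "z \<in> S" for z
    proof -
      have "L * dist z w \<le> L * (dist x z + dist x w)"
        using L0 by (intro mult_left_mono) (metis dist_commute dist_triangle)
      then show ?thesis using fL[OF w z] by (simp add: algebra_simps)
    qed
    then show ?thesis by (auto intro!: bdd_belowI2)
  qed
  have le: "g x \<le> g y + L * dist x y" for x y
  proof -
    have "g x - L * dist x y \<le> g y"
      unfolding g_def[of y]
    proof (rule cINF_greatest[OF False])
      fix z assume z: "z \<in> S"
      have "g x \<le> f z + L * dist x z" unfolding g_def by (rule cINF_lower[OF bdd z])
      also have "L * dist x z \<le> L * (dist x y + dist y z)"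
        using L0 by (intro mult_left_mono dist_triangle)
      finally show "g x - L * dist x y \<le> f z + L * dist y z" by (simp add: algebra_simps)
    qed
    then show ?thesis by simp
  qed
  have "L-lipschitz_on UNIV g"
  proof (rule lipschitz_onI)
    fix x y show "dist (g x) (g y) \<le> L * dist x y"
      using le[of x y] le[of y x] by (auto simp: dist_real_def dist_commute)
  qed (rule L0)
  moreover have "g x = f x" if x: "x \<in> S" for x
  proof (rule antisym)
    show "g x \<le> f x" using cINF_lower[OF bdd x, of x] by (simp add: g_def)
    show "f x \<le> g x" unfolding g_def using fL[OF x] by (intro cINF_greatest[OF False]) (simp add: dist_commute)
  qed
  ultimately show ?thesis by blast
qed

text \<open>The scalar extension is applied to each coordinate, so the constant grows by the factor
  \<open>DIM('b)\<close>.\<close>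

lemma lipschitz_extension:
  fixes f :: "'a::metric_space \<Rightarrow> 'b::euclidean_space"
  assumes L: "L-lipschitz_on S f"
  obtains M g where "M-lipschitz_on UNIV g" "\<And>x. x \<in> S \<Longrightarrow> g x = f x"
proof -
  have "\<exists>g. L-lipschitz_on UNIV g \<and> (\<forall>x\<in>S. g x = f x \<bullet> b)" if "b \<in> Basis" for b
    by (rule lipschitz_extension_real[OF lipschitz_on_inner_Basis[OF L that]])
  then obtain g where g: "\<And>b. b \<in> Basis \<Longrightarrow> L-lipschitz_on UNIV (g b)" "\<And>b x. b \<in> Basis \<Longrightarrow> x \<in> S \<Longrightarrow> g b x = f x \<bullet> b"
    by metis
  define h where "h x = (\<Sum>b\<in>Basis. g b x *\<^sub>R b)" for x
  have "(\<Sum>b\<in>(Basis::'b set). L)-lipschitz_on UNIV h"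
  proof (rule lipschitz_onI)
    fix x y
    have "dist (h x) (h y) = norm (\<Sum>b\<in>Basis. (g b x - g b y) *\<^sub>R b)"
      by (simp add: h_def dist_norm scaleR_diff_left sum_subtractf)
    also have "\<dots> \<le> (\<Sum>b\<in>Basis. norm ((g b x - g b y) *\<^sub>R b))" by (rule norm_sum)
    also have "\<dots> \<le> (\<Sum>b\<in>(Basis::'b set). L * dist x y)"
      using lipschitz_onD[OF g(1), of _ x y] by (intro sum_mono) (auto simp: dist_real_def)
    finally show "dist (h x) (h y) \<le> (\<Sum>b\<in>(Basis::'b set). L) * dist x y" by (simp add: sum_distrib_right)
  qed (use lipschitz_on_nonneg[OF L] in \<open>auto intro: sum_nonneg\<close>)
  moreover have "h x = f x" if "x \<in> S" for x
    using g(2) that by (simp add: h_def euclidean_representation)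
  ultimately show ?thesis using that by blast
qed

section \<open>Renaming of coordinates and the area formula\<close>

text \<open>Renaming by \<sigma> conjugates each permutation in the Leibniz sum, and conjugation
  keeps the sign.\<close>

lemma det_reindex:
  fixes A :: "real^'n::finite^'n" and \<sigma> :: "'m::finite \<Rightarrow> 'n"
  assumes "bij \<sigma>"
  shows "det (\<chi> i j. A $ \<sigma> i $ \<sigma> j) = det A"
proof -
  have inj: "inj \<sigma>" using assms by (rule bij_is_inj)
  have b: "bij_betw \<sigma> UNIV UNIV" "bij_betw (inv \<sigma>) UNIV UNIV" using assms bij_imp_bij_inv by auto
  show ?thesis
    unfolding det_def
  proof (rule sum.reindex_bij_witness[where i="map_permutation UNIV (inv \<sigma>)" and j="map_permutation UNIV \<sigma>"])
    fix p :: "'m \<Rightarrow> 'm" assume "p \<in> {p. p permutes UNIV}"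
    then have p: "p permutes UNIV" by simp
    show "map_permutation UNIV (inv \<sigma>) (map_permutation UNIV \<sigma> p) = p"
      using p b inj by (intro map_permutation_compose_inv) auto
    show "map_permutation UNIV \<sigma> p \<in> {p. p permutes UNIV}"
      using map_permutation_permutes[OF b(1) p] by simp
    have "(\<Prod>k\<in>UNIV. A $ k $ map_permutation UNIV \<sigma> p k) = (\<Prod>i\<in>UNIV. A $ \<sigma> i $ map_permutation UNIV \<sigma> p (\<sigma> i))"
      by (rule prod.reindex_bij_betw[OF b(1), symmetric])
    also have "\<dots> = (\<Prod>i\<in>UNIV. A $ \<sigma> i $ \<sigma> (p i))"
      using inj by (simp add: map_permutation_apply)
    finally show "of_int (sign (map_permutation UNIV \<sigma> p)) * (\<Prod>k\<in>UNIV. A $ k $ map_permutation UNIV \<sigma> p k) =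
       of_int (sign p) * (\<Prod>i\<in>UNIV. (\<chi> i j. A $ \<sigma> i $ \<sigma> j) $ i $ p i)"
      using sign_map_permutation[OF inj p] inj by simp
  next
    fix q :: "'n \<Rightarrow> 'n" assume "q \<in> {p. p permutes UNIV}"
    then have q: "q permutes UNIV" by simp
    show "map_permutation UNIV \<sigma> (map_permutation UNIV (inv \<sigma>) q) = q"
      using q b assms by (intro map_permutation_compose_inv) (auto simp: bij_is_surj surj_f_inv_f bij_is_inj)
    show "map_permutation UNIV (inv \<sigma>) q \<in> {p. p permutes UNIV}"
      using map_permutation_permutes[OF b(2) q] by simp
  qed
qed

lemma prod_Basis_cart: "(\<Prod>b\<in>Basis. (x::real^'n::finite) \<bullet> b) = (\<Prod>i\<in>UNIV. x $ i)"
proof -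
  have B: "(Basis :: (real^'n) set) = range (\<lambda>i. axis i 1)" by (auto simp: Basis_vec_def)
  have "inj (\<lambda>i::'n. axis i (1::real))" by (auto simp: inj_def axis_eq_axis)
  then show ?thesis unfolding B by (simp add: prod.reindex inner_axis)
qed

lemma reindex_measurable[measurable]:
  "(\<lambda>x::real^'n::finite. (\<chi> i. x $ \<sigma> i) :: real^'m::finite) \<in> borel_measurable borel"
  by (intro borel_measurable_continuous_onI continuous_intros)

lemma distr_lborel_reindex:
  fixes \<sigma> :: "'m::finite \<Rightarrow> 'n::finite"
  assumes "bij \<sigma>"
  shows "distr lborel borel (\<lambda>x::real^'n. (\<chi> i. x $ \<sigma> i) :: real^'m) = lborel"
proof (rule lborel_eqI[symmetric])
  fix l u :: "real^'m" assume "\<And>b. b \<in> Basis \<Longrightarrow> l \<bullet> b \<le> u \<bullet> b"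
  from this[of "axis i 1" for i] have le: "l $ i \<le> u $ i" for i
    by (simp add: inner_axis axis_in_Basis_iff)
  let ?l = "(\<chi> j. l $ inv \<sigma> j) :: real^'n" and ?u = "(\<chi> j. u $ inv \<sigma> j) :: real^'n"
  have sj: "\<sigma> (inv \<sigma> j) = j" "inv \<sigma> (\<sigma> i) = i" for i j
    using assms by (simp_all add: bij_is_surj surj_f_inv_f bij_is_inj)
  have "(\<lambda>x::real^'n. (\<chi> i. x $ \<sigma> i) :: real^'m) -` box l u = box ?l ?u"
    by (auto simp: mem_box_cart sj) (metis sj)+
  then have "emeasure (distr lborel borel (\<lambda>x::real^'n. (\<chi> i. x $ \<sigma> i) :: real^'m)) (box l u) = emeasure lborel (box ?l ?u)"
    by (subst emeasure_distr) auto
  also have "\<dots> = ennreal (\<Prod>b\<in>Basis. (?u - ?l) \<bullet> b)"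
    using le by (intro emeasure_lborel_box) (auto simp: Basis_vec_def inner_axis)
  also have "(\<Prod>b\<in>Basis. (?u - ?l) \<bullet> b) = (\<Prod>i\<in>UNIV. (?u - ?l) $ i)" by (rule prod_Basis_cart)
  also have "\<dots> = (\<Prod>i\<in>UNIV. (?u - ?l) $ \<sigma> i)"
    by (rule prod.reindex_bij_betw[OF assms, symmetric])
  also have "\<dots> = (\<Prod>b\<in>Basis. (u - l) \<bullet> b)" by (simp add: prod_Basis_cart sj)
  finally show "emeasure (distr lborel borel (\<lambda>x::real^'n. (\<chi> i. x $ \<sigma> i) :: real^'m)) (box l u) = (\<Prod>b\<in>Basis. (u - l) \<bullet> b)" .
qed simp

text \<open>The library's change of variables needs a well-ordered index type; the index type is exchanged by
  renaming coordinates.\<close>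

lemma emeasure_differentiable_image_reindex:
  fixes \<sigma> :: "'m::{finite,wellorder} \<Rightarrow> 'n::finite" and f :: "real^'n \<Rightarrow> real^'n"
  assumes \<sigma>: "bij \<sigma>" and S: "S \<in> sets borel" and fS: "f ` S \<in> sets borel" "emeasure lborel (f ` S) < \<infinity>"
    and der: "\<And>x. x \<in> S \<Longrightarrow> (f has_derivative f' x) (at x)" and inj: "inj_on f S"
    and d: "d \<in> borel_measurable borel" "\<And>x. x \<in> S \<Longrightarrow> d x = \<bar>det (matrix (f' x))\<bar>"
  shows "emeasure lborel (f ` S) = (\<integral>\<^sup>+x. indicator S x * ennreal (d x) \<partial>lborel)"
proof -
  define R where "R x = ((\<chi> i. x $ \<sigma> i) :: real^'m::_)" for x :: "real^'n"
  define R' where "R' y = ((\<chi> j. y $ inv \<sigma> j) :: real^'n)" for y :: "real^'m::_"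
  have sj: "\<sigma> (inv \<sigma> j) = j" "inv \<sigma> (\<sigma> i) = i" for i j
    using \<sigma> by (simp_all add: bij_is_surj surj_f_inv_f bij_is_inj)
  have RR[simp]: "R (R' y) = y" "R' (R x) = x" for x y
    by (simp_all add: R_def R'_def vec_eq_iff sj)
  have [measurable]: "R \<in> borel_measurable borel" "R' \<in> borel_measurable borel"
    unfolding R_def R'_def by measurable
  have bl: "bounded_linear R" "bounded_linear R'"
    unfolding R_def R'_def linear_conv_bounded_linear[symmetric]
    by (auto intro!: linearI simp: vec_eq_iff)
  have distr': "distr lborel borel R' = lborel"
    unfolding R'_def using distr_lborel_reindex[of "inv \<sigma>"] \<sigma> bij_imp_bij_inv by blast
  define T where "T = R' -` S"
  define g where "g = R \<circ> f \<circ> R'"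
  have Tm: "T \<in> sets borel" unfolding T_def using S measurable_sets_borel[of R' borel S] by simp
  have gT: "g ` T = R' -` (f ` S)"
  proof safe
    fix y z assume "R' y = f z" "z \<in> S"
    then have "y = g (R z)" "R z \<in> T" by (auto simp: g_def T_def) (metis RR)
    then show "y \<in> g ` T" by blast
  qed (auto simp: g_def T_def)
  have gTm: "g ` T \<in> sets borel" unfolding gT using fS measurable_sets_borel[of R' borel] by simp
  have em: "emeasure lborel (g ` T) = emeasure lborel (f ` S)"
  proof -
    have "emeasure lborel (f ` S) = emeasure (distr lborel borel R') (f ` S)" by (simp add: distr')
    also have "\<dots> = emeasure lborel (R' -` (f ` S))" using fS by (subst emeasure_distr) auto
    finally show ?thesis by (simp add: gT)
  qed
  have gder: "(g has_derivative (\<lambda>h. R (f' (R' y) (R' h)))) (at y within T)" if "y \<in> T" for y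
  proof -
    have "(f has_derivative f' (R' y)) (at (R' y))" using der that by (simp add: T_def)
    from has_derivative_compose[OF bounded_linear_imp_has_derivative[OF bl(2)] this]
    have "((\<lambda>x. f (R' x)) has_derivative (\<lambda>h. f' (R' y) (R' h))) (at y)" by simp
    from bounded_linear.has_derivative[OF bl(1) this] show ?thesis
      by (auto simp: g_def o_def intro: has_derivative_at_withinI)
  qed
  have ginj: "inj_on g T"
    using inj by (auto simp: inj_on_def g_def T_def) (metis RR)+
  have gfin: "g ` T \<in> lmeasurable"
    using gTm fS em by (auto simp: fmeasurable_def)
  \<comment> \<open>Conjugation by the renaming permutes the rows and the columns of the derivative
    matrix simultaneously.\<close>
  have det: "det (matrix (\<lambda>h. R (f' (R' y) (R' h)))) = det (matrix (f' (R' y)))" for y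
  proof -
    have ax: "R' (axis j 1) = axis (\<sigma> j) 1" for j
      unfolding R'_def by (auto simp: vec_eq_iff axis_def sj)
    have "matrix (\<lambda>h. R (f' (R' y) (R' h))) = (\<chi> i j. matrix (f' (R' y)) $ \<sigma> i $ \<sigma> j)"
      by (simp add: matrix_def ax vec_eq_iff R_def)
    then show ?thesis using det_reindex[OF \<sigma>] by simp
  qed
  have "((\<lambda>y. \<bar>det (matrix (f' (R' y)))\<bar>) has_integral measure lebesgue (g ` T)) T"
    using has_measure_differentiable_image[of T g "\<lambda>y h. R (f' (R' y) (R' h))" "measure lebesgue (g ` T)"]
      gder ginj gfin Tm by (simp add: det)
  from nn_integral_has_integral_lebesgue[OF _ this]
  have "(\<integral>\<^sup>+y. ennreal (indicator T y * \<bar>det (matrix (f' (R' y)))\<bar>) \<partial>lborel) = ennreal (measure lebesgue (g ` T))"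
    by simp
  also have "\<dots> = emeasure lborel (g ` T)"
    using gTm gfin by (subst emeasure_eq_measure2[symmetric]) auto
  finally have eq: "emeasure lborel (f ` S) = (\<integral>\<^sup>+y. ennreal (indicator T y * \<bar>det (matrix (f' (R' y)))\<bar>) \<partial>lborel)"
    by (simp add: em)
  also have "\<dots> = (\<integral>\<^sup>+y. indicator S (R' y) * ennreal (d (R' y)) \<partial>lborel)"
    using d(2) by (intro nn_integral_cong) (auto simp: T_def indicator_def)
  also have "\<dots> = (\<integral>\<^sup>+x. indicator S x * ennreal (d x) \<partial>distr lborel borel R')"
    using S d(1) by (subst nn_integral_distr) auto
  finally show ?thesis by (simp add: distr')
qed

text \<open>The numeral types \<open>2\<close> and \<open>3\<close> are well-ordered index types of
  the two admissible sizes. The Borel function \<open>d\<close> is a stand-in for the Jacobian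
  factor that agrees with it on \<open>S\<close>.\<close>

lemma emeasure_differentiable_image:
  fixes f :: "real^'n::finite \<Rightarrow> real^'n"
  assumes c: "CARD('n) = 2 \<or> CARD('n) = 3"
    and a: "S \<in> sets borel" "f ` S \<in> sets borel" "emeasure lborel (f ` S) < \<infinity>"
    "\<And>x. x \<in> S \<Longrightarrow> (f has_derivative f' x) (at x)" "inj_on f S"
    "d \<in> borel_measurable borel" "\<And>x. x \<in> S \<Longrightarrow> d x = \<bar>det (matrix (f' x))\<bar>"
  shows "emeasure lborel (f ` S) = (\<integral>\<^sup>+x. indicator S x * ennreal (d x) \<partial>lborel)"
  using c
proof
  assume "CARD('n) = 2"
  then obtain \<sigma> :: "2 \<Rightarrow> 'n" where "bij \<sigma>"
    using finite_same_card_bij[of "UNIV :: 2 set" "UNIV :: 'n set"] by auto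
  then show ?thesis by (rule emeasure_differentiable_image_reindex[OF _ a])
next
  assume "CARD('n) = 3"
  then obtain \<sigma> :: "3 \<Rightarrow> 'n" where "bij \<sigma>"
    using finite_same_card_bij[of "UNIV :: 3 set" "UNIV :: 'n set"] by auto
  then show ?thesis by (rule emeasure_differentiable_image_reindex[OF _ a])
qed

lemma lipschitz_has_derivative_bound:
  assumes "L-lipschitz_on UNIV f" "(f has_derivative f') (at x)"
  shows "norm (f' v) \<le> L * norm v"
  by (rule LIMSEQ_le_const2[OF tendsto_norm[OF has_derivative_imp_quotient_limit[OF assms(2)]]])
     (use lipschitz_quotient_bound[OF assms(1)] in blast)

lemma jacobian_column:
  "f differentiable (at x) \<Longrightarrow> jacobian f (at x) $ i $ j = frechet_derivative f (at x) (axis j 1) $ i"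
  by (simp add: jacobian_def matrix_def)

lemma lipschitz_jacobian_measurable:
  fixes F :: "real^'n::finite \<Rightarrow> real^'n"
  assumes L: "L-lipschitz_on UNIV F"
  shows "(\<lambda>x. jacobian F (at x) $ i $ j) \<in> borel_measurable lebesgue"
proof -
  have "AE x in lebesgue. (\<lambda>k. real (Suc k) *\<^sub>R (F (x + (1 / real (Suc k)) *\<^sub>R axis j 1) - F x))
      \<longlonglongrightarrow> frechet_derivative F (at x) (axis j 1)"
    using Rademacher[OF L]
    by eventually_elim (rule has_derivative_imp_quotient_limit, simp add: frechet_derivative_works)
  from lipschitz_integration_by_parts(1)[OF L zero_test_function this]
  have "(\<lambda>x. frechet_derivative F (at x) (axis j 1) $ i) \<in> borel_measurable lebesgue"
    by (rule measurable_compose[OF _ borel_measurable_continuous_onI[of "\<lambda>v. v $ i"]]) (intro continuous_intros)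
  then show ?thesis
    by (rule borel_measurable_AE) (use Rademacher[OF L] in \<open>auto elim!: eventually_mono simp: jacobian_column\<close>)
qed

lemma lipschitz_jacobian_bound:
  fixes F :: "real^'n::finite \<Rightarrow> real^'n"
  assumes L: "L-lipschitz_on UNIV F" and d: "F differentiable (at x)"
  shows "\<bar>jacobian F (at x) $ i $ j\<bar> \<le> L"
proof -
  have "\<bar>jacobian F (at x) $ i $ j\<bar> \<le> norm (frechet_derivative F (at x) (axis j 1))"
    unfolding jacobian_column[OF d] by (rule component_le_norm_cart)
  also have "\<dots> \<le> L * norm (axis j 1 :: real^'n)"
    using d by (intro lipschitz_has_derivative_bound[OF L]) (simp add: frechet_derivative_works)
  finally show ?thesis by simp
qed

lemma det_measurable:
  fixes A :: "'a \<Rightarrow> real^'n::finite^'n"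
  assumes "\<And>i j. (\<lambda>x. A x $ i $ j) \<in> borel_measurable M"
  shows "(\<lambda>x. det (A x)) \<in> borel_measurable M"
  unfolding det_def using assms
  by (intro borel_measurable_sum borel_measurable_times borel_measurable_prod) auto

lemma det_bound:
  fixes A :: "real^'n::finite^'n"
  assumes "\<And>i j. \<bar>A $ i $ j\<bar> \<le> L"
  shows "\<bar>det A\<bar> \<le> (\<Sum>p\<in>{p. p permutes (UNIV::'n set)}. L ^ CARD('n))"
proof -
  have "\<bar>det A\<bar> \<le> (\<Sum>p\<in>{p. p permutes (UNIV::'n set)}. \<bar>of_int (sign p) * (\<Prod>i\<in>UNIV. A $ i $ p i)\<bar>)"
    unfolding det_def by (rule sum_abs)
  also have "\<dots> \<le> (\<Sum>p\<in>{p. p permutes (UNIV::'n set)}. L ^ CARD('n))"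
  proof (rule sum_mono)
    fix p :: "'n \<Rightarrow> 'n"
    have "\<bar>of_int (sign p) * (\<Prod>i\<in>UNIV. A $ i $ p i)\<bar> = (\<Prod>i\<in>UNIV. \<bar>A $ i $ p i\<bar>)"
      by (simp add: abs_mult abs_prod sign_def)
    also have "\<dots> \<le> (\<Prod>i\<in>(UNIV::'n set). L)" by (intro prod_mono) (auto simp: assms)
    finally show "\<bar>of_int (sign p) * (\<Prod>i\<in>UNIV. A $ i $ p i)\<bar> \<le> L ^ CARD('n)" by simp
  qed
  finally show ?thesis .
qed

lemma lipschitz_negligible_image:
  fixes F :: "real^'n::finite \<Rightarrow> real^'n"
  assumes L: "L-lipschitz_on UNIV F" and "negligible N"
  shows "negligible (F ` N)"
proof (rule negligible_locally_Lipschitz_image)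
  show "\<exists>T B. open T \<and> x \<in> T \<and> (\<forall>y\<in>N \<inter> T. norm (F y - F x) \<le> B * norm (y - x))" for x
    using lipschitz_on_normD[OF L] by (intro exI[of _ UNIV] exI[of _ L]) auto
qed (use assms in auto)

lemma lebesgue_on_measurable_AE:
  fixes f g :: "'a::euclidean_space \<Rightarrow> 'b::euclidean_space"
  assumes S: "S \<in> sets lebesgue" and f: "f \<in> borel_measurable (lebesgue_on S)"
    and fg: "AE x in lebesgue. x \<in> S \<longrightarrow> f x = g x"
  shows "g \<in> borel_measurable (lebesgue_on S)"
proof -
  have "(\<lambda>x. if x \<in> S then f x else 0) \<in> borel_measurable lebesgue"
    using f S by (simp add: borel_measurable_if)
  moreover have "AE x in lebesgue. (if x \<in> S then f x else 0) = (if x \<in> S then g x else 0)"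
    using fg by eventually_elim auto
  ultimately have "(\<lambda>x. if x \<in> S then g x else 0) \<in> borel_measurable lebesgue"
    by (rule borel_measurable_AE)
  then show ?thesis using S by (simp add: borel_measurable_if)
qed

section \<open>Pairs of bi-Lipschitz maps and their change of variables\<close>

text \<open>\<open>F\<close> and \<open>G\<close> are total Lipschitz maps that are inverse to each
  other between \<Omega> and \<open>\<Omega>'\<close>; totality lets Rademacher's theorem apply on
  the whole space. The assumptions are symmetric, with one constant \<open>L\<close> for both maps,
  so that \<open>swap\<close> transfers every result to the inverse.\<close>

locale bilipschitz_pair =
  fixes F G :: "real^'n::finite \<Rightarrow> real^'n" and \<Omega> \<Omega>' :: "(real^'n) set" and L :: real
  assumes card: "CARD('n) = 2 \<or> CARD('n) = 3"
    and open_dom: "open \<Omega>" and open_ran: "open \<Omega>'"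
    and bounded_dom: "bounded \<Omega>" and bounded_ran: "bounded \<Omega>'"
    and F_lip: "L-lipschitz_on UNIV F" and G_lip: "L-lipschitz_on UNIV G"
    and F_in: "\<And>x. x \<in> \<Omega> \<Longrightarrow> F x \<in> \<Omega>'" and G_in: "\<And>y. y \<in> \<Omega>' \<Longrightarrow> G y \<in> \<Omega>"
    and GF: "\<And>x. x \<in> \<Omega> \<Longrightarrow> G (F x) = x" and FG: "\<And>y. y \<in> \<Omega>' \<Longrightarrow> F (G y) = y"
begin

lemma swap: "bilipschitz_pair G F \<Omega>' \<Omega> L"
  using bilipschitz_pair_axioms unfolding bilipschitz_pair_def by auto

lemma F_continuous: "continuous_on S F"
  using lipschitz_on_continuous_on[OF F_lip] continuous_on_subset by blast

lemma G_continuous: "continuous_on S G"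
  using lipschitz_on_continuous_on[OF G_lip] continuous_on_subset by blast

lemma F_borel[measurable]: "F \<in> borel_measurable borel"
  by (intro borel_measurable_continuous_onI F_continuous)

lemma G_borel[measurable]: "G \<in> borel_measurable borel"
  by (intro borel_measurable_continuous_onI G_continuous)

lemma dom_sets[measurable]: "\<Omega> \<in> sets borel" and ran_sets[measurable]: "\<Omega>' \<in> sets borel"
  using open_dom open_ran by auto

lemma image_eq: "A \<subseteq> \<Omega> \<Longrightarrow> F ` A = \<Omega>' \<inter> G -` A"
  using F_in G_in GF FG by force

text \<open>The exceptional set in \<Omega> is contained in the image under \<open>G\<close> of the
  one in \<open>\<Omega>'\<close>, and a Lipschitz map sends null sets to null sets. Almost
  everywhere identities cross between the domains in this way.\<close>

lemma AE_pullback: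
  assumes "AE y in lebesgue. y \<in> \<Omega>' \<longrightarrow> P y"
  shows "AE x in lebesgue. x \<in> \<Omega> \<longrightarrow> P (F x)"
proof -
  obtain N where N: "N \<in> null_sets lebesgue" "{y \<in> space lebesgue. \<not> (y \<in> \<Omega>' \<longrightarrow> P y)} \<subseteq> N"
    using assms unfolding eventually_ae_filter by blast
  then have "negligible (G ` N)"
    by (intro lipschitz_negligible_image[OF G_lip]) (simp add: negligible_iff_null_sets)
  moreover have "{x \<in> space lebesgue. \<not> (x \<in> \<Omega> \<longrightarrow> P (F x))} \<subseteq> G ` N"
    using N(2) F_in GF by force
  ultimately show ?thesis by (intro AE_I'[of "G ` N"]) (auto simp: negligible_iff_null_sets)
qed

definition dens :: "real^'n \<Rightarrow> real" where "dens x = \<bar>det (jacobian F (at x))\<bar>"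

lemma dens_nonneg: "0 \<le> dens x" by (simp add: dens_def)

lemma dens_measurable: "dens \<in> borel_measurable lebesgue"
  unfolding dens_def using det_measurable[OF lipschitz_jacobian_measurable[OF F_lip]] by measurable

lemma dens_bounded: obtains B where "0 \<le> B" "AE x in lebesgue. dens x \<le> B"
proof -
  have "AE x in lebesgue. dens x \<le> (\<Sum>p\<in>{p. p permutes (UNIV::'n set)}. L ^ CARD('n))"
    using Rademacher[OF F_lip]
    by eventually_elim (unfold dens_def, rule det_bound, rule lipschitz_jacobian_bound[OF F_lip])
  moreover have "0 \<le> (\<Sum>p\<in>{p. p permutes (UNIV::'n set)}. L ^ CARD('n))"
    using lipschitz_on_nonneg[OF F_lip] by (intro sum_nonneg) auto
  ultimately show ?thesis using that by blast
qed

text \<open>Rademacher's theorem makes \<open>G\<close> differentiable at almost every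
  \<open>y\<close>, and \<open>AE_pullback\<close> turns this into \<open>F x\<close> for almost
  every \<open>x\<close>. There the chain rule applies to \<open>G (F x) = x\<close>, which holds on
  a neighbourhood because \<Omega> is open.\<close>

lemma jacobian_chain:
  "AE x in lebesgue. x \<in> \<Omega> \<longrightarrow> F differentiable (at x) \<and> G differentiable (at (F x)) \<and>
     jacobian G (at (F x)) ** jacobian F (at x) = mat 1"
proof -
  have "AE x in lebesgue. x \<in> \<Omega> \<longrightarrow> G differentiable (at (F x))"
    using Rademacher[OF G_lip] by (intro AE_pullback) (auto elim: eventually_mono)
  then show ?thesis
    using Rademacher[OF F_lip]
  proof eventually_elim
    case (elim x)
    show ?case
    proof
      assume x: "x \<in> \<Omega>"
      have dF: "(F has_derivative (*v) (jacobian F (at x))) (at x)"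
        and dG: "(G has_derivative (*v) (jacobian G (at (F x)))) (at (F x))"
        using elim x jacobian_works by blast+
      have "((\<lambda>x. G (F x)) has_derivative (\<lambda>h. jacobian G (at (F x)) *v (jacobian F (at x) *v h))) (at x)"
        by (rule has_derivative_compose[OF dF dG])
      moreover have "((\<lambda>x. G (F x)) has_derivative (\<lambda>h. h)) (at x)"
        by (rule has_derivative_transform_within_open[OF has_derivative_ident open_dom x]) (simp add: GF)
      ultimately have "(\<lambda>h. jacobian G (at (F x)) *v (jacobian F (at x) *v h)) = (\<lambda>h. h)"
        by (rule has_derivative_unique)
      then have "jacobian G (at (F x)) ** jacobian F (at x) = mat 1"
        by (metis matrix_eq matrix_vector_mul_assoc matrix_vector_mul_lid)
      with elim x show "F differentiable (at x) \<and> G differentiable (at (F x)) \<and>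
          jacobian G (at (F x)) ** jacobian F (at x) = mat 1" by blast
    qed
  qed
qed

lemma dens_pos: "AE x in lebesgue. x \<in> \<Omega> \<longrightarrow> 0 < dens x"
  using jacobian_chain
proof eventually_elim
  case (elim x)
  show ?case
  proof
    assume "x \<in> \<Omega>"
    with elim have "det (jacobian G (at (F x)) ** jacobian F (at x)) = 1" by simp
    then show "0 < dens x" by (auto simp: dens_def det_mul)
  qed
qed

text \<open>The area formula applies off a Borel null set \<open>N\<close> that contains the points
  where \<open>F\<close> is not differentiable or \<open>dens\<close> differs from its Borel version
  \<open>d\<close>. The image of \<open>A \<inter> N\<close> is null because \<open>F\<close> is
  Lipschitz.\<close>

lemma emeasure_image_borel:
  assumes A: "A \<in> sets borel" "A \<subseteq> \<Omega>"
  shows "F ` A \<in> sets borel" "emeasure lborel (F ` A) = (\<integral>\<^sup>+x. indicator A x * ennreal (dens x) \<partial>lebesgue)"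
proof -
  have Fb: "F ` B \<in> sets borel" if "B \<in> sets borel" "B \<subseteq> \<Omega>" for B
    unfolding image_eq[OF that(2)] using that(1) measurable_sets_borel[OF G_borel that(1)] by auto
  show "F ` A \<in> sets borel" using Fb A by blast
  obtain d where d[measurable]: "d \<in> borel_measurable borel" "AE x in lebesgue. dens x = d x"
    using lebesgue_measurable_borel_representative[OF dens_measurable] by blast
  then have "AE x in lborel. dens x = d x \<and> F differentiable (at x)"
    using Rademacher[OF F_lip] by (simp add: AE_completion_iff)
  then obtain N where N: "N \<in> null_sets lborel" "\<And>x. x \<notin> N \<Longrightarrow> dens x = d x \<and> F differentiable (at x)"
    unfolding eventually_ae_filter by auto
  have [measurable]: "N \<in> sets borel" "A \<in> sets borel" using N A by auto
  have negl: "negligible (F ` (A \<inter> N))"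
  proof (rule lipschitz_negligible_image[OF F_lip], rule negligible_subset)
    show "negligible N" using N(1) null_sets_completionI by (simp add: negligible_iff_null_sets)
  qed simp
  have F1: "F ` (A \<inter> N) \<in> sets borel" "F ` (A - N) \<in> sets borel" using A by (auto intro!: Fb)
  have z: "emeasure lborel (F ` (A \<inter> N)) = 0"
    using negl F1(1) by (simp add: negligible_iff_null_sets null_sets_def)
  have inj: "inj_on F (A - N)" using GF A by (metis Diff_subset inj_on_inverseI subset_iff)
  have "F ` A = F ` (A \<inter> N) \<union> F ` (A - N)" by auto
  then have "emeasure lborel (F ` A) \<le> emeasure lborel (F ` (A \<inter> N)) + emeasure lborel (F ` (A - N))"
    using emeasure_subadditive[of "F ` (A \<inter> N)" lborel "F ` (A - N)"] F1 by simp
  moreover have "emeasure lborel (F ` (A - N)) \<le> emeasure lborel (F ` A)"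
    using Fb A by (intro emeasure_mono) auto
  ultimately have "emeasure lborel (F ` A) = emeasure lborel (F ` (A - N))" using z by simp
  also have "\<dots> = (\<integral>\<^sup>+x. indicator (A - N) x * ennreal (d x) \<partial>lborel)"
  proof (rule emeasure_differentiable_image[OF card])
    have "emeasure lborel (F ` (A - N)) \<le> emeasure lborel \<Omega>'"
      using F_in A by (intro emeasure_mono) auto
    also have "\<dots> < \<infinity>" using bounded_ran by (rule emeasure_bounded_finite)
    finally show "emeasure lborel (F ` (A - N)) < \<infinity>" .
    show "(F has_derivative frechet_derivative F (at x)) (at x)" if "x \<in> A - N" for x
      using N(2) that frechet_derivative_works by blast
    show "d x = \<bar>det (matrix (frechet_derivative F (at x)))\<bar>" if "x \<in> A - N" for x
      using N(2)[of x] that by (auto simp: dens_def jacobian_def)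
  qed (use F1 inj d in auto)
  also have "\<dots> = (\<integral>\<^sup>+x. indicator A x * ennreal (dens x) \<partial>lborel)"
  proof (rule nn_integral_cong_AE)
    have "AE x in lborel. x \<notin> N" using N(1) by (rule AE_not_in)
    then show "AE x in lborel. indicator (A - N) x * ennreal (d x) = indicator A x * ennreal (dens x)"
      by eventually_elim (use N(2) in \<open>auto simp: indicator_def\<close>)
  qed
  finally show "emeasure lborel (F ` A) = (\<integral>\<^sup>+x. indicator A x * ennreal (dens x) \<partial>lebesgue)"
    by (simp add: nn_integral_completion)
qed

text \<open>A Lebesgue measurable set is a Borel set together with a part of a null set, and the
  image of that part is null.\<close>

lemma emeasure_image_lebesgue:
  assumes A: "A \<in> sets lebesgue" "A \<subseteq> \<Omega>"
  shows "F ` A \<in> sets lebesgue" "emeasure lebesgue (F ` A) = (\<integral>\<^sup>+x. indicator A x * ennreal (dens x) \<partial>lebesgue)"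
proof -
  obtain B M M' where B: "A = B \<union> M" "M \<subseteq> M'" "M' \<in> null_sets lborel" "B \<in> sets lborel"
    using A(1) by (rule sets_completionE)
  have Bb: "B \<in> sets borel" "B \<subseteq> \<Omega>" using B A by auto
  have Mn: "negligible M"
    using B null_sets_completionI negligible_subset[of M'] by (auto simp: negligible_iff_null_sets)
  then have FM: "negligible (F ` M)" by (rule lipschitz_negligible_image[OF F_lip])
  have FB: "F ` B \<in> sets lebesgue" using emeasure_image_borel(1)[OF Bb] by simp
  have FMs: "F ` M \<in> null_sets lebesgue" using FM by (simp add: negligible_iff_null_sets)
  have FA: "F ` A = F ` B \<union> F ` M" using B by auto
  show "F ` A \<in> sets lebesgue" unfolding FA using FB FMs by auto
  have "emeasure lebesgue (F ` A) = emeasure lebesgue (F ` B)"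
    unfolding FA using FB FMs by (rule emeasure_Un_null_set)
  also have "\<dots> = (\<integral>\<^sup>+x. indicator B x * ennreal (dens x) \<partial>lebesgue)"
    using emeasure_image_borel[OF Bb] by simp
  also have "\<dots> = (\<integral>\<^sup>+x. indicator A x * ennreal (dens x) \<partial>lebesgue)"
  proof (rule nn_integral_cong_AE)
    have "AE x in lebesgue. x \<notin> M" using Mn by (intro AE_not_in) (simp add: negligible_iff_null_sets)
    then show "AE x in lebesgue. indicator B x * ennreal (dens x) = indicator A x * ennreal (dens x)"
      by eventually_elim (auto simp: B indicator_def)
  qed
  finally show "emeasure lebesgue (F ` A) = (\<integral>\<^sup>+x. indicator A x * ennreal (dens x) \<partial>lebesgue)" .
qed

text \<open>Preimages under \<open>F\<close> are images under \<open>G\<close>, and these are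
  Lebesgue measurable by the preceding result for the swapped pair. Continuity alone would not
  control preimages of Lebesgue measurable sets.\<close>

lemma F_measurable: "F \<in> measurable (lebesgue_on \<Omega>) (lebesgue_on \<Omega>')"
proof (rule measurableI)
  fix X assume X: "X \<in> sets (lebesgue_on \<Omega>')"
  then have X': "X \<in> sets lebesgue" "X \<subseteq> \<Omega>'"
    using ran_sets by (auto simp: sets_restrict_space_iff)
  have "F -` X \<inter> \<Omega> = G ` X"
    using bilipschitz_pair.image_eq[OF swap X'(2)] by auto
  moreover have "G ` X \<in> sets lebesgue"
    by (rule bilipschitz_pair.emeasure_image_lebesgue(1)[OF swap X'])
  ultimately show "F -` X \<inter> space (lebesgue_on \<Omega>) \<in> sets (lebesgue_on \<Omega>)"
    using dom_sets by (auto simp: sets_restrict_space_iff)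
qed (auto simp: F_in)

lemma compose_F_measurable:
  "h \<in> borel_measurable (lebesgue_on \<Omega>') \<Longrightarrow> (\<lambda>x. h (F x)) \<in> borel_measurable (lebesgue_on \<Omega>)"
  by (rule measurable_compose[OF F_measurable])

lemma dens_measurable_on: "dens \<in> borel_measurable (lebesgue_on \<Omega>)"
  using dens_measurable by (rule measurable_restrict_space1)

text \<open>The area formula as an identity of measures, so that change of variables reduces to the
  rules for \<open>distr\<close> and \<open>density\<close>.\<close>

lemma distr_dens: "distr (density (lebesgue_on \<Omega>) (\<lambda>x. ennreal (dens x))) (lebesgue_on \<Omega>') F = lebesgue_on \<Omega>'"
proof (rule measure_eqI)
  have m: "F \<in> measurable (density (lebesgue_on \<Omega>) (\<lambda>x. ennreal (dens x))) (lebesgue_on \<Omega>')"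
    using F_measurable by simp
  have om: "\<Omega> \<inter> space lebesgue \<in> sets lebesgue" "\<Omega>' \<inter> space lebesgue \<in> sets lebesgue" using dom_sets ran_sets by auto
  fix X assume X: "X \<in> sets (distr (density (lebesgue_on \<Omega>) (\<lambda>x. ennreal (dens x))) (lebesgue_on \<Omega>') F)"
  then have X': "X \<in> sets lebesgue" "X \<subseteq> \<Omega>'"
    using ran_sets by (auto simp: sets_restrict_space_iff)
  have GX: "F -` X \<inter> \<Omega> = G ` X"
    using bilipschitz_pair.image_eq[OF swap X'(2)] by auto
  have GX': "G ` X \<in> sets lebesgue" "G ` X \<subseteq> \<Omega>"
    using bilipschitz_pair.emeasure_image_lebesgue(1)[OF swap X'] G_in X' by auto
  have FGX: "F ` (G ` X) = X" using FG X' by (force simp: image_image)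
  have "emeasure (distr (density (lebesgue_on \<Omega>) (\<lambda>x. ennreal (dens x))) (lebesgue_on \<Omega>') F) X
      = emeasure (density (lebesgue_on \<Omega>) (\<lambda>x. ennreal (dens x))) (G ` X)"
    using X m GX by (subst emeasure_distr) auto
  also have "\<dots> = (\<integral>\<^sup>+x. ennreal (dens x) * indicator (G ` X) x \<partial>lebesgue_on \<Omega>)"
    using dens_measurable_on GX' om by (subst emeasure_density) (auto simp: sets_restrict_space_iff)
  also have "\<dots> = (\<integral>\<^sup>+x. indicator (G ` X) x * ennreal (dens x) \<partial>lebesgue)"
    using GX'(2) om by (subst nn_integral_restrict_space) (auto intro!: nn_integral_cong simp: indicator_def subset_iff)
  also have "\<dots> = emeasure lebesgue (F ` (G ` X))"
    using emeasure_image_lebesgue(2)[OF GX'] by simp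
  also have "\<dots> = emeasure (lebesgue_on \<Omega>') X"
    using X' om unfolding FGX by (subst emeasure_restrict_space) auto
  finally show "emeasure (distr (density (lebesgue_on \<Omega>) (\<lambda>x. ennreal (dens x))) (lebesgue_on \<Omega>') F) X
      = emeasure (lebesgue_on \<Omega>') X" .
qed simp

lemma change_of_variables:
  fixes h :: "real^'n \<Rightarrow> 'b::{banach, second_countable_topology}"
  assumes h: "h \<in> borel_measurable (lebesgue_on \<Omega>')"
  shows "integrable (lebesgue_on \<Omega>') h \<longleftrightarrow> integrable (lebesgue_on \<Omega>) (\<lambda>x. dens x *\<^sub>R h (F x))"
    and "(LINT y|lebesgue_on \<Omega>'. h y) = (LINT x|lebesgue_on \<Omega>. dens x *\<^sub>R h (F x))"
proof -
  have m: "F \<in> measurable (density (lebesgue_on \<Omega>) (\<lambda>x. ennreal (dens x))) (lebesgue_on \<Omega>')"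
    using F_measurable by simp
  show "integrable (lebesgue_on \<Omega>') h \<longleftrightarrow> integrable (lebesgue_on \<Omega>) (\<lambda>x. dens x *\<^sub>R h (F x))"
    by (subst distr_dens[symmetric], subst integrable_distr_eq[OF m h], subst integrable_density)
       (use compose_F_measurable[OF h] dens_measurable_on dens_nonneg in auto)
  show "(LINT y|lebesgue_on \<Omega>'. h y) = (LINT x|lebesgue_on \<Omega>. dens x *\<^sub>R h (F x))"
    by (subst distr_dens[symmetric], subst integral_distr[OF m h], subst integral_density)
       (use compose_F_measurable[OF h] dens_measurable_on dens_nonneg in auto)
qed

lemma AE_on_dom: "(AE x in lebesgue_on \<Omega>. P x) \<longleftrightarrow> (AE x in lebesgue. x \<in> \<Omega> \<longrightarrow> P x)"
  using dom_sets by (subst AE_restrict_space_iff) auto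

text \<open>Made for fields known only through their values at \<open>F x\<close> and up to null
  sets. Measurability of \<open>h\<close> is deduced from that of \<open>k\<close>, since
  \<open>h\<close> agrees almost everywhere with \<open>k / dens\<close> composed with
  \<open>G\<close>; positivity of \<open>dens\<close> permits the division.\<close>

lemma change_of_variables_AE:
  fixes h k :: "real^'n \<Rightarrow> 'b::euclidean_space"
  assumes k: "k \<in> borel_measurable (lebesgue_on \<Omega>)"
    and kh: "AE x in lebesgue. x \<in> \<Omega> \<longrightarrow> k x = dens x *\<^sub>R h (F x)"
  shows "integrable (lebesgue_on \<Omega>') h \<longleftrightarrow> integrable (lebesgue_on \<Omega>) k"
    and "(LINT y|lebesgue_on \<Omega>'. h y) = (LINT x|lebesgue_on \<Omega>. k x)"
proof -
  define h' where "h' y = (1 / dens (G y)) *\<^sub>R k (G y)" for y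
  have "(\<lambda>x. (1 / dens x) *\<^sub>R k x) \<in> borel_measurable (lebesgue_on \<Omega>)"
    using k dens_measurable_on by measurable
  then have h'm: "h' \<in> borel_measurable (lebesgue_on \<Omega>')"
    unfolding h'_def by (rule bilipschitz_pair.compose_F_measurable[OF swap])
  have "AE x in lebesgue. x \<in> \<Omega> \<longrightarrow> (1 / dens x) *\<^sub>R k x = h (F x)"
    using kh dens_pos by eventually_elim auto
  from bilipschitz_pair.AE_pullback[OF swap this]
  have "AE y in lebesgue. y \<in> \<Omega>' \<longrightarrow> h' y = h y"
    by eventually_elim (auto simp: h'_def FG)
  from lebesgue_on_measurable_AE[OF _ h'm this] have hm: "h \<in> borel_measurable (lebesgue_on \<Omega>')"
    using open_ran by simp
  have c: "AE x in lebesgue_on \<Omega>. dens x *\<^sub>R h (F x) = k x"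
    unfolding AE_on_dom using kh by eventually_elim auto
  have dm: "(\<lambda>x. dens x *\<^sub>R h (F x)) \<in> borel_measurable (lebesgue_on \<Omega>)"
    using dens_measurable_on compose_F_measurable[OF hm] by measurable
  show "integrable (lebesgue_on \<Omega>') h \<longleftrightarrow> integrable (lebesgue_on \<Omega>) k"
    unfolding change_of_variables(1)[OF hm] by (rule integrable_cong_AE[OF dm k c])
  show "(LINT y|lebesgue_on \<Omega>'. h y) = (LINT x|lebesgue_on \<Omega>. k x)"
    unfolding change_of_variables(2)[OF hm] by (rule integral_cong_AE[OF dm k c])
qed

end

subsection \<open>Weak derivatives and Lipschitz test functions\<close>

lemma integrable_scaleR_bounded:
  fixes f :: "'a \<Rightarrow> 'b::euclidean_space" and w :: "'a \<Rightarrow> real"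
  assumes f: "integrable M f" and w: "w \<in> borel_measurable M" "AE x in M. \<bar>w x\<bar> \<le> B"
  shows "integrable M (\<lambda>x. w x *\<^sub>R f x)"
proof (rule Bochner_Integration.integrable_bound)
  show "integrable M (\<lambda>x. B *\<^sub>R f x)" using f by simp
  show "(\<lambda>x. w x *\<^sub>R f x) \<in> borel_measurable M" using w f by measurable
  show "AE x in M. norm (w x *\<^sub>R f x) \<le> norm (B *\<^sub>R f x)"
    using w(2) by eventually_elim (auto intro!: mult_right_mono)
qed

lemma lebesgue_on_cong_AE:
  fixes f g :: "'a::euclidean_space \<Rightarrow> 'b::euclidean_space"
  assumes S: "S \<in> sets lebesgue" and fg: "AE x in lebesgue. x \<in> S \<longrightarrow> f x = g x"
  shows "integrable (lebesgue_on S) f \<longleftrightarrow> integrable (lebesgue_on S) g"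
    and "(LINT x|lebesgue_on S. f x) = (LINT x|lebesgue_on S. g x)"
proof -
  have gf: "AE x in lebesgue. x \<in> S \<longrightarrow> g x = f x" using fg by eventually_elim auto
  have m: "f \<in> borel_measurable (lebesgue_on S) \<longleftrightarrow> g \<in> borel_measurable (lebesgue_on S)"
    using lebesgue_on_measurable_AE[OF S _ fg] lebesgue_on_measurable_AE[OF S _ gf] by blast
  have ae: "AE x in lebesgue_on S. f x = g x" using fg S by (subst AE_restrict_space_iff) auto
  show "integrable (lebesgue_on S) f \<longleftrightarrow> integrable (lebesgue_on S) g"
    using integrable_cong_AE[OF _ _ ae] m borel_measurable_integrable by blast
  show "(LINT x|lebesgue_on S. f x) = (LINT x|lebesgue_on S. g x)"
  proof (cases "f \<in> borel_measurable (lebesgue_on S)")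
    case True then show ?thesis using m by (intro integral_cong_AE ae) auto
  next
    \<comment> \<open>Without measurability neither function is integrable, and both integrals take
      the default value 0.\<close>
    case False
    then have "\<not> integrable (lebesgue_on S) f" "\<not> integrable (lebesgue_on S) g"
      using m borel_measurable_integrable by blast+
    then show ?thesis by (simp add: not_integrable_integral_eq)
  qed
qed

lemma integrable_imp_locally_integrable:
  assumes \<Omega>: "\<Omega> \<in> sets lebesgue" and u: "integrable (lebesgue_on \<Omega>) u"
  shows "locally_integrable \<Omega> u"
  unfolding locally_integrable_def
proof (intro allI impI)
  fix K assume K: "compact K \<and> K \<subseteq> \<Omega>"
  then have Km: "K \<in> sets lebesgue" by (auto intro: lmeasurable_compact fmeasurableD)
  then have "integrable (restrict_space (lebesgue_on \<Omega>) K) u"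
    using K u \<Omega> integrable_mult_indicator[of K "lebesgue_on \<Omega>" u]
    by (subst integrable_restrict_space) (auto simp: sets_restrict_space_iff)
  then show "integrable (lebesgue_on K) u"
    using K Km \<Omega> by (simp add: restrict_restrict_space restrict_space_sets_cong Int_absorb1)
qed

lemma locally_integrable_restrict:
  assumes "locally_integrable \<Omega> f" "compact K" "K \<subseteq> \<Omega>"
  shows "integrable lebesgue (\<lambda>x. indicator K x *\<^sub>R f x)"
proof -
  have "integrable (lebesgue_on K) f" using assms by (auto simp: locally_integrable_def)
  then show ?thesis
    using assms(2) by (subst (asm) integrable_restrict_space) (auto intro: lmeasurable_compact fmeasurableD)
qed

text \<open>The last form truncates \<open>f\<close> to \<open>K\<close>, which turns a locally
  integrable function into one integrable on the whole space, as the mollification lemmas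
  require.\<close>

lemma locally_integrable_times:
  assumes \<Omega>: "\<Omega> \<in> sets lebesgue" and f: "locally_integrable \<Omega> f" and K: "compact K" "K \<subseteq> \<Omega>"
    and w: "w \<in> borel_measurable lebesgue" "AE x in lebesgue. \<bar>w x\<bar> \<le> B" "\<And>x. x \<notin> K \<Longrightarrow> w x = 0"
  shows "integrable lebesgue (\<lambda>x. f x * complex_of_real (w x))"
    and "integrable (lebesgue_on \<Omega>) (\<lambda>x. f x * complex_of_real (w x))"
    and "(LINT x|lebesgue_on \<Omega>. f x * complex_of_real (w x)) = (LINT x|lebesgue. f x * complex_of_real (w x))"
    and "(LINT x|lebesgue_on \<Omega>. f x * complex_of_real (w x)) = (LINT x|lebesgue. (indicator K x *\<^sub>R f x) * complex_of_real (w x))"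
proof -
  have eq: "w x *\<^sub>R (indicator K x *\<^sub>R f x) = f x * complex_of_real (w x)" for x
    using w(3)[of x] by (cases "x \<in> K") (auto simp: scaleR_conv_of_real)
  have eq2: "indicator \<Omega> x *\<^sub>R (f x * complex_of_real (w x)) = f x * complex_of_real (w x)" for x
    using w(3)[of x] K(2) by (cases "x \<in> \<Omega>") auto
  have eq3: "(indicator K x *\<^sub>R f x) * complex_of_real (w x) = f x * complex_of_real (w x)" for x
    using w(3)[of x] by (cases "x \<in> K") auto
  show i: "integrable lebesgue (\<lambda>x. f x * complex_of_real (w x))"
    using integrable_scaleR_bounded[OF locally_integrable_restrict[OF f K] w(1,2)] unfolding eq .
  then show "integrable (lebesgue_on \<Omega>) (\<lambda>x. f x * complex_of_real (w x))"
    using \<Omega> by (subst integrable_restrict_space) (auto simp: eq2)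
  show r: "(LINT x|lebesgue_on \<Omega>. f x * complex_of_real (w x)) = (LINT x|lebesgue. f x * complex_of_real (w x))"
    using \<Omega> by (subst integral_restrict_space) (auto simp: eq2)
  show "(LINT x|lebesgue_on \<Omega>. f x * complex_of_real (w x)) = (LINT x|lebesgue. (indicator K x *\<^sub>R f x) * complex_of_real (w x))"
    by (simp only: r eq3)
qed

lemma test_times:
  assumes \<phi>: "\<phi> \<in> test_functions \<Omega>" and op: "open \<Omega>" and f: "locally_integrable \<Omega> f"
  shows "integrable lebesgue (\<lambda>x. f x * complex_of_real (\<phi> x))"
    and "integrable (lebesgue_on \<Omega>) (\<lambda>x. f x * complex_of_real (\<phi> x))"
    and "(LINT x|lebesgue_on \<Omega>. f x * complex_of_real (\<phi> x)) = (LINT x|lebesgue. f x * complex_of_real (\<phi> x))"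
proof -
  obtain B where B: "\<And>x. \<bar>\<phi> x\<bar> \<le> B" using test_bounded[OF \<phi>] by blast
  let ?K = "closure {x. \<phi> x \<noteq> 0}"
  have K: "compact ?K" "?K \<subseteq> \<Omega>" using \<phi> by (auto simp: test_functions_def)
  have m: "\<phi> \<in> borel_measurable lebesgue" using test_borel_measurable[OF \<phi>] by (intro measurable_completion) simp
  have ae: "AE x in lebesgue. \<bar>\<phi> x\<bar> \<le> B" using B by simp
  have z: "\<phi> x = 0" if "x \<notin> ?K" for x using that by (rule test_zero_outside)
  note * = locally_integrable_times[OF _ f K m ae z]
  have \<Omega>: "\<Omega> \<in> sets lebesgue" using op by simp
  show "integrable lebesgue (\<lambda>x. f x * complex_of_real (\<phi> x))" by (rule *(1)[OF \<Omega>])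
  show "integrable (lebesgue_on \<Omega>) (\<lambda>x. f x * complex_of_real (\<phi> x))" by (rule *(2)[OF \<Omega>])
  show "(LINT x|lebesgue_on \<Omega>. f x * complex_of_real (\<phi> x)) = (LINT x|lebesgue. f x * complex_of_real (\<phi> x))"
    by (rule *(3)[OF \<Omega>])
qed

lemma locally_integrable_diff:
  "locally_integrable \<Omega> f \<Longrightarrow> locally_integrable \<Omega> g \<Longrightarrow> locally_integrable \<Omega> (\<lambda>x. f x - g x)"
  by (auto simp: locally_integrable_def)

lemma has_weak_partial_unique:
  assumes op: "open \<Omega>" and g: "has_weak_partial \<Omega> j f g" and h: "has_weak_partial \<Omega> j f h"
  shows "AE x in lebesgue. x \<in> \<Omega> \<longrightarrow> g x = h x"
proof -
  have li: "locally_integrable \<Omega> g" "locally_integrable \<Omega> h" using g h by (auto simp: has_weak_partial_def)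
  have "AE x in lebesgue. x \<in> \<Omega> \<longrightarrow> g x - h x = 0"
  proof (rule fundamental_lemma[OF op locally_integrable_diff[OF li]])
    fix \<phi> assume \<phi>: "\<phi> \<in> test_functions \<Omega>"
    have "(LINT x|lebesgue_on \<Omega>. f x * complex_of_real (partial_deriv j \<phi> x)) = - (LINT x|lebesgue_on \<Omega>. k x * complex_of_real (\<phi> x))"
      if "has_weak_partial \<Omega> j f k" for k
      using that \<phi> unfolding has_weak_partial_def by blast
    from this[OF g] this[OF h]
    have "(LINT x|lebesgue_on \<Omega>. g x * complex_of_real (\<phi> x)) = (LINT x|lebesgue_on \<Omega>. h x * complex_of_real (\<phi> x))"
      by simp
    then show "(LINT x|lebesgue_on \<Omega>. (g x - h x) * complex_of_real (\<phi> x)) = 0"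
      using test_times(2)[OF \<phi> op li(1)] test_times(2)[OF \<phi> op li(2)] by (simp add: left_diff_distrib)
  qed
  then show ?thesis by simp
qed

lemma locally_integrable_cong_AE:
  assumes op: "open \<Omega>" and fg: "AE x in lebesgue. x \<in> \<Omega> \<longrightarrow> f x = g x"
  shows "locally_integrable \<Omega> f \<longleftrightarrow> locally_integrable \<Omega> g"
proof -
  have "integrable (lebesgue_on K) f \<longleftrightarrow> integrable (lebesgue_on K) g" if K: "compact K \<and> K \<subseteq> \<Omega>" for K
  proof (rule lebesgue_on_cong_AE(1))
    show "K \<in> sets lebesgue" using K by (auto intro: lmeasurable_compact fmeasurableD)
    show "AE x in lebesgue. x \<in> K \<longrightarrow> f x = g x" using fg by eventually_elim (use K in auto)
  qed
  then show ?thesis by (auto simp: locally_integrable_def)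
qed

lemma has_weak_partial_cong_AE:
  assumes op: "open \<Omega>" and f: "AE x in lebesgue. x \<in> \<Omega> \<longrightarrow> f x = f' x" and g: "AE x in lebesgue. x \<in> \<Omega> \<longrightarrow> g x = g' x"
  shows "has_weak_partial \<Omega> j f g \<longleftrightarrow> has_weak_partial \<Omega> j f' g'"
proof -
  have m: "\<Omega> \<in> sets lebesgue" using op by simp
  have "(LINT x|lebesgue_on \<Omega>. f x * complex_of_real (w x)) = (LINT x|lebesgue_on \<Omega>. f' x * complex_of_real (w x))" for w
    by (rule lebesgue_on_cong_AE(2)[OF m]) (use f in \<open>auto elim: eventually_mono\<close>)
  moreover have "(LINT x|lebesgue_on \<Omega>. g x * complex_of_real (w x)) = (LINT x|lebesgue_on \<Omega>. g' x * complex_of_real (w x))" for w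
    by (rule lebesgue_on_cong_AE(2)[OF m]) (use g in \<open>auto elim: eventually_mono\<close>)
  ultimately show ?thesis
    unfolding has_weak_partial_def using locally_integrable_cong_AE[OF op f] locally_integrable_cong_AE[OF op g] by simp
qed

lemma weak_partial_works: "has_weak_partial \<Omega> j f g \<Longrightarrow> has_weak_partial \<Omega> j f (weak_partial \<Omega> j f)"
  unfolding weak_partial_def by (rule someI[where P="has_weak_partial \<Omega> j f"])

lemma partial_deriv_reflect:
  assumes "\<eta> differentiable (at (x - z))"
  shows "partial_deriv j (\<lambda>z. \<eta> (x - z)) z = - partial_deriv j \<eta> (x - z)"
proof -
  have "(\<eta> has_derivative frechet_derivative \<eta> (at (x - z))) (at (x - z))"
    using assms by (simp add: frechet_derivative_works)
  moreover have "((\<lambda>z. x - z) has_derivative (\<lambda>h. - h)) (at z)"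
    by (auto intro!: derivative_eq_intros)
  ultimately have "((\<lambda>z. \<eta> (x - z)) has_derivative (\<lambda>h. frechet_derivative \<eta> (at (x - z)) (- h))) (at z)"
    using has_derivative_compose by blast
  from has_derivative_partial_deriv[OF this] show ?thesis
    by (simp add: partial_deriv_def linear_neg[OF linear_frechet_derivative[OF assms]])
qed

text \<open>The kernel at \<open>x\<close> is a test function of \<Omega> because its ball lies
  inside. Differentiating \<open>mollifier r (x - z)\<close> in \<open>z\<close> produces a sign
  that cancels the one in the definition of the weak derivative. The indicator of \<open>A\<close>
  is invisible, since the kernel and its derivative vanish off \<open>A\<close>.\<close>

lemma mollify_weak_partial:
  assumes op: "open \<Omega>" and w: "has_weak_partial \<Omega> j f g" and r: "0 < r" and A: "cball x r \<subseteq> A" "A \<subseteq> \<Omega>"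
  shows "mollify (partial_deriv j (mollifier r)) (\<lambda>z. indicator A z *\<^sub>R f z) x
       = mollify (mollifier r) (\<lambda>z. indicator A z *\<^sub>R g z) x"
proof -
  let ?\<phi> = "\<lambda>z. mollifier r (x - z)"
  have \<phi>: "?\<phi> \<in> test_functions \<Omega>" using r A by (intro mollifier_shift_test_function) auto
  have li: "locally_integrable \<Omega> f" "locally_integrable \<Omega> g" using w by (auto simp: has_weak_partial_def)
  have p: "partial_deriv j ?\<phi> z = - partial_deriv j (mollifier r) (x - z)" for z
    by (intro partial_deriv_reflect elementary_smooth_differentiable mollifier_elementary)
  have z1: "?\<phi> z = 0" if "z \<notin> A" for z
    using that A(1) mollifier_support[OF r, of "x - z"] by (force simp: dist_norm)
  have z2: "partial_deriv j (mollifier r) (x - z) = 0" if "z \<notin> A" for z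
  proof -
    have "closure {y. ?\<phi> y \<noteq> 0} \<subseteq> cball x r"
      using mollifier_support[OF r] by (intro closure_minimal) (auto simp: dist_norm)
    then have "z \<notin> closure {y. ?\<phi> y \<noteq> 0}" using that A(1) by blast
    from partial_deriv_zero_outside[OF this] show ?thesis using p[of z] by simp
  qed
  have "mollify (partial_deriv j (mollifier r)) (\<lambda>z. indicator A z *\<^sub>R f z) x = (LINT z|lebesgue. - (f z * complex_of_real (partial_deriv j ?\<phi> z)))"
    unfolding mollify_def
  proof (intro Bochner_Integration.integral_cong refl)
    fix z show "partial_deriv j (mollifier r) (x - z) *\<^sub>R indicator A z *\<^sub>R f z = - (f z * complex_of_real (partial_deriv j ?\<phi> z))"
      using z2[of z] p[of z] by (cases "z \<in> A") (auto simp: scaleR_conv_of_real)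
  qed
  also have "\<dots> = - (LINT z|lebesgue_on \<Omega>. f z * complex_of_real (partial_deriv j ?\<phi> z))"
    using test_times(3)[OF partial_deriv_test_function[OF \<phi>] op li(1)] by simp
  also have "\<dots> = (LINT z|lebesgue_on \<Omega>. g z * complex_of_real (?\<phi> z))"
    using w \<phi> by (simp add: has_weak_partial_def)
  also have "\<dots> = (LINT z|lebesgue. g z * complex_of_real (?\<phi> z))"
    by (rule test_times(3)[OF \<phi> op li(2)])
  also have "\<dots> = mollify (mollifier r) (\<lambda>z. indicator A z *\<^sub>R g z) x"
    unfolding mollify_def
  proof (intro Bochner_Integration.integral_cong refl)
    fix z show "g z * complex_of_real (?\<phi> z) = mollifier r (x - z) *\<^sub>R indicator A z *\<^sub>R g z"
      using z1[of z] by (cases "z \<in> A") (auto simp: scaleR_conv_of_real)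
  qed
  finally show ?thesis .
qed

section \<open>Mollification of bounded functions and of Lipschitz test functions\<close>

lemma mollifier_shift_integral:
  assumes r: "0 < r"
  shows "integrable lebesgue (\<lambda>z. mollifier r (x - z))" "(LINT z|lebesgue. mollifier r (x - z :: real^'n::finite)) = 1"
proof -
  have [measurable]: "(mollifier r :: real^'n \<Rightarrow> real) \<in> borel_measurable borel"
    using mollifier_test_function[OF r] by (rule test_borel_measurable)
  have e: "mollifier r (x - z) = mollifier r (z - x)" for z using mollifier_minus[of r "x - z"] by simp
  have "integrable (distr lborel borel ((+) (- x))) (mollifier r)"
    using mollifier_integrable[OF r] by (simp add: lborel_distr_plus)
  then have "integrable lborel (\<lambda>z. mollifier r (z - x))" by (subst (asm) integrable_distr_eq) auto
  then show "integrable lebesgue (\<lambda>z. mollifier r (x - z))" by (subst integrable_completion) (auto simp: e)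
  have "(LINT z|lborel. mollifier r (z - x)) = 1"
    using integral_lborel_translate[of "mollifier r" "- x"] mollifier_integral[OF r, where 'n='n] by simp
  then show "(LINT z|lebesgue. mollifier r (x - z)) = 1" by (subst integral_completion) (auto simp: e)
qed

text \<open>A mollification is an average with respect to a probability density.\<close>

lemma mollify_bounded:
  fixes w :: "real^'n::finite \<Rightarrow> real"
  assumes r: "0 < r" and w: "integrable lebesgue w" "AE x in lebesgue. \<bar>w x\<bar> \<le> W"
  shows "\<bar>mollify (mollifier r) w x\<bar> \<le> W"
proof -
  have "\<bar>mollify (mollifier r) w x\<bar> \<le> (LINT z|lebesgue. mollifier r (x - z) * W)"
    unfolding mollify_def real_norm_def[symmetric]
  proof (rule Bochner_Integration.integral_norm_bound[THEN order_trans], rule integral_mono_AE)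
    show "integrable lebesgue (\<lambda>z. norm (mollifier r (x - z) *\<^sub>R w z))"
      using mollify_integrable[OF mollifier_test_function[OF r] w(1)] by (rule integrable_norm)
    show "integrable lebesgue (\<lambda>z. mollifier r (x - z) * W)" using mollifier_shift_integral(1)[OF r, of x] by simp
    show "AE z in lebesgue. norm (mollifier r (x - z) *\<^sub>R w z) \<le> mollifier r (x - z) * W"
      using w(2) by eventually_elim (auto simp: abs_mult mollifier_nonneg[OF r] intro!: mult_left_mono)
  qed
  also have "\<dots> = W" using mollifier_shift_integral[OF r, of x] by simp
  finally show ?thesis .
qed

lemma mollify_measurable:
  assumes "\<eta> \<in> test_functions UNIV" "integrable lebesgue f"
  shows "mollify \<eta> f \<in> borel_measurable borel"
proof -
  obtain L where "L-lipschitz_on UNIV (mollify \<eta> f)" using mollify_lipschitz[OF assms] by blast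
  then show ?thesis by (intro borel_measurable_continuous_onI lipschitz_on_continuous_on)
qed

text \<open>The mollifications of \<open>w\<close> stay bounded and converge in \<open>L\<^sup>1\<close>; splitting off the part where \<open>h\<close> is large
  avoids passing to an almost everywhere convergent subsequence.\<close>

lemma mollify_dual_convergence:
  fixes w :: "real^'n::finite \<Rightarrow> real" and h :: "real^'n \<Rightarrow> complex"
  assumes h: "integrable lebesgue h" and w: "integrable lebesgue w" "AE x in lebesgue. \<bar>w x\<bar> \<le> W"
    and e: "0 < (e::real)"
  shows "\<exists>\<delta>>0. \<forall>r. 0 < r \<and> r < \<delta> \<longrightarrow>
    cmod ((LINT x|lebesgue. h x * complex_of_real (mollify (mollifier r) w x)) - (LINT x|lebesgue. h x * complex_of_real (w x))) \<le> e"
proof -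
  \<comment> \<open>\<open>W'\<close> still bounds \<open>w\<close> and is positive, as the division
    by it requires.\<close>
  define W' where "W' = max W 1"
  have W': "W' > 0" "W \<le> W'" by (auto simp: W'_def)
  define t where "t n x = (if norm (h x) > real n then norm (h x) else 0)" for n :: nat and x
  have tm: "t n \<in> borel_measurable lebesgue" for n
    unfolding t_def using h by measurable
  have "(\<lambda>n. LINT x|lebesgue. t n x) \<longlonglongrightarrow> (LINT x|(lebesgue :: (real^'n) measure). (0::real))"
  proof (rule integral_dominated_convergence)
    show "integrable lebesgue (\<lambda>x. norm (h x))" using h by simp
    show "t n \<in> borel_measurable lebesgue" for n by (rule tm)
    show "AE x in lebesgue. (\<lambda>n. t n x) \<longlonglongrightarrow> 0"
    proof (rule AE_I2)
      fix x
      obtain N :: nat where "norm (h x) \<le> real N" using real_arch_simple by blast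
      then have "\<forall>n\<ge>N. t n x = 0" by (auto simp: t_def)
      then show "(\<lambda>n. t n x) \<longlonglongrightarrow> 0" by (intro tendsto_eventually) (auto simp: eventually_sequentially)
    qed
  qed (auto simp: t_def)
  then have "(\<lambda>n. LINT x|lebesgue. t n x) \<longlonglongrightarrow> 0" by simp
  then have "eventually (\<lambda>n. (LINT x|lebesgue. t n x) < e / (4 * W')) sequentially"
    using e W' by (intro order_tendstoD) auto
  then obtain n where n: "(LINT x|lebesgue. t n x) < e / (4 * W')" by (auto simp: eventually_sequentially)
  \<comment> \<open>The constants make each half of the error at most \<open>e / 2\<close>: the part
    below level \<open>n\<close> costs \<open>n * e / (2 * (n + 1))\<close>, the part above it
    \<open>2 * W' * e / (4 * W')\<close>.\<close>
  have "0 < e / (2 * (real n + 1))" using e by simp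
  from mollify_L1_convergence[OF w(1) this] obtain \<delta> where \<delta>: "\<delta> > 0" "\<And>r. 0 < r \<and> r < \<delta> \<Longrightarrow>
      (\<integral>\<^sup>+x. ennreal (norm (mollify (mollifier r) w x - w x)) \<partial>lebesgue) \<le> ennreal (e / (2 * (real n + 1)))" by blast
  have "cmod ((LINT x|lebesgue. h x * complex_of_real (mollify (mollifier r) w x)) - (LINT x|lebesgue. h x * complex_of_real (w x))) \<le> e"
    if r: "0 < r" "r < \<delta>" for r
  proof -
    let ?m = "mollify (mollifier r) w"
    have mm: "?m \<in> borel_measurable lebesgue"
      using mollify_measurable[OF mollifier_test_function[OF r(1)] w(1)] by (intro measurable_completion) simp
    have mb: "\<bar>?m x\<bar> \<le> W'" for x using mollify_bounded[OF r(1) w, of x] W' by linarith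
    have wb: "AE x in lebesgue. \<bar>w x\<bar> \<le> W'" using w(2) by eventually_elim (use W' in linarith)
    have i1: "integrable lebesgue (\<lambda>x. h x * complex_of_real (?m x))"
      using integrable_scaleR_bounded[OF h mm AE_I2[OF mb]] by (simp add: scaleR_conv_of_real mult.commute)
    have i2: "integrable lebesgue (\<lambda>x. h x * complex_of_real (w x))"
      using integrable_scaleR_bounded[OF h borel_measurable_integrable[OF w(1)] wb] by (simp add: scaleR_conv_of_real mult.commute)
    have fin: "(\<integral>\<^sup>+x. ennreal (norm (?m x - w x)) \<partial>lebesgue) < \<infinity>"
      using \<delta>(2)[of r] r by (auto intro: le_less_trans)
    have di: "integrable lebesgue (\<lambda>x. ?m x - w x)"
      using fin mm w(1) by (auto simp: integrable_iff_bounded)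
    have dle: "(LINT x|lebesgue. \<bar>?m x - w x\<bar>) \<le> e / (2 * (real n + 1))"
    proof -
      have "ennreal (LINT x|lebesgue. \<bar>?m x - w x\<bar>) = (\<integral>\<^sup>+x. ennreal \<bar>?m x - w x\<bar> \<partial>lebesgue)"
        using di by (intro nn_integral_eq_integral[symmetric]) auto
      also have "\<dots> \<le> ennreal (e / (2 * (real n + 1)))" using \<delta>(2)[of r] r by simp
      finally show ?thesis using e by (subst (asm) ennreal_le_iff) auto
    qed
    have ti: "integrable lebesgue (t n)"
      by (rule Bochner_Integration.integrable_bound[OF h tm]) (auto simp: t_def)
    have "cmod ((LINT x|lebesgue. h x * complex_of_real (?m x)) - (LINT x|lebesgue. h x * complex_of_real (w x)))
       = cmod (LINT x|lebesgue. h x * complex_of_real (?m x - w x))"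
      using i1 i2 by (simp add: right_diff_distrib)
    also have "\<dots> \<le> (LINT x|lebesgue. cmod (h x * complex_of_real (?m x - w x)))"
      by (rule Bochner_Integration.integral_norm_bound)
    also have "\<dots> \<le> (LINT x|lebesgue. real n * \<bar>?m x - w x\<bar> + (2 * W') * t n x)"
    proof (rule integral_mono_AE)
      show "integrable lebesgue (\<lambda>x. cmod (h x * complex_of_real (?m x - w x)))"
        using i1 i2 by (intro integrable_norm) (simp add: right_diff_distrib)
      show "integrable lebesgue (\<lambda>x. real n * \<bar>?m x - w x\<bar> + (2 * W') * t n x)" using di ti by auto
      show "AE x in lebesgue. cmod (h x * complex_of_real (?m x - w x)) \<le> real n * \<bar>?m x - w x\<bar> + (2 * W') * t n x"
        using wb
      proof eventually_elim
        case (elim x)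
        have eq: "cmod (h x * complex_of_real (?m x - w x)) = cmod (h x) * \<bar>?m x - w x\<bar>"
          by (simp only: norm_mult norm_of_real)
        show ?case
        proof (cases "norm (h x) > real n")
          case True
          have "cmod (h x) * \<bar>?m x - w x\<bar> \<le> cmod (h x) * (2 * W')"
            using elim mb[of x] by (intro mult_left_mono norm_ge_zero) linarith
          then show ?thesis unfolding eq using True by (simp add: t_def mult.commute add_increasing)
        next
          case False
          then show ?thesis unfolding eq by (auto simp: t_def intro!: mult_right_mono)
        qed
      qed
    qed
    also have "\<dots> = real n * (LINT x|lebesgue. \<bar>?m x - w x\<bar>) + (2 * W') * (LINT x|lebesgue. t n x)"
      using di ti by simp
    also have "\<dots> \<le> real n * (e / (2 * (real n + 1))) + (2 * W') * (e / (4 * W'))"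
      using dle n W' by (intro add_mono mult_left_mono) auto
    also have "\<dots> \<le> e / 2 + e / 2"
      using e W' by (intro add_mono) (auto simp: field_simps)
    finally show ?thesis by simp
  qed
  with \<delta>(1) show ?thesis by blast
qed

lemma lipschitz_partial_deriv_limit:
  fixes f :: "real^'n::finite \<Rightarrow> real"
  assumes L: "L-lipschitz_on UNIV f"
  shows "AE x in lebesgue. (\<lambda>k. real (Suc k) *\<^sub>R (f (x + (1 / real (Suc k)) *\<^sub>R axis j 1) - f x)) \<longlonglongrightarrow> partial_deriv j f x"
  using Rademacher[OF L] unfolding partial_deriv_def
  by eventually_elim (rule has_derivative_imp_quotient_limit, simp add: frechet_derivative_works)

lemma lipschitz_partial_deriv_bound:
  fixes f :: "real^'n::finite \<Rightarrow> real"
  assumes L: "L-lipschitz_on UNIV f"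
  shows "AE x in lebesgue. \<bar>partial_deriv j f x\<bar> \<le> L"
  using Rademacher[OF L]
proof eventually_elim
  case (elim x)
  then have "norm (frechet_derivative f (at x) (axis j 1)) \<le> L * norm (axis j 1 :: real^'n)"
    by (intro lipschitz_has_derivative_bound[OF L]) (simp add: frechet_derivative_works)
  then show ?case by (simp add: partial_deriv_def)
qed

lemma lipschitz_partial_deriv_measurable:
  fixes f :: "real^'n::finite \<Rightarrow> real"
  assumes L: "L-lipschitz_on UNIV f"
  shows "partial_deriv j f \<in> borel_measurable lebesgue"
  by (rule lipschitz_integration_by_parts(1)[OF L zero_test_function lipschitz_partial_deriv_limit[OF L]])

text \<open>The counterpart of \<open>mollify_weak_partial\<close> for a Lipschitz function and its
  classical derivative; here integration by parts against the kernel comes from the convergence of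
  difference quotients.\<close>

lemma mollify_lipschitz_partial:
  fixes f :: "real^'n::finite \<Rightarrow> real"
  assumes L: "L-lipschitz_on UNIV f" and r: "0 < r"
  shows "mollify (partial_deriv j (mollifier r)) f x = mollify (mollifier r) (partial_deriv j f) x"
proof -
  let ?\<phi> = "\<lambda>z. mollifier r (x - z)"
  have \<phi>: "?\<phi> \<in> test_functions UNIV" using r by (intro mollifier_shift_test_function) auto
  have p: "partial_deriv j ?\<phi> z = - partial_deriv j (mollifier r) (x - z)" for z
    by (intro partial_deriv_reflect elementary_smooth_differentiable mollifier_elementary)
  have "(LINT z|lebesgue. ?\<phi> z *\<^sub>R partial_deriv j f z) = - (LINT z|lebesgue. frechet_derivative ?\<phi> (at z) (axis j 1) *\<^sub>R f z)"
    by (rule lipschitz_integration_by_parts(3)[OF L \<phi> lipschitz_partial_deriv_limit[OF L]])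
  also have "\<dots> = (LINT z|lebesgue. partial_deriv j (mollifier r) (x - z) *\<^sub>R f z)"
    using p by (simp add: partial_deriv_def)
  finally show ?thesis by (simp add: mollify_def)
qed

lemma compact_bounded_measurable_integrable:
  fixes w :: "'a::euclidean_space \<Rightarrow> real"
  assumes K: "compact K" and w: "w \<in> borel_measurable lebesgue" "AE x in lebesgue. \<bar>w x\<bar> \<le> B" "\<And>x. x \<notin> K \<Longrightarrow> w x = 0"
  shows "integrable lebesgue w"
proof -
  have "integrable lebesgue (\<lambda>x. indicator K x :: real)"
    using K lmeasurable_compact[OF K] by (auto simp: lmeasurable_iff_integrable)
  from integrable_scaleR_bounded[OF this w(1,2)]
  have "integrable lebesgue (\<lambda>x. w x *\<^sub>R (indicator K x :: real))" .
  moreover have "(\<lambda>x. w x *\<^sub>R (indicator K x :: real)) = w" using w(3) by (force simp: indicator_def)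
  ultimately show ?thesis by simp
qed

lemma zero_if_norm_le_multiples:
  fixes z :: "'a::real_normed_vector"
  assumes "0 \<le> c" "\<And>e. 0 < e \<Longrightarrow> norm z \<le> c * e"
  shows "z = 0"
proof (rule ccontr)
  assume "z \<noteq> 0"
  then have "0 < norm z / (c + 1) / 2" using assms(1) by simp
  from assms(2)[OF this] have "norm z \<le> c * (norm z / (c + 1) / 2)" .
  also have "\<dots> = norm z * (c / (c + 1)) / 2" by simp
  also have "\<dots> \<le> norm z * 1 / 2"
    using assms(1) by (intro divide_right_mono mult_left_mono) auto
  finally show False using \<open>z \<noteq> 0\<close> by simp
qed

lemma finite_common_positive_bound:
  fixes \<delta> :: "'a::finite \<Rightarrow> real"
  assumes "\<And>i. 0 < \<delta> i" "0 < \<epsilon>"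
  obtains r where "0 < r" "r < \<epsilon>" "\<And>i. r < \<delta> i"
proof -
  define m where "m = Min (insert \<epsilon> (range \<delta>))"
  have m: "0 < m" using assms by (auto simp: m_def)
  moreover have "m \<le> \<epsilon>" "m \<le> \<delta> i" for i unfolding m_def by (rule Min_le; simp)+
  ultimately have m: "0 < m" "m \<le> \<epsilon>" "\<And>i. m \<le> \<delta> i" by blast+
  show ?thesis
  proof
    show "0 < m / 2" "m / 2 < \<epsilon>" using m by auto
    show "m / 2 < \<delta> i" for i using m(1) m(3)[of i] by linarith
  qed
qed

text \<open>For small \<open>r\<close> the mollification of \<xi> is an admissible test function
  whose partial derivatives are the mollified \<open>partial_deriv j \<xi>\<close>. These stay
  bounded by the Lipschitz constant, so \<open>mollify_dual_convergence\<close> applies against the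
  truncated fields, which are merely integrable.\<close>

lemma weak_divergence_lipschitz:
  fixes h :: "'n::finite \<Rightarrow> real^'n \<Rightarrow> complex"
  assumes op: "open \<Omega>" and h: "\<And>j. locally_integrable \<Omega> (h j)" and s: "locally_integrable \<Omega> s"
    and eq: "\<And>\<phi>. \<phi> \<in> test_functions \<Omega> \<Longrightarrow>
      (LINT x|lebesgue_on \<Omega>. (\<Sum>j\<in>UNIV. h j x * complex_of_real (partial_deriv j \<phi> x)) + s x * complex_of_real (\<phi> x)) = 0"
    and L: "L-lipschitz_on UNIV \<xi>" and K: "compact K" "K \<subseteq> \<Omega>" "\<And>x. x \<notin> K \<Longrightarrow> \<xi> x = 0"
  shows "(LINT x|lebesgue_on \<Omega>. (\<Sum>j\<in>UNIV. h j x * complex_of_real (partial_deriv j \<xi> x)) + s x * complex_of_real (\<xi> x)) = 0"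
proof -
  have m\<Omega>: "\<Omega> \<in> sets lebesgue" using op by simp
  obtain \<epsilon> where \<epsilon>: "\<epsilon> > 0" "(\<Union>x\<in>K. cball x \<epsilon>) \<subseteq> \<Omega>"
    using compact_subset_open_imp_cball_epsilon_subset[OF K(1) op K(2)] by blast
  define A where "A = (\<Union>x\<in>K. cball x \<epsilon>)"
  have A: "compact A" "A \<subseteq> \<Omega>" using K(1) \<epsilon>(2) unfolding A_def by (auto intro: compact_minkowski_sum_cball)
  have KA: "K \<subseteq> A" using \<epsilon>(1) by (force simp: A_def)
  define hA where "hA j x = indicator A x *\<^sub>R h j x" for j x
  define sA where "sA x = indicator A x *\<^sub>R s x" for x
  have hA: "integrable lebesgue (hA j)" for j unfolding hA_def by (rule locally_integrable_restrict[OF h A])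
  have sA: "integrable lebesgue sA" unfolding sA_def by (rule locally_integrable_restrict[OF s A])
  \<comment> \<open>The left-hand side of the weak identity for fields truncated to the compact
    neighbourhood \<open>A\<close> of \<open>K\<close>, with the derivatives \<open>w\<close> and
    the values \<open>v\<close> of the test function as independent arguments. Mollifying \<xi>
    changes it by at most \<open>CARD('n) + 1\<close> errors of size \<open>e\<close>.\<close>
  define T where "T w v = (\<Sum>j\<in>UNIV. LINT x|lebesgue. hA j x * complex_of_real (w j x)) + (LINT x|lebesgue. sA x * complex_of_real (v x))"
    for w :: "'n \<Rightarrow> real^'n \<Rightarrow> real" and v :: "real^'n \<Rightarrow> real"
  have T: "(LINT x|lebesgue_on \<Omega>. (\<Sum>j\<in>UNIV. h j x * complex_of_real (w j x)) + s x * complex_of_real (v x)) = T w v"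
    if w: "\<And>j. w j \<in> borel_measurable lebesgue" "\<And>j. AE x in lebesgue. \<bar>w j x\<bar> \<le> B j" "\<And>j x. x \<notin> A \<Longrightarrow> w j x = 0"
      and v: "v \<in> borel_measurable lebesgue" "AE x in lebesgue. \<bar>v x\<bar> \<le> B'" "\<And>x. x \<notin> A \<Longrightarrow> v x = 0"
    for w :: "'n \<Rightarrow> real^'n \<Rightarrow> real" and v :: "real^'n \<Rightarrow> real" and B B'
  proof -
    have i1: "integrable (lebesgue_on \<Omega>) (\<lambda>x. h j x * complex_of_real (w j x))" for j
      by (rule locally_integrable_times(2)[OF m\<Omega> h A w])
    have i2: "integrable (lebesgue_on \<Omega>) (\<lambda>x. s x * complex_of_real (v x))"
      by (rule locally_integrable_times(2)[OF m\<Omega> s A v])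
    have "(LINT x|lebesgue_on \<Omega>. h j x * complex_of_real (w j x)) = (LINT x|lebesgue. hA j x * complex_of_real (w j x))" for j
      unfolding hA_def by (rule locally_integrable_times(4)[OF m\<Omega> h A w])
    moreover have "(LINT x|lebesgue_on \<Omega>. s x * complex_of_real (v x)) = (LINT x|lebesgue. sA x * complex_of_real (v x))"
      unfolding sA_def by (rule locally_integrable_times(4)[OF m\<Omega> s A v])
    ultimately show ?thesis
      using i1 i2 by (simp add: T_def Bochner_Integration.integral_add Bochner_Integration.integral_sum)
  qed
  let ?d = "\<lambda>j. partial_deriv j \<xi>"
  have dm: "?d j \<in> borel_measurable lebesgue" for j by (rule lipschitz_partial_deriv_measurable[OF L])
  have db: "AE x in lebesgue. \<bar>?d j x\<bar> \<le> L" for j by (rule lipschitz_partial_deriv_bound[OF L])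
  have d0: "?d j x = 0" if "x \<notin> K" for j x
  proof (rule partial_deriv_zero_outside)
    have "closure {x. \<xi> x \<noteq> 0} \<subseteq> K" using K by (intro closure_minimal compact_imp_closed) auto
    then show "x \<notin> closure {x. \<xi> x \<noteq> 0}" using that by blast
  qed
  have di: "integrable lebesgue (?d j)" for j
    by (rule compact_bounded_measurable_integrable[OF K(1) dm db d0])
  have cont: "continuous_on UNIV \<xi>" by (rule lipschitz_on_continuous_on[OF L])
  have \<xi>m: "\<xi> \<in> borel_measurable lebesgue"
    using borel_measurable_continuous_onI[OF cont] by (intro measurable_completion) simp
  obtain B where B: "\<And>x. x \<in> K \<Longrightarrow> norm (\<xi> x) \<le> B"
    using compact_imp_bounded[OF compact_continuous_image[OF continuous_on_subset[OF cont] K(1)]]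
    unfolding bounded_iff by blast
  have \<xi>b: "AE x in lebesgue. \<bar>\<xi> x\<bar> \<le> max B 0"
  proof (rule AE_I2)
    fix x show "\<bar>\<xi> x\<bar> \<le> max B 0" using B[of x] K(3)[of x] by (cases "x \<in> K") auto
  qed
  have \<xi>i: "integrable lebesgue \<xi>"
    by (rule compact_bounded_measurable_integrable[OF K(1) \<xi>m \<xi>b K(3)])
  have main: "norm (T ?d \<xi>) \<le> (real CARD('n) + 1) * e" if e: "0 < e" for e
  proof -
    have "\<forall>j. \<exists>\<delta>>0. \<forall>r. 0 < r \<and> r < \<delta> \<longrightarrow>
      cmod ((LINT x|lebesgue. hA j x * complex_of_real (mollify (mollifier r) (?d j) x)) - (LINT x|lebesgue. hA j x * complex_of_real (?d j x))) \<le> e"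
      using mollify_dual_convergence[OF hA di db e] by blast
    then obtain \<delta> where \<delta>: "\<And>j. \<delta> j > 0" "\<And>j r. 0 < r \<Longrightarrow> r < \<delta> j \<Longrightarrow>
      cmod ((LINT x|lebesgue. hA j x * complex_of_real (mollify (mollifier r) (?d j) x)) - (LINT x|lebesgue. hA j x * complex_of_real (?d j x))) \<le> e"
      by metis
    obtain \<delta>' where \<delta>': "\<delta>' > 0" "\<And>r. 0 < r \<Longrightarrow> r < \<delta>' \<Longrightarrow>
      cmod ((LINT x|lebesgue. sA x * complex_of_real (mollify (mollifier r) \<xi> x)) - (LINT x|lebesgue. sA x * complex_of_real (\<xi> x))) \<le> e"
      using mollify_dual_convergence[OF sA \<xi>i \<xi>b e] by blast
    obtain r where r: "0 < r" "r < min \<epsilon> \<delta>'" "\<And>j. r < \<delta> j"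
      using finite_common_positive_bound[of \<delta> "min \<epsilon> \<delta>'"] \<delta>(1) \<delta>'(1) \<epsilon>(1) by auto
    let ?\<phi> = "mollify (mollifier r) \<xi>"
    have "(\<Union>x\<in>K. cball x r) \<subseteq> A" using r by (force simp: A_def)
    then have \<phi>: "?\<phi> \<in> test_functions A"
      by (intro mollify_test_function[OF r(1) \<xi>i K(1,3)])
    then have \<phi>\<Omega>: "?\<phi> \<in> test_functions \<Omega>" using test_functions_mono[OF A(2)] by blast
    have pd: "partial_deriv j ?\<phi> = mollify (mollifier r) (?d j)" for j
      using mollify_partial_deriv[OF mollifier_test_function[OF r(1)] \<xi>i, of j] mollify_lipschitz_partial[OF L r(1), of j] by auto
    have tm: "\<psi> \<in> borel_measurable lebesgue" "\<exists>B. AE x in lebesgue. \<bar>\<psi> x\<bar> \<le> B" "\<And>x. x \<notin> A \<Longrightarrow> \<psi> x = 0"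
      if \<psi>: "\<psi> \<in> test_functions A" for \<psi>
    proof -
      show "\<psi> \<in> borel_measurable lebesgue" using test_borel_measurable[OF \<psi>] by (intro measurable_completion) simp
      obtain B where "\<And>x. \<bar>\<psi> x\<bar> \<le> B" using test_bounded[OF \<psi>] by blast
      then show "\<exists>B. AE x in lebesgue. \<bar>\<psi> x\<bar> \<le> B" by (intro exI[of _ B]) simp
      show "\<psi> x = 0" if "x \<notin> A" for x
        using \<psi> that test_zero_outside[of x \<psi>] by (auto simp: test_functions_def)
    qed
    have pt: "partial_deriv j ?\<phi> \<in> test_functions A" for j by (rule partial_deriv_test_function[OF \<phi>])
    obtain B where B: "\<And>j. AE x in lebesgue. \<bar>partial_deriv j ?\<phi> x\<bar> \<le> B j"
      using tm(2)[OF pt] by metis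
    obtain B' where B': "AE x in lebesgue. \<bar>?\<phi> x\<bar> \<le> B'" using tm(2)[OF \<phi>] by blast
    have "T (\<lambda>j. partial_deriv j ?\<phi>) ?\<phi> = 0"
      using T[of "\<lambda>j. partial_deriv j ?\<phi>" B ?\<phi> B', OF tm(1)[OF pt] B tm(3)[OF pt] tm(1)[OF \<phi>] B' tm(3)[OF \<phi>]] eq[OF \<phi>\<Omega>] by simp
    then have "T ?d \<xi> = - (T (\<lambda>j. mollify (mollifier r) (?d j)) ?\<phi> - T ?d \<xi>)" by (simp add: pd)
    also have "T (\<lambda>j. mollify (mollifier r) (?d j)) ?\<phi> - T ?d \<xi> =
       (\<Sum>j\<in>UNIV. (LINT x|lebesgue. hA j x * complex_of_real (mollify (mollifier r) (?d j) x)) - (LINT x|lebesgue. hA j x * complex_of_real (?d j x)))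
       + ((LINT x|lebesgue. sA x * complex_of_real (?\<phi> x)) - (LINT x|lebesgue. sA x * complex_of_real (\<xi> x)))"
      by (simp add: T_def sum_subtractf)
    also have "norm (- \<dots>) \<le> (\<Sum>j\<in>(UNIV::'n set). e) + e"
      unfolding norm_minus_cancel
      by (intro norm_triangle_mono order_trans[OF norm_sum] sum_mono \<delta>(2) \<delta>'(2)) (use r in auto)
    finally show ?thesis by (simp add: algebra_simps)
  qed
  have "T ?d \<xi> = 0" by (rule zero_if_norm_le_multiples[OF _ main]) simp_all
  moreover have "(LINT x|lebesgue_on \<Omega>. (\<Sum>j\<in>UNIV. h j x * complex_of_real (?d j x)) + s x * complex_of_real (\<xi> x)) = T ?d \<xi>"
    by (rule T[OF dm db _ \<xi>m \<xi>b]) (use d0 K(3) KA in blast)+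
  ultimately show ?thesis by simp
qed

subsection \<open>The weak chain rule and the Piola transform\<close>

context bilipschitz_pair
begin

text \<open>Change of variables for \<open>G\<close>, whose Jacobian determinant is bounded by some
  \<open>C\<close> because \<open>G\<close> is Lipschitz. Composition with \<open>F\<close> is
  therefore bounded in integral norms.\<close>

lemma compose_nn_bound:
  obtains C where "0 \<le> C" "\<And>v :: real^'n \<Rightarrow> ennreal. v \<in> borel_measurable (lebesgue_on \<Omega>') \<Longrightarrow>
     (\<integral>\<^sup>+x. v (F x) \<partial>lebesgue_on \<Omega>) \<le> ennreal C * (\<integral>\<^sup>+y. v y \<partial>lebesgue_on \<Omega>')"
proof -
  let ?d = "bilipschitz_pair.dens G"
  obtain C where C: "0 \<le> C" "AE y in lebesgue. ?d y \<le> C"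
    using bilipschitz_pair.dens_bounded[OF swap] by blast
  have Cae: "AE y in lebesgue_on \<Omega>'. ?d y \<le> C"
    unfolding bilipschitz_pair.AE_on_dom[OF swap] using C(2) by eventually_elim simp
  have "(\<integral>\<^sup>+x. v (F x) \<partial>lebesgue_on \<Omega>) \<le> ennreal C * (\<integral>\<^sup>+y. v y \<partial>lebesgue_on \<Omega>')"
    if v: "v \<in> borel_measurable (lebesgue_on \<Omega>')" for v :: "real^'n \<Rightarrow> ennreal"
  proof -
    have vF: "(\<lambda>x. v (F x)) \<in> borel_measurable (lebesgue_on \<Omega>)" by (rule measurable_compose[OF F_measurable v])
    have Gm: "G \<in> measurable (density (lebesgue_on \<Omega>') (\<lambda>y. ennreal (?d y))) (lebesgue_on \<Omega>)"
      using bilipschitz_pair.F_measurable[OF swap] by simp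
    have vFG: "(\<lambda>y. v (F (G y))) \<in> borel_measurable (lebesgue_on \<Omega>')"
      by (rule measurable_compose[OF bilipschitz_pair.F_measurable[OF swap] vF])
    have "(\<integral>\<^sup>+x. v (F x) \<partial>lebesgue_on \<Omega>) = (\<integral>\<^sup>+y. v (F (G y)) \<partial>density (lebesgue_on \<Omega>') (\<lambda>y. ennreal (?d y)))"
      by (subst bilipschitz_pair.distr_dens[OF swap, symmetric], rule nn_integral_distr[OF Gm]) (use vF in simp)
    also have "\<dots> = (\<integral>\<^sup>+y. ennreal (?d y) * v (F (G y)) \<partial>lebesgue_on \<Omega>')"
      using bilipschitz_pair.dens_measurable_on[OF swap] vFG by (subst nn_integral_density) auto
    also have "\<dots> \<le> (\<integral>\<^sup>+y. ennreal C * v y \<partial>lebesgue_on \<Omega>')"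
    proof (rule nn_integral_mono_AE)
      have "AE y in lebesgue_on \<Omega>'. y \<in> \<Omega>'" by (rule AE_I2) simp
      with Cae show "AE y in lebesgue_on \<Omega>'. ennreal (?d y) * v (F (G y)) \<le> ennreal C * v y"
        by eventually_elim (auto simp: FG intro!: mult_right_mono ennreal_leI)
    qed
    also have "\<dots> = ennreal C * (\<integral>\<^sup>+y. v y \<partial>lebesgue_on \<Omega>')" by (rule nn_integral_cmult[OF v])
    finally show ?thesis .
  qed
  then show ?thesis using that C(1) by blast
qed

lemma compose_integrable:
  fixes u :: "real^'n \<Rightarrow> 'b::euclidean_space"
  assumes u: "integrable (lebesgue_on \<Omega>') u"
  shows "integrable (lebesgue_on \<Omega>) (\<lambda>x. u (F x))"
proof -
  obtain C where C: "0 \<le> C" "\<And>v :: real^'n \<Rightarrow> ennreal. v \<in> borel_measurable (lebesgue_on \<Omega>') \<Longrightarrow>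
     (\<integral>\<^sup>+x. v (F x) \<partial>lebesgue_on \<Omega>) \<le> ennreal C * (\<integral>\<^sup>+y. v y \<partial>lebesgue_on \<Omega>')"
    using compose_nn_bound by blast
  have um: "u \<in> borel_measurable (lebesgue_on \<Omega>')" and uf: "(\<integral>\<^sup>+y. norm (u y) \<partial>lebesgue_on \<Omega>') < \<infinity>"
    using u by (auto simp: integrable_iff_bounded)
  have "(\<integral>\<^sup>+x. norm (u (F x)) \<partial>lebesgue_on \<Omega>) \<le> ennreal C * (\<integral>\<^sup>+y. norm (u y) \<partial>lebesgue_on \<Omega>')"
    using um by (intro C(2)[of "\<lambda>y. ennreal (norm (u y))"]) auto
  also have "\<dots> < \<infinity>" using uf by (simp add: ennreal_mult_less_top)
  finally show ?thesis using compose_F_measurable[OF um] by (simp add: integrable_iff_bounded)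
qed

lemma dom_lebesgue: "\<Omega> \<in> sets lebesgue" and ran_lebesgue: "\<Omega>' \<in> sets lebesgue"
  using open_dom open_ran by auto

lemma weighted_compose_integrable:
  fixes u :: "real^'n \<Rightarrow> 'b::euclidean_space"
  assumes u: "integrable lebesgue u"
    and w: "w \<in> borel_measurable lebesgue" "AE x in lebesgue. \<bar>w x\<bar> \<le> W" "\<And>x. x \<notin> \<Omega> \<Longrightarrow> w x = 0"
  shows "integrable lebesgue (\<lambda>x. w x *\<^sub>R u (F x))"
proof -
  have "integrable (lebesgue_on \<Omega>') u"
    using integrable_mult_indicator[OF ran_lebesgue u] ran_lebesgue by (subst integrable_restrict_space) auto
  then have "integrable (lebesgue_on \<Omega>) (\<lambda>x. u (F x))" by (rule compose_integrable)
  then have "integrable lebesgue (\<lambda>x. indicator \<Omega> x *\<^sub>R u (F x))"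
    using dom_lebesgue by (subst (asm) integrable_restrict_space) auto
  from integrable_scaleR_bounded[OF this w(1,2)]
  have "integrable lebesgue (\<lambda>x. w x *\<^sub>R indicator \<Omega> x *\<^sub>R u (F x))" .
  moreover have "w x *\<^sub>R indicator \<Omega> x *\<^sub>R u (F x) = w x *\<^sub>R u (F x)" for x using w(3)[of x] by (cases "x \<in> \<Omega>") auto
  ultimately show ?thesis by (simp only:)
qed

text \<open>Measures how an L1 error on the image domain propagates to integrals over \<Omega> with
  weight \<open>w\<close>. The constant of \<open>compose_nn_bound\<close> is passed in, so that a
  single \<open>C\<close> serves all approximations.\<close>

lemma weighted_compose_diff:
  fixes u u' :: "real^'n \<Rightarrow> 'b::euclidean_space"
  assumes C: "0 \<le> C" "\<And>v :: real^'n \<Rightarrow> ennreal. v \<in> borel_measurable (lebesgue_on \<Omega>') \<Longrightarrow>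
     (\<integral>\<^sup>+x. v (F x) \<partial>lebesgue_on \<Omega>) \<le> ennreal C * (\<integral>\<^sup>+y. v y \<partial>lebesgue_on \<Omega>')"
    and u: "integrable lebesgue u" and u': "u' \<in> borel_measurable lebesgue"
    and w: "w \<in> borel_measurable lebesgue" "AE x in lebesgue. \<bar>w x\<bar> \<le> W" "\<And>x. x \<notin> \<Omega> \<Longrightarrow> w x = 0" and W: "0 \<le> W"
    and e: "0 \<le> e" "(\<integral>\<^sup>+y. ennreal (norm (u' y - u y)) \<partial>lebesgue) \<le> ennreal e"
  shows "integrable lebesgue (\<lambda>x. w x *\<^sub>R u' (F x))"
    and "norm ((LINT x|lebesgue. w x *\<^sub>R u' (F x)) - (LINT x|lebesgue. w x *\<^sub>R u (F x))) \<le> W * C * e"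
proof -
  have um: "(\<lambda>y. u' y - u y) \<in> borel_measurable lebesgue" using u u' by measurable
  have di: "integrable lebesgue (\<lambda>y. u' y - u y)"
  proof -
    have "(\<integral>\<^sup>+y. ennreal (norm (u' y - u y)) \<partial>lebesgue) < \<infinity>" using e(2) by (rule le_less_trans) simp
    then show ?thesis using um unfolding integrable_iff_bounded by blast
  qed
  have "integrable lebesgue (\<lambda>y. (u' y - u y) + u y)" using di u by (rule Bochner_Integration.integrable_add)
  then have u'i: "integrable lebesgue u'" by simp
  show i': "integrable lebesgue (\<lambda>x. w x *\<^sub>R u' (F x))" by (rule weighted_compose_integrable[OF u'i w])
  have i: "integrable lebesgue (\<lambda>x. w x *\<^sub>R u (F x))" by (rule weighted_compose_integrable[OF u w])
  have id: "integrable lebesgue (\<lambda>x. w x *\<^sub>R (u' (F x) - u (F x)))"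
    using i i' by (simp add: scaleR_diff_right)
  have nm: "(\<lambda>y. ennreal (norm (u' y - u y))) \<in> borel_measurable (lebesgue_on \<Omega>')"
    using u' borel_measurable_integrable[OF u] by (intro measurable_restrict_space1) measurable
  have vFm: "(\<lambda>x. ennreal (norm (u' (F x) - u (F x)))) \<in> borel_measurable (lebesgue_on \<Omega>)"
    by (rule measurable_compose[OF F_measurable nm])
  have "(\<integral>\<^sup>+y. ennreal (norm (u' y - u y)) \<partial>lebesgue_on \<Omega>') \<le> (\<integral>\<^sup>+y. ennreal (norm (u' y - u y)) \<partial>lebesgue)"
    using ran_lebesgue by (subst nn_integral_restrict_space) (auto intro!: nn_integral_mono simp: indicator_def)
  then have le: "(\<integral>\<^sup>+y. ennreal (norm (u' y - u y)) \<partial>lebesgue_on \<Omega>') \<le> ennreal e"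
    using e(2) by (rule order_trans)
  have "ennreal (norm ((LINT x|lebesgue. w x *\<^sub>R u' (F x)) - (LINT x|lebesgue. w x *\<^sub>R u (F x))))
     = ennreal (norm (LINT x|lebesgue. w x *\<^sub>R (u' (F x) - u (F x))))"
    using i i' by (simp add: scaleR_diff_right)
  also have "\<dots> \<le> (\<integral>\<^sup>+x. norm (w x *\<^sub>R (u' (F x) - u (F x))) \<partial>lebesgue)"
    by (rule integral_norm_bound_ennreal[OF id])
  also have "\<dots> \<le> (\<integral>\<^sup>+x. ennreal W * ennreal (norm (u' (F x) - u (F x))) * indicator \<Omega> x \<partial>lebesgue)"
  proof (rule nn_integral_mono_AE)
    show "AE x in lebesgue. ennreal (norm (w x *\<^sub>R (u' (F x) - u (F x)))) \<le> ennreal W * ennreal (norm (u' (F x) - u (F x))) * indicator \<Omega> x"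
      using w(2)
    proof eventually_elim
      case (elim x)
      then show ?case
        using w(3)[of x] W by (cases "x \<in> \<Omega>") (auto simp flip: ennreal_mult intro!: ennreal_leI mult_right_mono)
    qed
  qed
  also have "\<dots> = (\<integral>\<^sup>+x. ennreal W * ennreal (norm (u' (F x) - u (F x))) \<partial>lebesgue_on \<Omega>)"
    using dom_lebesgue by (subst nn_integral_restrict_space) auto
  also have "\<dots> = ennreal W * (\<integral>\<^sup>+x. ennreal (norm (u' (F x) - u (F x))) \<partial>lebesgue_on \<Omega>)"
    by (rule nn_integral_cmult[OF vFm])
  also have "\<dots> \<le> ennreal W * (ennreal C * (\<integral>\<^sup>+y. ennreal (norm (u' y - u y)) \<partial>lebesgue_on \<Omega>'))"
    by (intro mult_left_mono C(2)[OF nm]) auto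
  also have "\<dots> \<le> ennreal W * (ennreal C * ennreal e)"
    by (intro mult_left_mono le) auto
  also have "\<dots> = ennreal (W * C * e)" using W C(1) e(1) by (simp flip: ennreal_mult add: mult.assoc)
  finally show "norm ((LINT x|lebesgue. w x *\<^sub>R u' (F x)) - (LINT x|lebesgue. w x *\<^sub>R u (F x))) \<le> W * C * e"
    using W C(1) e(1) by (subst (asm) ennreal_le_iff) auto
qed

lemma compose_locally_integrable:
  assumes f: "locally_integrable \<Omega>' f"
  shows "locally_integrable \<Omega> (\<lambda>x. f (F x))"
  unfolding locally_integrable_def
proof (intro allI impI)
  fix K assume K: "compact K \<and> K \<subseteq> \<Omega>"
  have FK: "compact (F ` K)" "F ` K \<subseteq> \<Omega>'" using K F_in by (auto intro: compact_continuous_image F_continuous)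
  have Ks: "K \<in> sets lebesgue" using K by (auto intro: lmeasurable_compact fmeasurableD)
  have ind: "(\<lambda>x. indicator K x :: real) \<in> borel_measurable lebesgue" using Ks by simp
  have "integrable lebesgue (\<lambda>x. indicator K x *\<^sub>R (indicator (F ` K) (F x) *\<^sub>R f (F x)))"
    by (rule weighted_compose_integrable[OF locally_integrable_restrict[OF f FK] ind, where W=1]) (use K in \<open>auto simp: indicator_def\<close>)
  moreover have "indicator K x *\<^sub>R (indicator (F ` K) (F x) *\<^sub>R f (F x)) = indicator K x *\<^sub>R f (F x)" for x
    by (auto simp: indicator_def)
  ultimately have "integrable lebesgue (\<lambda>x. indicator K x *\<^sub>R f (F x))" by (simp only:)
  then show "integrable (lebesgue_on K) (\<lambda>x. f (F x))"
    using Ks by (subst integrable_restrict_space) auto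
qed

end

lemma locally_integrable_mult_bounded:
  assumes f: "locally_integrable \<Omega> f" and w: "w \<in> borel_measurable lebesgue" "AE x in lebesgue. \<bar>w x\<bar> \<le> W"
  shows "locally_integrable \<Omega> (\<lambda>x. f x * complex_of_real (w x))"
  unfolding locally_integrable_def
proof (intro allI impI)
  fix K assume K: "compact K \<and> K \<subseteq> \<Omega>"
  then have fK: "integrable (lebesgue_on K) f" using f by (auto simp: locally_integrable_def)
  have "AE x in lebesgue_on K. \<bar>w x\<bar> \<le> W"
    using w(2) K by (subst AE_restrict_space_iff) (auto intro: lmeasurable_compact fmeasurableD)
  from integrable_scaleR_bounded[OF fK measurable_restrict_space1[OF w(1)] this]
  show "integrable (lebesgue_on K) (\<lambda>x. f x * complex_of_real (w x))"
    by (simp add: scaleR_conv_of_real mult.commute)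
qed

lemma locally_integrable_sum:
  "(\<And>i. i \<in> I \<Longrightarrow> locally_integrable \<Omega> (f i)) \<Longrightarrow> locally_integrable \<Omega> (\<lambda>x. \<Sum>i\<in>I. f i x)"
  by (auto simp: locally_integrable_def)

context bilipschitz_pair
begin

text \<open>For the mollification of the truncated \<open>f\<close> the classical chain rule holds
  wherever \<open>F\<close> is differentiable, and integration by parts is available because the
  composite is Lipschitz. On the image of the support of \<phi> the derivatives of the mollification
  are the mollified \<open>g p\<close>, so both sides converge in L1, and composition with
  \<open>F\<close> preserves this.\<close>

lemma weak_partial_chain:
  assumes wp: "\<And>p. has_weak_partial \<Omega>' p f (g p)"
  shows "has_weak_partial \<Omega> l (\<lambda>x. f (F x)) (\<lambda>x. \<Sum>p\<in>UNIV. g p (F x) * complex_of_real (jacobian F (at x) $ p $ l))"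
proof -
  have lf: "locally_integrable \<Omega>' f" and lg: "locally_integrable \<Omega>' (g p)" for p
    using wp by (auto simp: has_weak_partial_def)
  let ?J = "\<lambda>p x. jacobian F (at x) $ p $ l"
  have Jm: "?J p \<in> borel_measurable lebesgue" for p by (rule lipschitz_jacobian_measurable[OF F_lip])
  have Jb: "AE x in lebesgue. \<bar>?J p x\<bar> \<le> L" for p
    using Rademacher[OF F_lip] by eventually_elim (rule lipschitz_jacobian_bound[OF F_lip])
  have L0: "0 \<le> L" by (rule lipschitz_on_nonneg[OF F_lip])
  have lfF: "locally_integrable \<Omega> (\<lambda>x. f (F x))" by (rule compose_locally_integrable[OF lf])
  have lgF: "locally_integrable \<Omega> (\<lambda>x. g p (F x) * complex_of_real (?J p x))" for p
    by (rule locally_integrable_mult_bounded[OF compose_locally_integrable[OF lg] Jm Jb])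
  obtain C where C: "0 \<le> C" "\<And>v :: real^'n \<Rightarrow> ennreal. v \<in> borel_measurable (lebesgue_on \<Omega>') \<Longrightarrow>
     (\<integral>\<^sup>+x. v (F x) \<partial>lebesgue_on \<Omega>) \<le> ennreal C * (\<integral>\<^sup>+y. v y \<partial>lebesgue_on \<Omega>')"
    using compose_nn_bound by blast
  have "(LINT x|lebesgue_on \<Omega>. f (F x) * complex_of_real (partial_deriv l \<phi> x))
      = - (LINT x|lebesgue_on \<Omega>. (\<Sum>p\<in>UNIV. g p (F x) * complex_of_real (?J p x)) * complex_of_real (\<phi> x))"
    if \<phi>: "\<phi> \<in> test_functions \<Omega>" for \<phi>
  proof -
    define K where "K = closure {x. \<phi> x \<noteq> 0}"
    have K: "compact K" "K \<subseteq> \<Omega>" using \<phi> by (auto simp: test_functions_def K_def)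
    have \<phi>0: "\<phi> x = 0" "partial_deriv l \<phi> x = 0" if "x \<notin> K" for x
      using that test_zero_outside partial_deriv_zero_outside unfolding K_def by blast+
    have FK: "compact (F ` K)" "F ` K \<subseteq> \<Omega>'" using K F_in by (auto intro: compact_continuous_image F_continuous)
    obtain \<epsilon> where \<epsilon>: "\<epsilon> > 0" "(\<Union>y\<in>F ` K. cball y \<epsilon>) \<subseteq> \<Omega>'"
      using compact_subset_open_imp_cball_epsilon_subset[OF FK(1) open_ran FK(2)] by blast
    define A where "A = (\<Union>y\<in>F ` K. cball y \<epsilon>)"
    have A: "compact A" "A \<subseteq> \<Omega>'"
      unfolding A_def by (rule compact_minkowski_sum_cball[OF FK(1)], rule \<epsilon>(2))
    have FKA: "F x \<in> A" if "x \<in> K" for x using that \<epsilon>(1) by (auto simp: A_def intro!: bexI[of _ x])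
    define fA where "fA y = indicator A y *\<^sub>R f y" for y
    define gA where "gA p y = indicator A y *\<^sub>R g p y" for p y
    have fA: "integrable lebesgue fA" unfolding fA_def by (rule locally_integrable_restrict[OF lf A])
    have gA: "integrable lebesgue (gA p)" for p unfolding gA_def by (rule locally_integrable_restrict[OF lg A])
    define w where "w p x = \<phi> x * ?J p x" for p x
    obtain B where B: "0 \<le> B" "\<And>x. \<bar>\<phi> x\<bar> \<le> B" using test_bounded[OF \<phi>] by blast
    obtain B' where B': "0 \<le> B'" "\<And>x. \<bar>partial_deriv l \<phi> x\<bar> \<le> B'"
      using test_bounded[OF partial_deriv_test_function[OF \<phi>]] by blast
    have \<phi>m: "\<phi> \<in> borel_measurable lebesgue" "partial_deriv l \<phi> \<in> borel_measurable lebesgue"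
      using test_borel_measurable[OF \<phi>] test_borel_measurable[OF partial_deriv_test_function[OF \<phi>]]
      by (auto intro: measurable_completion)
    have wm: "w p \<in> borel_measurable lebesgue" for p unfolding w_def using \<phi>m(1) Jm by (intro borel_measurable_times) auto
    have wb: "AE x in lebesgue. \<bar>w p x\<bar> \<le> B * L" for p
      using Jb[of p] by eventually_elim (use B L0 in \<open>auto simp: w_def abs_mult intro!: mult_mono\<close>)
    have w0: "w p x = 0" if "x \<notin> \<Omega>" for p x using \<phi>0(1)[of x] that K by (auto simp: w_def)
    have d0: "partial_deriv l \<phi> x = 0" if "x \<notin> \<Omega>" for x using \<phi>0(2)[of x] that K by auto
    have db: "AE x in lebesgue. \<bar>partial_deriv l \<phi> x\<bar> \<le> B'" using B' by simp
    \<comment> \<open>The defect of the desired identity. For mollified data it is 0, so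
      \<open>Z\<close> is bounded by the approximation errors.\<close>
    define Z where "Z = (\<Sum>p\<in>UNIV. LINT x|lebesgue. w p x *\<^sub>R gA p (F x)) + (LINT x|lebesgue. partial_deriv l \<phi> x *\<^sub>R fA (F x))"
    have main: "norm Z \<le> (real CARD('n) * (B * L * C) + B' * C) * e" if e: "0 < e" for e
    proof -
      have "\<forall>p. \<exists>\<delta>>0. \<forall>r. 0 < r \<and> r < \<delta> \<longrightarrow> (\<integral>\<^sup>+x. ennreal (norm (mollify (mollifier r) (gA p) x - gA p x)) \<partial>lebesgue) \<le> ennreal e"
        using mollify_L1_convergence[OF gA e] by blast
      then obtain \<delta> where \<delta>: "\<And>p. \<delta> p > 0" "\<And>p r. 0 < r \<Longrightarrow> r < \<delta> p \<Longrightarrow>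
          (\<integral>\<^sup>+x. ennreal (norm (mollify (mollifier r) (gA p) x - gA p x)) \<partial>lebesgue) \<le> ennreal e"
        by metis
      obtain \<delta>' where \<delta>': "\<delta>' > 0" "\<And>r. 0 < r \<Longrightarrow> r < \<delta>' \<Longrightarrow>
          (\<integral>\<^sup>+x. ennreal (norm (mollify (mollifier r) fA x - fA x)) \<partial>lebesgue) \<le> ennreal e"
        using mollify_L1_convergence[OF fA e] by blast
      obtain r where r: "0 < r" "r < min \<epsilon> \<delta>'" "\<And>p. r < \<delta> p"
        using finite_common_positive_bound[of \<delta> "min \<epsilon> \<delta>'"] \<delta>(1) \<delta>'(1) \<epsilon>(1) by auto
      let ?\<eta> = "mollifier r :: real^'n \<Rightarrow> real"
      have \<eta>: "?\<eta> \<in> test_functions UNIV" by (rule mollifier_test_function[OF r(1)])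
      let ?m = "mollify ?\<eta> fA"
      let ?D = "\<lambda>p. mollify (partial_deriv p ?\<eta>) fA"
      have mg: "mollify ?\<eta> (gA p) \<in> borel_measurable lebesgue" for p
        using mollify_measurable[OF \<eta> gA] by (intro measurable_completion) simp
      have mf: "?m \<in> borel_measurable lebesgue"
        using mollify_measurable[OF \<eta> fA] by (intro measurable_completion) simp
      obtain M where M: "M-lipschitz_on UNIV ?m" using mollify_lipschitz[OF \<eta> fA] by blast
      have HL: "(M * L)-lipschitz_on UNIV (\<lambda>x. ?m (F x))"
        by (rule lipschitz_on_compose2[OF F_lip lipschitz_on_subset[OF M subset_UNIV]])
      have lim: "AE x in lebesgue. (\<lambda>k. real (Suc k) *\<^sub>R (?m (F (x + (1 / real (Suc k)) *\<^sub>R axis l 1)) - ?m (F x)))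
          \<longlonglongrightarrow> (\<Sum>p\<in>UNIV. ?J p x *\<^sub>R ?D p (F x))"
        using Rademacher[OF F_lip]
      proof eventually_elim
        case (elim x)
        then have "(F has_derivative frechet_derivative F (at x)) (at x)" by (simp add: frechet_derivative_works)
        from has_derivative_compose[OF this mollify_has_derivative[OF \<eta> fA]]
        have "((\<lambda>x. ?m (F x)) has_derivative (\<lambda>v. \<Sum>p\<in>UNIV. frechet_derivative F (at x) v $ p *\<^sub>R ?D p (F x))) (at x)" .
        from has_derivative_imp_quotient_limit[OF this, of "axis l 1"]
        show ?case by (simp only: jacobian_column[OF elim])
      qed
      note ibp = lipschitz_integration_by_parts[OF HL \<phi> lim]
      \<comment> \<open>On \<open>K\<close> the ball of radius \<open>r\<close> about
        \<open>F x\<close> lies in \<open>A\<close>, where mollification commutes with the weak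
        derivative; off \<open>K\<close> both sides vanish with \<phi>.\<close>
      have mol: "\<phi> x *\<^sub>R (\<Sum>p\<in>UNIV. ?J p x *\<^sub>R ?D p (F x)) = (\<Sum>p\<in>UNIV. w p x *\<^sub>R mollify ?\<eta> (gA p) (F x))" for x
      proof (cases "x \<in> K")
        case True
        then have "cball (F x) r \<subseteq> A" using r by (force simp: A_def)
        then have "?D p (F x) = mollify ?\<eta> (gA p) (F x)" for p
          unfolding fA_def gA_def by (intro mollify_weak_partial[OF open_ran wp r(1) _ A(2)])
        then show ?thesis by (simp add: scaleR_sum_right w_def)
      next
        case False then show ?thesis using \<phi>0(1)[OF False] by (simp add: w_def)
      qed
      have g1: "integrable lebesgue (\<lambda>x. w p x *\<^sub>R mollify ?\<eta> (gA p) (F x))"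
        and g2: "norm ((LINT x|lebesgue. w p x *\<^sub>R mollify ?\<eta> (gA p) (F x)) - (LINT x|lebesgue. w p x *\<^sub>R gA p (F x))) \<le> B * L * C * e" for p
        using weighted_compose_diff[OF C gA mg wm wb w0 _ _ \<delta>(2)] B(1) L0 e r by auto
      have f2: "norm ((LINT x|lebesgue. partial_deriv l \<phi> x *\<^sub>R ?m (F x)) - (LINT x|lebesgue. partial_deriv l \<phi> x *\<^sub>R fA (F x))) \<le> B' * C * e"
        using weighted_compose_diff(2)[OF C fA mf \<phi>m(2) db d0 B'(1) _ \<delta>'(2)] e r by auto
      have "(\<Sum>p\<in>UNIV. LINT x|lebesgue. w p x *\<^sub>R mollify ?\<eta> (gA p) (F x)) = (LINT x|lebesgue. (\<Sum>p\<in>UNIV. w p x *\<^sub>R mollify ?\<eta> (gA p) (F x)))"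
        using g1 by (simp add: Bochner_Integration.integral_sum)
      also have "\<dots> = - (LINT x|lebesgue. partial_deriv l \<phi> x *\<^sub>R ?m (F x))"
        using ibp(3) by (simp only: mol partial_deriv_def)
      finally have "Z = - (\<Sum>p\<in>UNIV. (LINT x|lebesgue. w p x *\<^sub>R mollify ?\<eta> (gA p) (F x)) - (LINT x|lebesgue. w p x *\<^sub>R gA p (F x)))
         - ((LINT x|lebesgue. partial_deriv l \<phi> x *\<^sub>R ?m (F x)) - (LINT x|lebesgue. partial_deriv l \<phi> x *\<^sub>R fA (F x)))"
        by (simp add: Z_def sum_subtractf)
      also have "norm \<dots> \<le> (\<Sum>p\<in>(UNIV::'n set). B * L * C * e) + B' * C * e"
        by (rule order_trans[OF norm_triangle_ineq4], rule add_mono[OF _ f2], unfold norm_minus_cancel,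
            rule order_trans[OF norm_sum], rule sum_mono, rule g2)
      finally show ?thesis by (simp add: algebra_simps)
    qed
    have Z0: "Z = 0"
      by (rule zero_if_norm_le_multiples[OF _ main]) (use B(1) B'(1) L0 C(1) in auto)
    have wg: "integrable lebesgue (\<lambda>x. w p x *\<^sub>R gA p (F x))" for p
      by (rule weighted_compose_integrable[OF gA wm wb w0])
    have "(LINT x|lebesgue_on \<Omega>. f (F x) * complex_of_real (partial_deriv l \<phi> x)) = (LINT x|lebesgue. f (F x) * complex_of_real (partial_deriv l \<phi> x))"
      by (rule test_times(3)[OF partial_deriv_test_function[OF \<phi>] open_dom lfF])
    also have "\<dots> = (LINT x|lebesgue. partial_deriv l \<phi> x *\<^sub>R fA (F x))"
      using FKA \<phi>0(2) by (intro Bochner_Integration.integral_cong) (auto simp: fA_def indicator_def scaleR_conv_of_real)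
    also have "\<dots> = - (\<Sum>p\<in>UNIV. LINT x|lebesgue. w p x *\<^sub>R gA p (F x))"
      using Z0 unfolding Z_def by (simp add: add_eq_0_iff)
    also have "\<dots> = - (LINT x|lebesgue. (\<Sum>p\<in>UNIV. w p x *\<^sub>R gA p (F x)))"
      using wg by (simp add: Bochner_Integration.integral_sum)
    also have "(LINT x|lebesgue. (\<Sum>p\<in>UNIV. w p x *\<^sub>R gA p (F x)))
        = (LINT x|lebesgue. (\<Sum>p\<in>UNIV. g p (F x) * complex_of_real (?J p x)) * complex_of_real (\<phi> x))"
    proof (intro Bochner_Integration.integral_cong refl)
      fix x
      show "(\<Sum>p\<in>UNIV. w p x *\<^sub>R gA p (F x)) = (\<Sum>p\<in>UNIV. g p (F x) * complex_of_real (?J p x)) * complex_of_real (\<phi> x)"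
        using FKA[of x] \<phi>0(1)[of x]
        by (cases "x \<in> K") (auto simp: w_def gA_def scaleR_conv_of_real sum_distrib_left mult_ac)
    qed
    also have "\<dots> = (LINT x|lebesgue_on \<Omega>. (\<Sum>p\<in>UNIV. g p (F x) * complex_of_real (?J p x)) * complex_of_real (\<phi> x))"
      by (rule test_times(3)[OF \<phi> open_dom locally_integrable_sum, symmetric]) (rule lgF)
    finally show ?thesis .
  qed
  moreover have "locally_integrable \<Omega> (\<lambda>x. \<Sum>p\<in>UNIV. g p (F x) * complex_of_real (?J p x))"
    by (rule locally_integrable_sum) (rule lgF)
  ultimately show ?thesis
    unfolding has_weak_partial_def using lfF by blast
qed

text \<open>\<xi> is \<phi> composed with \<open>G\<close> and extended by 0; it is Lipschitz but in
  general not smooth. Two points of \<open>\<Omega>'\<close> give the constant \<open>M * L\<close>.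
  If one point lies outside, the values differ only when the other is in the compact
  \<open>K\<close>, at distance at least \<epsilon>, which gives
  \<open>B / \<epsilon>\<close>.\<close>

lemma test_pushforward:
  assumes \<phi>: "\<phi> \<in> test_functions \<Omega>"
  obtains M \<xi> K where "M-lipschitz_on UNIV \<xi>" "compact K" "K \<subseteq> \<Omega>'" "\<And>y. y \<notin> K \<Longrightarrow> \<xi> y = 0"
    "\<And>x. x \<in> \<Omega> \<Longrightarrow> \<xi> (F x) = \<phi> x"
proof -
  define S where "S = closure {x. \<phi> x \<noteq> 0}"
  have S: "compact S" "S \<subseteq> \<Omega>" using \<phi> by (auto simp: test_functions_def S_def)
  define K where "K = F ` S"
  have K: "compact K" "K \<subseteq> \<Omega>'" using S F_in by (auto simp: K_def intro: compact_continuous_image F_continuous)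
  define \<xi> where "\<xi> y = (if y \<in> \<Omega>' then \<phi> (G y) else 0)" for y
  have \<xi>0: "\<xi> y = 0" if "y \<notin> K" for y
  proof -
    have "G y \<notin> S" if "y \<in> \<Omega>'" using \<open>y \<notin> K\<close> FG[OF that] unfolding K_def by (metis imageI)
    then show ?thesis using test_zero_outside[of "G y" \<phi>] by (auto simp: \<xi>_def S_def)
  qed
  obtain \<epsilon> where \<epsilon>: "\<epsilon> > 0" "(\<Union>y\<in>K. ball y \<epsilon>) \<subseteq> \<Omega>'"
    using compact_subset_open_imp_ball_epsilon_subset[OF K(1) open_ran K(2)] by blast
  obtain B where B: "0 \<le> B" "\<And>x. \<bar>\<phi> x\<bar> \<le> B" using test_bounded[OF \<phi>] by blast
  obtain M where M: "M-lipschitz_on UNIV \<phi>" using test_lipschitz[OF \<phi>] by blast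
  have nonneg: "0 \<le> M * L" using lipschitz_on_nonneg[OF M] lipschitz_on_nonneg[OF F_lip] by simp
  have far: "\<bar>\<xi> y - \<xi> z\<bar> \<le> B / \<epsilon> * dist y z" if "z \<notin> \<Omega>'" for y z
  proof (cases "y \<in> K")
    case True
    then have "\<epsilon> \<le> dist y z" using \<epsilon>(2) that by (force simp: not_le)
    then have "B / \<epsilon> * \<epsilon> \<le> B / \<epsilon> * dist y z" using B(1) \<epsilon>(1) by (intro mult_left_mono) auto
    moreover have "\<bar>\<xi> y - \<xi> z\<bar> \<le> B" using that B by (simp add: \<xi>_def)
    ultimately show ?thesis using \<epsilon>(1) by simp
  next
    case False then show ?thesis using \<xi>0[of y] that B(1) \<epsilon>(1) by (simp add: \<xi>_def)
  qed
  have "(M * L + B / \<epsilon>)-lipschitz_on UNIV \<xi>"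
  proof (rule lipschitz_onI)
    fix y z
    have "\<bar>\<xi> y - \<xi> z\<bar> \<le> (M * L) * dist y z \<or> \<bar>\<xi> y - \<xi> z\<bar> \<le> B / \<epsilon> * dist y z"
    proof (cases "y \<in> \<Omega>' \<and> z \<in> \<Omega>'")
      case True
      have "dist (\<phi> (G y)) (\<phi> (G z)) \<le> M * dist (G y) (G z)" by (rule lipschitz_onD[OF M]) auto
      also have "\<dots> \<le> M * (L * dist y z)"
        using lipschitz_on_nonneg[OF M] lipschitz_onD[OF G_lip, of y z] by (intro mult_left_mono) auto
      finally show ?thesis using True by (simp add: \<xi>_def dist_real_def)
    next
      case False
      then show ?thesis using far[of z y] far[of y z] by (auto simp: dist_commute abs_minus_commute)
    qed
    moreover have "0 \<le> M * L * dist y z" "0 \<le> B / \<epsilon> * dist y z" using nonneg B(1) \<epsilon>(1) by auto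
    ultimately show "dist (\<xi> y) (\<xi> z) \<le> (M * L + B / \<epsilon>) * dist y z"
      unfolding dist_real_def distrib_right by linarith
  qed (use nonneg B(1) \<epsilon>(1) in auto)
  moreover have "\<xi> (F x) = \<phi> x" if "x \<in> \<Omega>" for x using that by (simp add: \<xi>_def F_in GF)
  ultimately show ?thesis using that K \<xi>0 by blast
qed

text \<open>The Piola transform of a vector field commutes with the weak divergence.\<close>

lemma piola_forward:
  fixes h h0 :: "'n \<Rightarrow> real^'n \<Rightarrow> complex"
  assumes h: "\<And>q. integrable (lebesgue_on \<Omega>') (h q)" and s: "integrable (lebesgue_on \<Omega>') s"
    and h0: "\<And>j. h0 j \<in> borel_measurable (lebesgue_on \<Omega>)" and s0: "s0 \<in> borel_measurable (lebesgue_on \<Omega>)"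
    and rel: "AE x in lebesgue. x \<in> \<Omega> \<longrightarrow> dens x *\<^sub>R s (F x) = s0 x \<and>
       (\<forall>q. dens x *\<^sub>R h q (F x) = (\<Sum>j\<in>UNIV. complex_of_real (jacobian F (at x) $ q $ j) * h0 j x))"
    and eq: "\<And>\<phi>. \<phi> \<in> test_functions \<Omega>' \<Longrightarrow>
      (LINT y|lebesgue_on \<Omega>'. (\<Sum>q\<in>UNIV. h q y * complex_of_real (partial_deriv q \<phi> y)) + s y * complex_of_real (\<phi> y)) = 0"
    and \<phi>: "\<phi> \<in> test_functions \<Omega>"
  shows "(LINT x|lebesgue_on \<Omega>. (\<Sum>j\<in>UNIV. h0 j x * complex_of_real (partial_deriv j \<phi> x)) + s0 x * complex_of_real (\<phi> x)) = 0"
proof -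
  obtain M \<xi> K where \<xi>: "M-lipschitz_on UNIV \<xi>" "compact K" "K \<subseteq> \<Omega>'" "\<And>y. y \<notin> K \<Longrightarrow> \<xi> y = 0"
    "\<And>x. x \<in> \<Omega> \<Longrightarrow> \<xi> (F x) = \<phi> x"
    using test_pushforward[OF \<phi>] by metis
  note li = integrable_imp_locally_integrable[OF ran_lebesgue]
  \<comment> \<open>The equation on the image domain is tested with the Lipschitz function that
    corresponds to \<phi> under \<open>F\<close>.\<close>
  have "0 = (LINT y|lebesgue_on \<Omega>'. (\<Sum>q\<in>UNIV. h q y * complex_of_real (partial_deriv q \<xi> y)) + s y * complex_of_real (\<xi> y))"
    by (rule weak_divergence_lipschitz[OF open_ran li[OF h] li[OF s] eq \<xi>(1-4), symmetric])
  also have "\<dots> = (LINT x|lebesgue_on \<Omega>. (\<Sum>j\<in>UNIV. h0 j x * complex_of_real (partial_deriv j \<phi> x)) + s0 x * complex_of_real (\<phi> x))"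
  proof (rule change_of_variables_AE(2))
    have tm: "\<psi> \<in> borel_measurable (lebesgue_on \<Omega>)" if "\<psi> \<in> test_functions \<Omega>" for \<psi>
      using test_borel_measurable[OF that] by (intro measurable_restrict_space1 measurable_completion) simp
    have "\<phi> \<in> borel_measurable (lebesgue_on \<Omega>)" "partial_deriv j \<phi> \<in> borel_measurable (lebesgue_on \<Omega>)" for j
      by (rule tm[OF \<phi>], rule tm[OF partial_deriv_test_function[OF \<phi>]])
    then show "(\<lambda>x. (\<Sum>j\<in>UNIV. h0 j x * complex_of_real (partial_deriv j \<phi> x)) + s0 x * complex_of_real (\<phi> x)) \<in> borel_measurable (lebesgue_on \<Omega>)"
      using h0 s0 by measurable
    have "AE x in lebesgue. x \<in> \<Omega> \<longrightarrow> \<xi> differentiable (at (F x))"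
      by (rule AE_pullback) (use Rademacher[OF \<xi>(1)] in \<open>auto elim: eventually_mono\<close>)
    with rel Rademacher[OF F_lip]
    show "AE x in lebesgue. x \<in> \<Omega> \<longrightarrow> (\<Sum>j\<in>UNIV. h0 j x * complex_of_real (partial_deriv j \<phi> x)) + s0 x * complex_of_real (\<phi> x)
        = dens x *\<^sub>R ((\<Sum>q\<in>UNIV. h q (F x) * complex_of_real (partial_deriv q \<xi> (F x))) + s (F x) * complex_of_real (\<xi> (F x)))"
    proof eventually_elim
      case (elim x)
      show ?case
      proof
        assume x: "x \<in> \<Omega>"
        \<comment> \<open>Since \<phi> is \<xi> after \<open>F\<close> on \<Omega>, the chain rule
          expresses its gradient by the transposed Jacobian; summed against \<open>h0\<close>, this
          Jacobian is exactly the one in \<open>rel\<close>.\<close>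
        have pd: "partial_deriv j \<phi> x = (\<Sum>q\<in>UNIV. jacobian F (at x) $ q $ j * partial_deriv q \<xi> (F x))" for j
        proof -
          have "(F has_derivative frechet_derivative F (at x)) (at x)" "(\<xi> has_derivative frechet_derivative \<xi> (at (F x))) (at (F x))"
            using elim x by (auto simp: frechet_derivative_works)
          from has_derivative_compose[OF this]
          have "(\<phi> has_derivative (\<lambda>v. frechet_derivative \<xi> (at (F x)) (frechet_derivative F (at x) v))) (at x)"
            by (rule has_derivative_transform_within_open[OF _ open_dom x]) (simp add: \<xi>(5))
          from has_derivative_partial_deriv[OF this, of j] show ?thesis
            using elim x by (simp add: frechet_derivative_eq_sum_partial_deriv jacobian_column)
        qed
        have "(\<Sum>j\<in>UNIV. h0 j x * complex_of_real (partial_deriv j \<phi> x))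
           = (\<Sum>j\<in>UNIV. \<Sum>q\<in>UNIV. complex_of_real (jacobian F (at x) $ q $ j) * h0 j x * complex_of_real (partial_deriv q \<xi> (F x)))"
          unfolding pd by (simp add: sum_distrib_left mult_ac)
        also have "\<dots> = (\<Sum>q\<in>UNIV. (\<Sum>j\<in>UNIV. complex_of_real (jacobian F (at x) $ q $ j) * h0 j x) * complex_of_real (partial_deriv q \<xi> (F x)))"
          by (subst sum.swap) (simp add: sum_distrib_right)
        also have "\<dots> = (\<Sum>q\<in>UNIV. (dens x *\<^sub>R h q (F x)) * complex_of_real (partial_deriv q \<xi> (F x)))"
          using elim x by simp
        also have "\<dots> = dens x *\<^sub>R (\<Sum>q\<in>UNIV. h q (F x) * complex_of_real (partial_deriv q \<xi> (F x)))"
          by (simp add: scaleR_sum_right)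
        finally show "(\<Sum>j\<in>UNIV. h0 j x * complex_of_real (partial_deriv j \<phi> x)) + s0 x * complex_of_real (\<phi> x)
          = dens x *\<^sub>R ((\<Sum>q\<in>UNIV. h q (F x) * complex_of_real (partial_deriv q \<xi> (F x))) + s (F x) * complex_of_real (\<xi> (F x)))"
          using elim x \<xi>(5)[OF x] by (simp add: scaleR_add_right flip: mult_scaleR_left)
      qed
    qed
  qed
  finally show ?thesis by simp
qed

end

subsection \<open>Sobolev functions under composition\<close>

lemma square_integrable_add:
  assumes "square_integrable M f" "square_integrable M g"
  shows "square_integrable M (\<lambda>x. f x + g x)"
proof -
  have m: "f \<in> borel_measurable M" "g \<in> borel_measurable M" and i: "integrable M (\<lambda>x. (norm (f x))\<^sup>2)" "integrable M (\<lambda>x. (norm (g x))\<^sup>2)"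
    using assms by (auto simp: square_integrable_def)
  have "integrable M (\<lambda>x. 2 * (norm (f x))\<^sup>2 + 2 * (norm (g x))\<^sup>2)" using i by auto
  then have "integrable M (\<lambda>x. (norm (f x + g x))\<^sup>2)"
  proof (rule Bochner_Integration.integrable_bound)
    show "(\<lambda>x. (norm (f x + g x))\<^sup>2) \<in> borel_measurable M" using m by measurable
    have "(norm (f x + g x))\<^sup>2 \<le> 2 * (norm (f x))\<^sup>2 + 2 * (norm (g x))\<^sup>2" for x
    proof -
      have "(norm (f x + g x))\<^sup>2 \<le> (norm (f x) + norm (g x))\<^sup>2"
        by (intro power_mono norm_triangle_ineq) simp
      also have "\<dots> \<le> 2 * (norm (f x))\<^sup>2 + 2 * (norm (g x))\<^sup>2"
        using sum_squares_bound[of "norm (f x)" "norm (g x)"] by (simp add: power2_sum)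
      finally show ?thesis .
    qed
    then show "AE x in M. norm ((norm (f x + g x))\<^sup>2) \<le> norm (2 * (norm (f x))\<^sup>2 + 2 * (norm (g x))\<^sup>2)" by simp
  qed
  then show ?thesis using m by (simp add: square_integrable_def)
qed

lemma square_integrable_zero: "square_integrable M (\<lambda>x. 0)"
  by (simp add: square_integrable_def)

lemma square_integrable_sum:
  "(\<And>i. i \<in> I \<Longrightarrow> square_integrable M (f i)) \<Longrightarrow> square_integrable M (\<lambda>x. \<Sum>i\<in>I. f i x)"
  by (induction I rule: infinite_finite_induct) (auto intro: square_integrable_add square_integrable_zero)

lemma square_integrable_mult_bounded:
  fixes f :: "'a \<Rightarrow> complex" and w :: "'a \<Rightarrow> complex"
  assumes f: "square_integrable M f" and w: "w \<in> borel_measurable M" "AE x in M. cmod (w x) \<le> B"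
  shows "square_integrable M (\<lambda>x. w x * f x)"
proof -
  have m: "f \<in> borel_measurable M" and i: "integrable M (\<lambda>x. (norm (f x))\<^sup>2)" using f by (auto simp: square_integrable_def)
  have "integrable M (\<lambda>x. (norm (w x * f x))\<^sup>2)"
  proof (rule Bochner_Integration.integrable_bound)
    show "integrable M (\<lambda>x. B\<^sup>2 * (norm (f x))\<^sup>2)" using i by simp
    show "(\<lambda>x. (norm (w x * f x))\<^sup>2) \<in> borel_measurable M" using m w(1) by measurable
    show "AE x in M. norm ((norm (w x * f x))\<^sup>2) \<le> norm (B\<^sup>2 * (norm (f x))\<^sup>2)"
      using w(2) by eventually_elim (auto simp: norm_mult power_mult_distrib intro!: mult_right_mono power_mono)
  qed
  then show ?thesis using m w(1) by (simp add: square_integrable_def)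
qed

lemma square_integrable_imp_integrable:
  fixes f :: "'a \<Rightarrow> 'b::euclidean_space"
  assumes "finite_measure M" and f: "square_integrable M f"
  shows "integrable M f"
proof (rule Bochner_Integration.integrable_bound)
  interpret finite_measure M by fact
  show "integrable M (\<lambda>x. 1 + (norm (f x))\<^sup>2)" using f by (auto simp: square_integrable_def)
  show "f \<in> borel_measurable M" using f by (simp add: square_integrable_def)
  have "norm (f x) \<le> 1 + (norm (f x))\<^sup>2" for x
    using sum_squares_bound[of 1 "norm (f x)"] norm_ge_zero[of "f x"] unfolding power_one by linarith
  then show "AE x in M. norm (f x) \<le> norm (1 + (norm (f x))\<^sup>2)" by simp
qed

lemma square_integrable_cong_AE:
  fixes f g :: "'a::euclidean_space \<Rightarrow> 'b::euclidean_space"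
  assumes S: "S \<in> sets lebesgue" and fg: "AE x in lebesgue. x \<in> S \<longrightarrow> f x = g x" and f: "square_integrable (lebesgue_on S) f"
  shows "square_integrable (lebesgue_on S) g"
proof -
  have "AE x in lebesgue. x \<in> S \<longrightarrow> (norm (f x))\<^sup>2 = (norm (g x))\<^sup>2" using fg by eventually_elim auto
  then have "integrable (lebesgue_on S) (\<lambda>x. (norm (f x))\<^sup>2) \<longleftrightarrow> integrable (lebesgue_on S) (\<lambda>x. (norm (g x))\<^sup>2)"
    by (rule lebesgue_on_cong_AE(1)[OF S])
  then show ?thesis using f lebesgue_on_measurable_AE[OF S _ fg] by (auto simp: square_integrable_def)
qed

text \<open>The equality holds everywhere: both functions have the same weak derivatives, so
  \<open>SOME\<close> picks the same representative.\<close>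

lemma weak_partial_cong_AE:
  assumes "open \<Omega>" "AE x in lebesgue. x \<in> \<Omega> \<longrightarrow> f x = f' x"
  shows "weak_partial \<Omega> j f = weak_partial \<Omega> j f'"
  unfolding weak_partial_def using has_weak_partial_cong_AE[OF assms, of _ _ j] by (auto intro!: arg_cong[where f=Eps])

lemma weak_grad_cong_AE:
  assumes "open \<Omega>" "AE x in lebesgue. x \<in> \<Omega> \<longrightarrow> u x = v x"
  shows "weak_grad \<Omega> u = weak_grad \<Omega> v"
proof -
  have "weak_partial \<Omega> l (\<lambda>y. u y $ k) = weak_partial \<Omega> l (\<lambda>y. v y $ k)" for k l
    by (rule weak_partial_cong_AE[OF assms(1)]) (use assms(2) in \<open>auto elim: eventually_mono\<close>)
  then show ?thesis by (simp add: weak_grad_def fun_eq_iff)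
qed

lemma H1_cong_AE:
  assumes op: "open \<Omega>" and uv: "AE x in lebesgue. x \<in> \<Omega> \<longrightarrow> u x = v x"
  shows "u \<in> H1 \<Omega> \<longleftrightarrow> v \<in> H1 \<Omega>"
proof -
  have vu: "AE x in lebesgue. x \<in> \<Omega> \<longrightarrow> v x = u x" using uv by eventually_elim auto
  have m: "\<Omega> \<in> sets lebesgue" using op by simp
  have "has_weak_partial \<Omega> l (\<lambda>y. u y $ k) g \<longleftrightarrow> has_weak_partial \<Omega> l (\<lambda>y. v y $ k) g" for k l g
    by (rule has_weak_partial_cong_AE[OF op]) (use uv in \<open>auto elim: eventually_mono\<close>)
  then show ?thesis
    unfolding H1_def using square_integrable_cong_AE[OF m uv] square_integrable_cong_AE[OF m vu] by auto
qed

lemma H1_norm_cong_AE: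
  assumes op: "open \<Omega>" and uv: "AE x in lebesgue. x \<in> \<Omega> \<longrightarrow> u x = v x"
  shows "H1_norm \<Omega> u = H1_norm \<Omega> v"
proof -
  have "(LINT x|lebesgue_on \<Omega>. (norm (u x))\<^sup>2) = (LINT x|lebesgue_on \<Omega>. (norm (v x))\<^sup>2)"
    by (rule lebesgue_on_cong_AE(2)) (use op uv in \<open>auto elim: eventually_mono\<close>)
  then show ?thesis by (simp add: H1_norm_def weak_grad_cong_AE[OF assms])
qed

lemma H1_has_weak_partial:
  "u \<in> H1 \<Omega> \<Longrightarrow> has_weak_partial \<Omega> l (\<lambda>y. u y $ k) (\<lambda>x. weak_grad \<Omega> u x $ k $ l)"
  unfolding weak_grad_def H1_def by (auto intro: weak_partial_works)

text \<open>The representative picked by \<open>SOME\<close> need not be the square integrable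
  witness in \<open>H1\<close>, but weak derivatives agree almost everywhere.\<close>

lemma H1_weak_grad_square_integrable:
  assumes op: "open \<Omega>" and u: "u \<in> H1 \<Omega>"
  shows "square_integrable (lebesgue_on \<Omega>) (\<lambda>x. weak_grad \<Omega> u x $ k $ l)"
proof -
  obtain g where g: "has_weak_partial \<Omega> l (\<lambda>y. u y $ k) g" "square_integrable (lebesgue_on \<Omega>) g"
    using u by (auto simp: H1_def)
  show ?thesis
    by (rule square_integrable_cong_AE[OF _ has_weak_partial_unique[OF op g(1) H1_has_weak_partial[OF u]] g(2)]) (use op in simp)
qed

lemma square_integrable_component:
  fixes u :: "'a \<Rightarrow> complex^'n::finite"
  assumes "square_integrable M u" shows "square_integrable M (\<lambda>x. u x $ k)"
proof -
  have m: "(\<lambda>x. u x $ k) \<in> borel_measurable M"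
    using assms by (intro measurable_compose[OF _ borel_measurable_continuous_onI[of "\<lambda>v. v $ k"]] continuous_intros)
      (simp add: square_integrable_def)
  moreover have "integrable M (\<lambda>x. (norm (u x $ k))\<^sup>2)"
  proof (rule Bochner_Integration.integrable_bound)
    show "integrable M (\<lambda>x. (norm (u x))\<^sup>2)" using assms by (simp add: square_integrable_def)
    show "AE x in M. norm ((norm (u x $ k))\<^sup>2) \<le> norm ((norm (u x))\<^sup>2)"
      by (auto intro!: power_mono Finite_Cartesian_Product.norm_nth_le)
  qed (use m in measurable)
  ultimately show ?thesis by (simp add: square_integrable_def)
qed

lemma norm_matrix_power2:
  fixes A :: "complex^'n::finite^'m::finite"
  shows "(norm A)\<^sup>2 = (\<Sum>i\<in>UNIV. \<Sum>j\<in>UNIV. (cmod (A $ i $ j))\<^sup>2)"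
  by (simp add: norm_vec_def L2_set_def sum_nonneg)

text \<open>A crude count: each entry is at most \<open>CARD('n) * L * norm B\<close>, and there are
  \<open>CARD('n) ^ 2\<close> entries.\<close>

lemma norm_mult_matrix_bound:
  fixes B :: "complex^'n::finite^'n" and M :: "real^'n^'n"
  assumes "\<And>i j. \<bar>M $ i $ j\<bar> \<le> L"
  shows "(norm (\<chi> k l. \<Sum>p\<in>UNIV. B $ k $ p * complex_of_real (M $ p $ l)))\<^sup>2 \<le> (real CARD('n) ^ 2 * L)\<^sup>2 * (norm B)\<^sup>2"
proof -
  have "cmod (\<Sum>p\<in>UNIV. B $ k $ p * complex_of_real (M $ p $ l)) \<le> real CARD('n) * L * norm B" for k l
  proof -
    have "cmod (\<Sum>p\<in>UNIV. B $ k $ p * complex_of_real (M $ p $ l)) \<le> (\<Sum>p\<in>(UNIV::'n set). norm B * L)"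
    proof (intro order_trans[OF norm_sum] sum_mono)
      fix p
      have "cmod (B $ k $ p) \<le> norm B"
        by (rule order_trans[OF Finite_Cartesian_Product.norm_nth_le Finite_Cartesian_Product.norm_nth_le])
      then show "cmod (B $ k $ p * complex_of_real (M $ p $ l)) \<le> norm B * L"
        using assms[of p l] by (simp add: norm_mult mult_mono)
    qed
    then show ?thesis by (simp add: mult_ac)
  qed
  then have "(norm (\<chi> k l. \<Sum>p\<in>UNIV. B $ k $ p * complex_of_real (M $ p $ l)))\<^sup>2
     \<le> (\<Sum>k\<in>(UNIV::'n set). \<Sum>l\<in>(UNIV::'n set). (real CARD('n) * L * norm B)\<^sup>2)"
    unfolding norm_matrix_power2 by (intro sum_mono power_mono) auto
  also have "\<dots> = (real CARD('n) ^ 2 * L)\<^sup>2 * (norm B)\<^sup>2"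
    by (simp add: power_mult_distrib power2_eq_square mult_ac)
  finally show ?thesis .
qed

text \<open>The algebra behind the transformation rule for the elasticity tensor: one factor of the Jacobian is absorbed by the
  gradient of \<open>u\<close>, the other one by the test function.\<close>

lemma push_tensor_contract:
  fixes c :: "'n::finite \<Rightarrow> 'n \<Rightarrow> 'n \<Rightarrow> real" and M :: "real^'n^'n" and b :: "'n \<Rightarrow> 'n \<Rightarrow> complex"
  shows "(\<Sum>k\<in>UNIV. \<Sum>p\<in>UNIV. complex_of_real (\<Sum>l\<in>UNIV. \<Sum>j\<in>UNIV. c j k l * M$p$l * M$q$j) * b k p)
    = (\<Sum>j\<in>UNIV. complex_of_real (M$q$j) * (\<Sum>k\<in>UNIV. \<Sum>l\<in>UNIV. complex_of_real (c j k l) * (\<Sum>p\<in>UNIV. b k p * complex_of_real (M$p$l))))"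
proof -
  have "(\<Sum>j\<in>UNIV. complex_of_real (M$q$j) * (\<Sum>k\<in>UNIV. \<Sum>l\<in>UNIV. complex_of_real (c j k l) * (\<Sum>p\<in>UNIV. b k p * complex_of_real (M$p$l))))
    = (\<Sum>j\<in>UNIV. \<Sum>k\<in>UNIV. \<Sum>l\<in>UNIV. \<Sum>p\<in>UNIV. complex_of_real (c j k l * M$p$l * M$q$j) * b k p)"
    by (simp add: sum_distrib_left mult_ac)
  also have "\<dots> = (\<Sum>k\<in>UNIV. \<Sum>j\<in>UNIV. \<Sum>l\<in>UNIV. \<Sum>p\<in>UNIV. complex_of_real (c j k l * M$p$l * M$q$j) * b k p)"
    by (rule sum.swap)
  also have "\<dots> = (\<Sum>k\<in>UNIV. \<Sum>p\<in>UNIV. \<Sum>l\<in>UNIV. \<Sum>j\<in>UNIV. complex_of_real (c j k l * M$p$l * M$q$j) * b k p)"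
  proof (rule sum.cong[OF refl])
    fix k
    have "(\<Sum>j\<in>UNIV. \<Sum>l\<in>UNIV. \<Sum>p\<in>UNIV. complex_of_real (c j k l * M$p$l * M$q$j) * b k p)
        = (\<Sum>l\<in>UNIV. \<Sum>j\<in>UNIV. \<Sum>p\<in>UNIV. complex_of_real (c j k l * M$p$l * M$q$j) * b k p)" by (rule sum.swap)
    also have "\<dots> = (\<Sum>l\<in>UNIV. \<Sum>p\<in>UNIV. \<Sum>j\<in>UNIV. complex_of_real (c j k l * M$p$l * M$q$j) * b k p)"
      by (rule sum.cong[OF refl], rule sum.swap)
    also have "\<dots> = (\<Sum>p\<in>UNIV. \<Sum>l\<in>UNIV. \<Sum>j\<in>UNIV. complex_of_real (c j k l * M$p$l * M$q$j) * b k p)"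
      by (rule sum.swap)
    finally show "(\<Sum>j\<in>UNIV. \<Sum>l\<in>UNIV. \<Sum>p\<in>UNIV. complex_of_real (c j k l * M$p$l * M$q$j) * b k p)
        = (\<Sum>p\<in>UNIV. \<Sum>l\<in>UNIV. \<Sum>j\<in>UNIV. complex_of_real (c j k l * M$p$l * M$q$j) * b k p)" .
  qed
  also have "\<dots> = (\<Sum>k\<in>UNIV. \<Sum>p\<in>UNIV. complex_of_real (\<Sum>l\<in>UNIV. \<Sum>j\<in>UNIV. c j k l * M$p$l * M$q$j) * b k p)"
    by (simp only: of_real_sum sum_distrib_right)
  finally show ?thesis by (rule sym)
qed

context bilipschitz_pair
begin

lemma H1_compose:
  assumes u: "u \<in> H1 \<Omega>'" shows "(\<lambda>x. u (F x)) \<in> H1 \<Omega>"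
proof -
  have su: "square_integrable (lebesgue_on \<Omega>') u" using u by (simp add: H1_def)
  have sq: "square_integrable (lebesgue_on \<Omega>) (\<lambda>x. v (F x))" if "square_integrable (lebesgue_on \<Omega>') v"
    for v :: "real^'n \<Rightarrow> 'b::euclidean_space"
    using that compose_F_measurable[of v] compose_integrable[of "\<lambda>y. (norm (v y))\<^sup>2"] by (simp add: square_integrable_def)
  have "\<exists>g. has_weak_partial \<Omega> l (\<lambda>x. u (F x) $ k) g \<and> square_integrable (lebesgue_on \<Omega>) g" for k l
  proof -
    let ?g = "\<lambda>x. \<Sum>p\<in>UNIV. weak_grad \<Omega>' u (F x) $ k $ p * complex_of_real (jacobian F (at x) $ p $ l)"
    have "has_weak_partial \<Omega> l (\<lambda>x. u (F x) $ k) ?g"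
      by (rule weak_partial_chain[OF H1_has_weak_partial[OF u]])
    moreover have "square_integrable (lebesgue_on \<Omega>) (\<lambda>x. weak_grad \<Omega>' u (F x) $ k $ p * complex_of_real (jacobian F (at x) $ p $ l))" for p
    proof -
      have "AE x in lebesgue. cmod (complex_of_real (jacobian F (at x) $ p $ l)) \<le> L"
        using Rademacher[OF F_lip] by eventually_elim (simp add: lipschitz_jacobian_bound[OF F_lip])
      then have b: "AE x in lebesgue_on \<Omega>. cmod (complex_of_real (jacobian F (at x) $ p $ l)) \<le> L"
        unfolding AE_on_dom by eventually_elim simp
      have "(\<lambda>x. complex_of_real (jacobian F (at x) $ p $ l)) \<in> borel_measurable (lebesgue_on \<Omega>)"
        using measurable_restrict_space1[OF lipschitz_jacobian_measurable[OF F_lip]] by measurable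
      from square_integrable_mult_bounded[OF sq[OF H1_weak_grad_square_integrable[OF open_ran u]] this b]
      show ?thesis by (simp add: mult.commute)
    qed
    then have "square_integrable (lebesgue_on \<Omega>) ?g" by (rule square_integrable_sum)
    ultimately show ?thesis by blast
  qed
  then show ?thesis using sq[OF su] by (simp add: H1_def)
qed

lemma weak_grad_compose:
  assumes u: "u \<in> H1 \<Omega>'"
  shows "AE x in lebesgue. x \<in> \<Omega> \<longrightarrow> weak_grad \<Omega> (\<lambda>x. u (F x)) x
     = (\<chi> k l. \<Sum>p\<in>UNIV. weak_grad \<Omega>' u (F x) $ k $ p * complex_of_real (jacobian F (at x) $ p $ l))"
proof -
  have "AE x in lebesgue. x \<in> \<Omega> \<longrightarrow> weak_grad \<Omega> (\<lambda>x. u (F x)) x $ k $ l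
     = (\<Sum>p\<in>UNIV. weak_grad \<Omega>' u (F x) $ k $ p * complex_of_real (jacobian F (at x) $ p $ l))" for k l
    by (rule has_weak_partial_unique[OF open_dom H1_has_weak_partial[OF H1_compose[OF u]] weak_partial_chain[OF H1_has_weak_partial[OF u]]])
  then have "AE x in lebesgue. \<forall>k\<in>UNIV. \<forall>l\<in>UNIV. x \<in> \<Omega> \<longrightarrow> weak_grad \<Omega> (\<lambda>x. u (F x)) x $ k $ l
     = (\<Sum>p\<in>UNIV. weak_grad \<Omega>' u (F x) $ k $ p * complex_of_real (jacobian F (at x) $ p $ l))"
    by (intro AE_finite_allI) auto
  then show ?thesis by eventually_elim (simp add: vec_eq_iff)
qed

lemma compose_integral_bound:
  obtains C where "0 \<le> C" "\<And>v :: real^'n \<Rightarrow> real. integrable (lebesgue_on \<Omega>') v \<Longrightarrow> (\<And>y. 0 \<le> v y) \<Longrightarrow>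
     (LINT x|lebesgue_on \<Omega>. v (F x)) \<le> C * (LINT y|lebesgue_on \<Omega>'. v y)"
proof -
  obtain C where C: "0 \<le> C" "\<And>v :: real^'n \<Rightarrow> ennreal. v \<in> borel_measurable (lebesgue_on \<Omega>') \<Longrightarrow>
     (\<integral>\<^sup>+x. v (F x) \<partial>lebesgue_on \<Omega>) \<le> ennreal C * (\<integral>\<^sup>+y. v y \<partial>lebesgue_on \<Omega>')"
    using compose_nn_bound by blast
  have "(LINT x|lebesgue_on \<Omega>. v (F x)) \<le> C * (LINT y|lebesgue_on \<Omega>'. v y)"
    if v: "integrable (lebesgue_on \<Omega>') v" "\<And>y. 0 \<le> v y" for v :: "real^'n \<Rightarrow> real"
  proof -
    have "ennreal (LINT x|lebesgue_on \<Omega>. v (F x)) = (\<integral>\<^sup>+x. ennreal (v (F x)) \<partial>lebesgue_on \<Omega>)"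
      by (rule nn_integral_eq_integral[symmetric]) (use compose_integrable[OF v(1)] v(2) in auto)
    also have "\<dots> \<le> ennreal C * (\<integral>\<^sup>+y. ennreal (v y) \<partial>lebesgue_on \<Omega>')"
      by (rule C(2)) (use borel_measurable_integrable[OF v(1)] in measurable)
    also have "(\<integral>\<^sup>+y. ennreal (v y) \<partial>lebesgue_on \<Omega>') = ennreal (LINT y|lebesgue_on \<Omega>'. v y)"
      by (rule nn_integral_eq_integral) (use v in auto)
    also have "ennreal C * \<dots> = ennreal (C * (LINT y|lebesgue_on \<Omega>'. v y))"
      using C(1) v(2) by (intro ennreal_mult[symmetric] Bochner_Integration.integral_nonneg) auto
    finally show ?thesis
      using C(1) v(2) by (subst (asm) ennreal_le_iff) (auto intro!: mult_nonneg_nonneg Bochner_Integration.integral_nonneg)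
  qed
  then show ?thesis using that C(1) by blast
qed

text \<open>Continuity of composition in \<open>H1\<close>. It carries the approximating sequences
  of traces and the a priori bound of the Neumann problem from one domain to the other.\<close>

lemma H1_norm_compose:
  obtains K where "0 \<le> K" "\<And>u. u \<in> H1 \<Omega>' \<Longrightarrow> H1_norm \<Omega> (\<lambda>x. u (F x)) \<le> K * H1_norm \<Omega>' u"
proof -
  obtain C where C: "0 \<le> C" "\<And>v :: real^'n \<Rightarrow> real. integrable (lebesgue_on \<Omega>') v \<Longrightarrow> (\<And>y. 0 \<le> v y) \<Longrightarrow>
     (LINT x|lebesgue_on \<Omega>. v (F x)) \<le> C * (LINT y|lebesgue_on \<Omega>'. v y)"
    using compose_integral_bound by blast
  define c where "c = (real CARD('n) ^ 2 * L)\<^sup>2"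
  have c0: "0 \<le> c" by (simp add: c_def)
  have "H1_norm \<Omega> (\<lambda>x. u (F x)) \<le> sqrt (C * (1 + c)) * H1_norm \<Omega>' u" if u: "u \<in> H1 \<Omega>'" for u
  proof -
    have i1: "integrable (lebesgue_on \<Omega>') (\<lambda>y. (norm (u y))\<^sup>2)" using u by (simp add: H1_def square_integrable_def)
    have i2: "integrable (lebesgue_on \<Omega>') (\<lambda>y. (norm (weak_grad \<Omega>' u y))\<^sup>2)"
      unfolding norm_matrix_power2
      using H1_weak_grad_square_integrable[OF open_ran u] by (auto simp: square_integrable_def)
    have i3: "integrable (lebesgue_on \<Omega>) (\<lambda>x. (norm (weak_grad \<Omega> (\<lambda>x. u (F x)) x))\<^sup>2)"
      unfolding norm_matrix_power2
      using H1_weak_grad_square_integrable[OF open_dom H1_compose[OF u]] by (auto simp: square_integrable_def)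
    let ?a = "LINT y|lebesgue_on \<Omega>'. (norm (u y))\<^sup>2" and ?b = "LINT y|lebesgue_on \<Omega>'. (norm (weak_grad \<Omega>' u y))\<^sup>2"
    have ab: "0 \<le> ?a" "0 \<le> ?b" by (auto intro: Bochner_Integration.integral_nonneg)
    have "(LINT x|lebesgue_on \<Omega>. (norm (u (F x)))\<^sup>2) \<le> C * ?a" by (rule C(2)[OF i1]) simp
    moreover have "(LINT x|lebesgue_on \<Omega>. (norm (weak_grad \<Omega> (\<lambda>x. u (F x)) x))\<^sup>2) \<le> C * (c * ?b)"
    proof -
      have "(LINT x|lebesgue_on \<Omega>. (norm (weak_grad \<Omega> (\<lambda>x. u (F x)) x))\<^sup>2) \<le> (LINT x|lebesgue_on \<Omega>. c * (norm (weak_grad \<Omega>' u (F x)))\<^sup>2)"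
      proof (rule integral_mono_AE[OF i3])
        show "integrable (lebesgue_on \<Omega>) (\<lambda>x. c * (norm (weak_grad \<Omega>' u (F x)))\<^sup>2)"
          using compose_integrable[OF i2] by simp
        show "AE x in lebesgue_on \<Omega>. (norm (weak_grad \<Omega> (\<lambda>x. u (F x)) x))\<^sup>2 \<le> c * (norm (weak_grad \<Omega>' u (F x)))\<^sup>2"
          unfolding AE_on_dom using weak_grad_compose[OF u] Rademacher[OF F_lip]
        proof eventually_elim
          case (elim x)
          show ?case
            using elim(1) norm_mult_matrix_bound[OF lipschitz_jacobian_bound[OF F_lip elim(2)], of "weak_grad \<Omega>' u (F x)"]
            by (simp add: c_def)
        qed
      qed
      also have "\<dots> \<le> C * (LINT y|lebesgue_on \<Omega>'. c * (norm (weak_grad \<Omega>' u y))\<^sup>2)"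
        by (rule C(2)) (use i2 c0 in auto)
      finally show ?thesis by simp
    qed
    ultimately have "(LINT x|lebesgue_on \<Omega>. (norm (u (F x)))\<^sup>2) + (LINT x|lebesgue_on \<Omega>. (norm (weak_grad \<Omega> (\<lambda>x. u (F x)) x))\<^sup>2)
        \<le> C * ?a + C * (c * ?b)" by linarith
    also have "\<dots> \<le> (C * (1 + c)) * (?a + ?b)"
      using mult_nonneg_nonneg[OF C(1) mult_nonneg_nonneg[OF c0 ab(1)]] mult_nonneg_nonneg[OF C(1) ab(2)]
      by (simp add: algebra_simps)
    finally show ?thesis unfolding H1_norm_def real_sqrt_mult[symmetric] by (rule real_sqrt_le_mono)
  qed
  moreover have "0 \<le> sqrt (C * (1 + c))" using C(1) c0 by simp
  ultimately show ?thesis using that by blast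
qed

text \<open>Combines \<open>piola_forward\<close> for the pair and for its swap. The relation
  between the fields inverts itself: multiplied by the inverse Jacobian, which is the Jacobian of
  \<open>G\<close> at \<open>F x\<close>, it becomes the same relation with the roles exchanged,
  because the two densities multiply to 1.\<close>

lemma piola_iff:
  fixes h h0 :: "'n \<Rightarrow> real^'n \<Rightarrow> complex"
  assumes h: "\<And>q. integrable (lebesgue_on \<Omega>') (h q)" and s: "integrable (lebesgue_on \<Omega>') s"
    and h0: "\<And>j. integrable (lebesgue_on \<Omega>) (h0 j)" and s0: "integrable (lebesgue_on \<Omega>) s0"
    and rel: "AE x in lebesgue. x \<in> \<Omega> \<longrightarrow> dens x *\<^sub>R s (F x) = s0 x \<and>
       (\<forall>q. dens x *\<^sub>R h q (F x) = (\<Sum>j\<in>UNIV. complex_of_real (jacobian F (at x) $ q $ j) * h0 j x))"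
  shows "(\<forall>\<phi>\<in>test_functions \<Omega>.
      (LINT x|lebesgue_on \<Omega>. (\<Sum>j\<in>UNIV. h0 j x * complex_of_real (partial_deriv j \<phi> x)) + s0 x * complex_of_real (\<phi> x)) = 0) \<longleftrightarrow>
    (\<forall>\<phi>\<in>test_functions \<Omega>'.
      (LINT y|lebesgue_on \<Omega>'. (\<Sum>q\<in>UNIV. h q y * complex_of_real (partial_deriv q \<phi> y)) + s y * complex_of_real (\<phi> y)) = 0)"
proof -
  let ?d = "bilipschitz_pair.dens G"
  have "AE x in lebesgue. x \<in> \<Omega> \<longrightarrow> ?d (F x) *\<^sub>R s0 x = s (F x) \<and>
       (\<forall>j. ?d (F x) *\<^sub>R h0 j x = (\<Sum>q\<in>UNIV. complex_of_real (jacobian G (at (F x)) $ j $ q) * h q (F x)))"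
    using rel jacobian_chain
  proof eventually_elim
    case (elim x)
    show ?case
    proof
      assume x: "x \<in> \<Omega>"
      let ?A = "jacobian G (at (F x))" and ?M = "jacobian F (at x)"
      have AM: "?A ** ?M = mat 1" using elim x by blast
      then have "det ?A * det ?M = 1" by (metis det_I det_mul)
      then have dd: "?d (F x) * dens x = 1"
        by (simp add: bilipschitz_pair.dens_def[OF swap] dens_def flip: abs_mult)
      have "?d (F x) *\<^sub>R s0 x = (?d (F x) * dens x) *\<^sub>R s (F x)" using elim x by (simp flip: scaleR_scaleR)
      then have 1: "?d (F x) *\<^sub>R s0 x = s (F x)" using dd by simp
      have 2: "?d (F x) *\<^sub>R h0 j x = (\<Sum>q\<in>UNIV. complex_of_real (?A $ j $ q) * h q (F x))" for j
      proof -
        have "(\<Sum>q\<in>UNIV. complex_of_real (?A $ j $ q) * (dens x *\<^sub>R h q (F x)))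
            = (\<Sum>q\<in>UNIV. \<Sum>i\<in>UNIV. complex_of_real (?A $ j $ q * ?M $ q $ i) * h0 i x)"
          using elim x by (simp add: sum_distrib_left mult.assoc)
        also have "\<dots> = (\<Sum>i\<in>UNIV. complex_of_real ((?A ** ?M) $ j $ i) * h0 i x)"
          by (subst sum.swap) (simp add: matrix_matrix_mult_def sum_distrib_right)
        also have "\<dots> = h0 j x"
          by (simp add: AM mat_def if_distrib[of complex_of_real] if_distrib[of "\<lambda>c. c * _"] cong: if_cong)
        finally have "h0 j x = dens x *\<^sub>R (\<Sum>q\<in>UNIV. complex_of_real (?A $ j $ q) * h q (F x))"
          by (simp add: scaleR_sum_right)
        then have "?d (F x) *\<^sub>R h0 j x = (?d (F x) * dens x) *\<^sub>R (\<Sum>q\<in>UNIV. complex_of_real (?A $ j $ q) * h q (F x))"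
          by (simp only: scaleR_scaleR)
        then show ?thesis using dd by simp
      qed
      from 1 2 show "?d (F x) *\<^sub>R s0 x = s (F x) \<and> (\<forall>j. ?d (F x) *\<^sub>R h0 j x = (\<Sum>q\<in>UNIV. complex_of_real (?A $ j $ q) * h q (F x)))"
        by blast
    qed
  qed
  from bilipschitz_pair.AE_pullback[OF swap this]
  have rel': "AE y in lebesgue. y \<in> \<Omega>' \<longrightarrow> ?d y *\<^sub>R s0 (G y) = s y \<and>
       (\<forall>j. ?d y *\<^sub>R h0 j (G y) = (\<Sum>q\<in>UNIV. complex_of_real (jacobian G (at y) $ j $ q) * h q y))"
    by eventually_elim (auto simp: FG)
  show ?thesis
  proof (intro iffI ballI)
    fix \<phi> assume a: "\<forall>\<phi>\<in>test_functions \<Omega>.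
      (LINT x|lebesgue_on \<Omega>. (\<Sum>j\<in>UNIV. h0 j x * complex_of_real (partial_deriv j \<phi> x)) + s0 x * complex_of_real (\<phi> x)) = 0"
      and \<phi>: "\<phi> \<in> test_functions \<Omega>'"
    show "(LINT y|lebesgue_on \<Omega>'. (\<Sum>q\<in>UNIV. h q y * complex_of_real (partial_deriv q \<phi> y)) + s y * complex_of_real (\<phi> y)) = 0"
      by (rule bilipschitz_pair.piola_forward[OF swap h0 s0 borel_measurable_integrable[OF h] borel_measurable_integrable[OF s] rel' _ \<phi>])
        (use a in blast)
  next
    fix \<phi> assume a: "\<forall>\<phi>\<in>test_functions \<Omega>'.
      (LINT y|lebesgue_on \<Omega>'. (\<Sum>q\<in>UNIV. h q y * complex_of_real (partial_deriv q \<phi> y)) + s y * complex_of_real (\<phi> y)) = 0"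
      and \<phi>: "\<phi> \<in> test_functions \<Omega>"
    show "(LINT x|lebesgue_on \<Omega>. (\<Sum>j\<in>UNIV. h0 j x * complex_of_real (partial_deriv j \<phi> x)) + s0 x * complex_of_real (\<phi> x)) = 0"
      by (rule piola_forward[OF h s borel_measurable_integrable[OF h0] borel_measurable_integrable[OF s0] rel _ \<phi>])
        (use a in blast)
  qed
qed

end

subsection \<open>The elastic equation and the Neumann problem\<close>

text \<open>The minus sign brings the elastic equation into the shape of the Piola lemmas: flux
  against the gradient of the test function plus source against the test function.\<close>

definition flux :: "(real^'n::finite) set \<Rightarrow> 'n tensor_field \<Rightarrow> (real^'n \<Rightarrow> complex^'n) \<Rightarrow> 'n \<Rightarrow> 'n \<Rightarrow> real^'n \<Rightarrow> complex" where
  "flux \<Omega> C u i j x = - (\<Sum>k\<in>UNIV. \<Sum>l\<in>UNIV. complex_of_real (C x i j k l) * weak_grad \<Omega> u x $ k $ l)"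

lemma integrable_times_test:
  assumes f: "integrable (lebesgue_on \<Omega>) f" and \<phi>: "\<phi> \<in> test_functions \<Omega>"
  shows "integrable (lebesgue_on \<Omega>) (\<lambda>x. f x * complex_of_real (\<phi> x))"
proof -
  obtain B where B: "\<And>x. \<bar>\<phi> x\<bar> \<le> B" using test_bounded[OF \<phi>] by blast
  have m: "\<phi> \<in> borel_measurable (lebesgue_on \<Omega>)"
    using test_borel_measurable[OF \<phi>] by (intro measurable_restrict_space1 measurable_completion) simp
  show ?thesis
    using integrable_scaleR_bounded[OF f m AE_I2[OF B]] by (simp add: scaleR_conv_of_real mult.commute)
qed

text \<open>Integrability of both fields allows the two integrals in \<open>elastic_eq\<close> to be
  merged into the single one on which the Piola lemmas operate.\<close>

lemma elastic_eq_iff_flux: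
  assumes h: "\<And>i j. integrable (lebesgue_on \<Omega>) (flux \<Omega> C u i j)"
    and s: "\<And>i. integrable (lebesgue_on \<Omega>) (\<lambda>x. (complex_of_real \<omega>)\<^sup>2 * (\<rho> x * u x $ i))"
  shows "elastic_eq \<omega> \<Omega> C \<rho> u \<longleftrightarrow> (\<forall>i. \<forall>\<phi>\<in>test_functions \<Omega>.
     (LINT x|lebesgue_on \<Omega>. (\<Sum>j\<in>UNIV. flux \<Omega> C u i j x * complex_of_real (partial_deriv j \<phi> x))
        + (complex_of_real \<omega>)\<^sup>2 * (\<rho> x * u x $ i) * complex_of_real (\<phi> x)) = 0)"
proof -
  have "(LINT x|lebesgue_on \<Omega>. (\<Sum>j\<in>UNIV. flux \<Omega> C u i j x * complex_of_real (partial_deriv j \<phi> x))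
        + (complex_of_real \<omega>)\<^sup>2 * (\<rho> x * u x $ i) * complex_of_real (\<phi> x))
     = - (LINT x|lebesgue_on \<Omega>. (\<Sum>j\<in>UNIV. \<Sum>k\<in>UNIV. \<Sum>l\<in>UNIV.
          complex_of_real (C x i j k l) * weak_grad \<Omega> u x $ k $ l * complex_of_real (partial_deriv j \<phi> x)))
     + (complex_of_real \<omega>)\<^sup>2 * (LINT x|lebesgue_on \<Omega>. \<rho> x * u x $ i * complex_of_real (\<phi> x))"
    if \<phi>: "\<phi> \<in> test_functions \<Omega>" for i \<phi>
  proof -
    have i1: "integrable (lebesgue_on \<Omega>) (\<lambda>x. \<Sum>j\<in>UNIV. flux \<Omega> C u i j x * complex_of_real (partial_deriv j \<phi> x))"
      using integrable_times_test[OF h partial_deriv_test_function[OF \<phi>]] by (intro Bochner_Integration.integrable_sum) auto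
    have i2: "integrable (lebesgue_on \<Omega>) (\<lambda>x. (complex_of_real \<omega>)\<^sup>2 * (\<rho> x * u x $ i) * complex_of_real (\<phi> x))"
      by (rule integrable_times_test[OF s \<phi>])
    have e1: "(\<Sum>j\<in>UNIV. flux \<Omega> C u i j x * complex_of_real (partial_deriv j \<phi> x))
      = - (\<Sum>j\<in>UNIV. \<Sum>k\<in>UNIV. \<Sum>l\<in>UNIV.
          complex_of_real (C x i j k l) * weak_grad \<Omega> u x $ k $ l * complex_of_real (partial_deriv j \<phi> x))" for x
      by (simp add: flux_def sum_distrib_right sum_negf)
    have e2: "(complex_of_real \<omega>)\<^sup>2 * (\<rho> x * u x $ i) * complex_of_real (\<phi> x)
      = (complex_of_real \<omega>)\<^sup>2 * (\<rho> x * u x $ i * complex_of_real (\<phi> x))" for x by (simp add: mult.assoc)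
    show ?thesis
      unfolding Bochner_Integration.integral_add[OF i1 i2] unfolding e1 e2 by simp
  qed
  then show ?thesis unfolding elastic_eq_def by simp
qed

lemma elastic_eq_cong_AE:
  assumes op: "open \<Omega>" and uv: "AE x in lebesgue. x \<in> \<Omega> \<longrightarrow> u x = v x"
  shows "elastic_eq \<omega> \<Omega> C \<rho> u \<longleftrightarrow> elastic_eq \<omega> \<Omega> C \<rho> v"
proof -
  have "(LINT x|lebesgue_on \<Omega>. \<rho> x * u x $ i * complex_of_real (\<phi> x)) = (LINT x|lebesgue_on \<Omega>. \<rho> x * v x $ i * complex_of_real (\<phi> x))" for i \<phi>
    by (rule lebesgue_on_cong_AE(2)) (use op uv in \<open>auto elim: eventually_mono\<close>)
  then show ?thesis by (simp add: elastic_eq_def weak_grad_cong_AE[OF op uv])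
qed

definition elastic_form ::
  "real \<Rightarrow> (real^'n::finite) set \<Rightarrow> 'n tensor_field \<Rightarrow> (real^'n \<Rightarrow> complex) \<Rightarrow> (real^'n \<Rightarrow> complex^'n) \<Rightarrow> (real^'n \<Rightarrow> complex^'n) \<Rightarrow> complex" where
  "elastic_form \<omega> \<Omega> C \<rho> u v = (LINT x|lebesgue_on \<Omega>.
        (\<Sum>i\<in>UNIV. \<Sum>j\<in>UNIV. \<Sum>k\<in>UNIV. \<Sum>l\<in>UNIV.
           complex_of_real (C x i j k l) * weak_grad \<Omega> u x $ k $ l * cnj (weak_grad \<Omega> v x $ i $ j))
        - (complex_of_real \<omega>)\<^sup>2 * \<rho> x * (\<Sum>i\<in>UNIV. u x $ i * cnj (v x $ i)))"

lemma elastic_form_cong_AE: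
  assumes op: "open \<Omega>" and u: "AE x in lebesgue. x \<in> \<Omega> \<longrightarrow> u x = u' x" and v: "AE x in lebesgue. x \<in> \<Omega> \<longrightarrow> v x = v' x"
  shows "elastic_form \<omega> \<Omega> C \<rho> u v = elastic_form \<omega> \<Omega> C \<rho> u' v'"
  unfolding elastic_form_def weak_grad_cong_AE[OF op u] weak_grad_cong_AE[OF op v]
proof (rule lebesgue_on_cong_AE(2))
  show "AE x in lebesgue. x \<in> \<Omega> \<longrightarrow>
     (\<Sum>i\<in>UNIV. \<Sum>j\<in>UNIV. \<Sum>k\<in>UNIV. \<Sum>l\<in>UNIV. complex_of_real (C x i j k l) * weak_grad \<Omega> u' x $ k $ l * cnj (weak_grad \<Omega> v' x $ i $ j))
        - (complex_of_real \<omega>)\<^sup>2 * \<rho> x * (\<Sum>i\<in>UNIV. u x $ i * cnj (v x $ i)) =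
     (\<Sum>i\<in>UNIV. \<Sum>j\<in>UNIV. \<Sum>k\<in>UNIV. \<Sum>l\<in>UNIV. complex_of_real (C x i j k l) * weak_grad \<Omega> u' x $ k $ l * cnj (weak_grad \<Omega> v' x $ i $ j))
        - (complex_of_real \<omega>)\<^sup>2 * \<rho> x * (\<Sum>i\<in>UNIV. u' x $ i * cnj (v' x $ i))"
    using u v by eventually_elim simp
qed (use op in simp)

lemma neumann_solution_form:
  "neumann_solution \<omega> \<Omega> C \<rho> \<psi> u \<longleftrightarrow> u \<in> H1 \<Omega> \<and>
     (\<forall>v\<in>H1 \<Omega>. elastic_form \<omega> \<Omega> C \<rho> u v = \<psi> (\<lambda>x. \<chi> i. cnj (trace \<Omega> v x $ i)))"
  by (simp add: neumann_solution_def elastic_form_def)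

lemma neumann_solution_cong_AE:
  assumes "open \<Omega>" "AE x in lebesgue. x \<in> \<Omega> \<longrightarrow> u x = v x"
  shows "neumann_solution \<omega> \<Omega> C \<rho> \<psi> u \<longleftrightarrow> neumann_solution \<omega> \<Omega> C \<rho> \<psi> v"
proof -
  have "elastic_form \<omega> \<Omega> C \<rho> u t = elastic_form \<omega> \<Omega> C \<rho> v t" for t
    by (rule elastic_form_cong_AE[OF assms]) simp
  then show ?thesis unfolding neumann_solution_form H1_cong_AE[OF assms] by simp
qed

lemma H1_diff:
  assumes op: "open \<Omega>" and u: "u \<in> H1 \<Omega>" and v: "v \<in> H1 \<Omega>"
  shows "(\<lambda>x. u x - v x) \<in> H1 \<Omega>"
proof -
  have sd: "square_integrable M (\<lambda>x. f x - g x)" if "square_integrable M f" "square_integrable M g"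
    for M :: "(real^'n) measure" and f g :: "real^'n \<Rightarrow> 'b::euclidean_space"
    using square_integrable_add[OF that(1), of "\<lambda>x. - g x"] that(2) by (simp add: square_integrable_def)
  have "\<exists>g. has_weak_partial \<Omega> l (\<lambda>y. (u y - v y) $ k) g \<and> square_integrable (lebesgue_on \<Omega>) g" for k l
  proof -
    have wu: "has_weak_partial \<Omega> l (\<lambda>y. u y $ k) (\<lambda>x. weak_grad \<Omega> u x $ k $ l)" (is "has_weak_partial _ _ ?f ?f'")
      and wv: "has_weak_partial \<Omega> l (\<lambda>y. v y $ k) (\<lambda>x. weak_grad \<Omega> v x $ k $ l)" (is "has_weak_partial _ _ ?g ?g'")
      using H1_has_weak_partial u v by blast+
    have li: "locally_integrable \<Omega> ?f" "locally_integrable \<Omega> ?f'" "locally_integrable \<Omega> ?g" "locally_integrable \<Omega> ?g'"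
      using wu wv by (auto simp: has_weak_partial_def)
    have "has_weak_partial \<Omega> l (\<lambda>y. ?f y - ?g y) (\<lambda>x. ?f' x - ?g' x)"
      unfolding has_weak_partial_def
    proof (intro conjI locally_integrable_diff li ballI)
      fix \<phi> assume \<phi>: "\<phi> \<in> test_functions \<Omega>"
      note d\<phi> = partial_deriv_test_function[OF \<phi>]
      have "(LINT x|lebesgue_on \<Omega>. ?f x * complex_of_real (partial_deriv l \<phi> x)) = - (LINT x|lebesgue_on \<Omega>. ?f' x * complex_of_real (\<phi> x))"
        "(LINT x|lebesgue_on \<Omega>. ?g x * complex_of_real (partial_deriv l \<phi> x)) = - (LINT x|lebesgue_on \<Omega>. ?g' x * complex_of_real (\<phi> x))"
        using wu wv \<phi> unfolding has_weak_partial_def by blast+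
      then show "(LINT x|lebesgue_on \<Omega>. (?f x - ?g x) * complex_of_real (partial_deriv l \<phi> x)) = - (LINT x|lebesgue_on \<Omega>. (?f' x - ?g' x) * complex_of_real (\<phi> x))"
        using test_times(2)[OF d\<phi> op li(1)] test_times(2)[OF d\<phi> op li(3)] test_times(2)[OF \<phi> op li(2)] test_times(2)[OF \<phi> op li(4)]
        by (simp add: left_diff_distrib)
    qed
    moreover have "square_integrable (lebesgue_on \<Omega>) (\<lambda>x. ?f' x - ?g' x)"
      by (intro sd H1_weak_grad_square_integrable op u v)
    ultimately show ?thesis by (auto simp: vector_minus_component)
  qed
  moreover have "square_integrable (lebesgue_on \<Omega>) (\<lambda>x. u x - v x)"
    by (rule sd) (use u v in \<open>simp_all add: H1_def\<close>)
  ultimately show ?thesis by (simp add: H1_def)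
qed

section \<open>Traces and maps that fix the boundary\<close>

lemma is_trace_cong_AE:
  assumes op: "open \<Omega>" and uv: "AE x in lebesgue. x \<in> \<Omega> \<longrightarrow> u x = v x"
  shows "is_trace \<Omega> u g \<longleftrightarrow> is_trace \<Omega> v g"
proof -
  have "H1_norm \<Omega> (\<lambda>x. w x - u x) = H1_norm \<Omega> (\<lambda>x. w x - v x)" for w
    by (rule H1_norm_cong_AE[OF op]) (use uv in \<open>auto elim: eventually_mono\<close>)
  then show ?thesis by (simp add: is_trace_def)
qed

lemma trace_cong_AE:
  assumes "open \<Omega>" "AE x in lebesgue. x \<in> \<Omega> \<longrightarrow> u x = v x"
  shows "trace \<Omega> u = trace \<Omega> v"
  unfolding trace_def is_trace_cong_AE[OF assms] ..

lemma space_surface_measure: "space (surface_measure \<Gamma>) = \<Gamma>"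
  by (simp add: surface_measure_def space_restrict_space hausdorff_measure_def space_measure_of_conv)

context bilipschitz_pair
begin

lemma GF_AE: "AE x in lebesgue. x \<in> \<Omega> \<longrightarrow> u (G (F x)) = u x"
  by (auto simp: GF)

lemma FG_AE: "AE y in lebesgue. y \<in> \<Omega>' \<longrightarrow> u (F (G y)) = u y"
  by (auto simp: FG)

lemma H1_compose_iff: "(\<lambda>x. u (F x)) \<in> H1 \<Omega> \<longleftrightarrow> u \<in> H1 \<Omega>'"
  using H1_compose[of u] bilipschitz_pair.H1_compose[OF swap, of "\<lambda>x. u (F x)"] H1_cong_AE[OF open_ran FG_AE[of u]] by blast

context
  assumes fixed: "\<And>p. p \<in> frontier \<Omega> \<Longrightarrow> F p = p"
begin

lemma closure_dom: "closure \<Omega> = \<Omega> \<union> frontier \<Omega>"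
  by (metis closure_subset frontier_def interior_open open_dom Un_Diff_cancel sup.absorb2)

text \<open>The identity extends from \<Omega> to its closure by continuity; this is why
  \<open>G\<close> fixes the boundary as well.\<close>

lemma GF_closure: assumes "x \<in> closure \<Omega>" shows "G (F x) = x"
proof -
  have "closed {x. G (F x) = x}"
    by (intro closed_Collect_eq continuous_on_compose2[OF G_continuous F_continuous] continuous_on_id) auto
  then have "closure \<Omega> \<subseteq> {x. G (F x) = x}" by (intro closure_minimal) (auto simp: GF)
  then show ?thesis using assms by blast
qed

lemma G_fixed: "p \<in> frontier \<Omega> \<Longrightarrow> G p = p"
  using GF_closure[of p] fixed[of p] by (simp add: frontier_def)

lemma F_closure: "x \<in> closure \<Omega> \<Longrightarrow> F x \<in> closure \<Omega>'"
  using image_closure_subset[of \<Omega> F "closure \<Omega>'"] F_in closure_subset F_continuous by fastforce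

text \<open>The image of the compact closure of \<Omega> under \<open>F\<close> is the union of
  \<open>\<Omega>'\<close> and the frontier of \<Omega>; being closed, it contains the closure of
  \<open>\<Omega>'\<close>. The union is disjoint: a frontier point in \<open>\<Omega>'\<close> is
  fixed by \<open>G\<close>, which would put it into the open set \<Omega>.\<close>

lemma frontier_eq: "frontier \<Omega>' = frontier \<Omega>"
proof -
  have "compact (F ` closure \<Omega>)"
    using bounded_dom by (intro compact_continuous_image F_continuous) auto
  moreover have im: "F ` closure \<Omega> = \<Omega>' \<union> frontier \<Omega>"
  proof
    show "F ` closure \<Omega> \<subseteq> \<Omega>' \<union> frontier \<Omega>" using fixed F_in by (auto simp: closure_dom)
    have "y \<in> F ` closure \<Omega>" if "y \<in> \<Omega>'" for y
      using FG[OF that] G_in[OF that] closure_subset by (metis image_eqI subsetD)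
    moreover have "p \<in> F ` closure \<Omega>" if "p \<in> frontier \<Omega>" for p
      using fixed[OF that] that closure_dom by (metis UnI2 image_eqI)
    ultimately show "\<Omega>' \<union> frontier \<Omega> \<subseteq> F ` closure \<Omega>" by blast
  qed
  ultimately have "closure \<Omega>' \<subseteq> \<Omega>' \<union> frontier \<Omega>"
    by (intro closure_minimal) (auto dest: compact_imp_closed)
  moreover have "frontier \<Omega> \<subseteq> closure \<Omega>'" using F_closure fixed closure_dom by fastforce
  moreover have "frontier \<Omega> \<inter> \<Omega>' = {}"
  proof -
    have False if p: "p \<in> frontier \<Omega>" "p \<in> \<Omega>'" for p
    proof -
      have "p \<in> \<Omega>" using G_in[OF p(2)] G_fixed[OF p(1)] by simp
      then show False using p(1) open_dom by (simp add: frontier_def interior_open)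
    qed
    then show ?thesis by blast
  qed
  moreover have "frontier \<Omega>' = closure \<Omega>' - \<Omega>'" using open_ran by (simp add: frontier_def interior_open)
  ultimately show ?thesis by blast
qed

text \<open>The approximating functions are composed with \<open>F\<close> and remain continuous up
  to the boundary. Their boundary error is literally unchanged because \<open>F\<close> is the
  identity there, and \<open>H1_norm_compose\<close> controls the interior error.\<close>

lemma is_trace_compose:
  assumes u: "u \<in> H1 \<Omega>'" and t: "is_trace \<Omega>' u g"
  shows "is_trace \<Omega> (\<lambda>x. u (F x)) g"
proof -
  obtain w where w: "\<And>n. w n \<in> H1 \<Omega>'" "\<And>n. continuous_on (closure \<Omega>') (w n)"
      "(\<lambda>n. H1_norm \<Omega>' (\<lambda>x. w n x - u x)) \<longlonglongrightarrow> 0"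
      "(\<lambda>n. \<integral>\<^sup>+x. ennreal ((norm (w n x - g x))\<^sup>2) \<partial>surface_measure (frontier \<Omega>')) \<longlonglongrightarrow> 0"
    using t unfolding is_trace_def by blast
  obtain K where K: "0 \<le> K" "\<And>u. u \<in> H1 \<Omega>' \<Longrightarrow> H1_norm \<Omega> (\<lambda>x. u (F x)) \<le> K * H1_norm \<Omega>' u"
    using H1_norm_compose by blast
  have "(\<lambda>n. H1_norm \<Omega> (\<lambda>x. w n (F x) - u (F x))) \<longlonglongrightarrow> 0"
  proof (rule tendsto_sandwich[where f="\<lambda>n. 0" and h="\<lambda>n. K * H1_norm \<Omega>' (\<lambda>x. w n x - u x)"])
    show "(\<lambda>n. K * H1_norm \<Omega>' (\<lambda>x. w n x - u x)) \<longlonglongrightarrow> 0" using tendsto_mult_left[OF w(3), of K] by simp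
    show "\<forall>\<^sub>F n in sequentially. H1_norm \<Omega> (\<lambda>x. w n (F x) - u (F x)) \<le> K * H1_norm \<Omega>' (\<lambda>x. w n x - u x)"
      using K(2)[OF H1_diff[OF open_ran w(1) u]] by simp
    show "\<forall>\<^sub>F n in sequentially. 0 \<le> H1_norm \<Omega> (\<lambda>x. w n (F x) - u (F x))"
      by (simp add: H1_norm_def Bochner_Integration.integral_nonneg)
  qed simp
  moreover have "(\<integral>\<^sup>+x. ennreal ((norm (w n (F x) - g x))\<^sup>2) \<partial>surface_measure (frontier \<Omega>))
      = (\<integral>\<^sup>+x. ennreal ((norm (w n x - g x))\<^sup>2) \<partial>surface_measure (frontier \<Omega>'))" for n
    unfolding frontier_eq by (rule nn_integral_cong) (simp add: space_surface_measure fixed)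
  moreover have "continuous_on (closure \<Omega>) (\<lambda>x. w n (F x))" for n
    by (rule continuous_on_compose2[OF w(2) F_continuous]) (use F_closure in auto)
  moreover have "square_integrable (surface_measure (frontier \<Omega>)) g" using t by (simp add: is_trace_def frontier_eq)
  ultimately show ?thesis
    unfolding is_trace_def using w(4) H1_compose[OF w(1)] by (intro conjI exI[of _ "\<lambda>n x. w n (F x)"]) auto
qed

text \<open>The two trace predicates coincide, by \<open>is_trace_compose\<close> for the pair and
  for its swap. So \<open>SOME\<close> returns the same function on both sides.\<close>

lemma trace_compose:
  assumes u: "u \<in> H1 \<Omega>'" shows "trace \<Omega> (\<lambda>x. u (F x)) = trace \<Omega>' u"
proof -
  have "is_trace \<Omega>' u g" if "is_trace \<Omega> (\<lambda>x. u (F x)) g" for g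
  proof -
    have "is_trace \<Omega>' (\<lambda>y. u (F (G y))) g"
      by (rule bilipschitz_pair.is_trace_compose[OF swap _ H1_compose[OF u] that]) (simp add: frontier_eq G_fixed)
    then show ?thesis using is_trace_cong_AE[OF open_ran FG_AE] by blast
  qed
  then have "is_trace \<Omega> (\<lambda>x. u (F x)) = is_trace \<Omega>' u" using is_trace_compose[OF u] by blast
  then show ?thesis by (simp add: trace_def)
qed

end

end

section \<open>The transformed medium\<close>

text \<open>The new coefficients are prescribed through their values at points \<open>F x\<close>,
  so that the pulled-back formulas contain no inverse map.\<close>

locale transformed_medium = bilipschitz_pair F G \<Omega> \<Omega>' L
  for F G :: "real^'n::finite \<Rightarrow> real^'n" and \<Omega> \<Omega>' L +
  fixes C C' :: "'n tensor_field" and \<rho> \<rho>' :: "real^'n \<Rightarrow> complex"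
  assumes orient: "AE x in lebesgue. x \<in> \<Omega> \<longrightarrow> 0 < det (jacobian F (at x))"
    and C_bounded: "\<And>i j k l. essentially_bounded (lebesgue_on \<Omega>) (\<lambda>x. C x i j k l)"
    and \<rho>_bounded: "essentially_bounded (lebesgue_on \<Omega>) \<rho>"
    and C'_eq: "\<And>x i q k p. x \<in> \<Omega> \<Longrightarrow> C' (F x) i q k p
       = 1 / det (jacobian F (at x)) * (\<Sum>l\<in>UNIV. \<Sum>j\<in>UNIV. C x i j k l * jacobian F (at x) $ p $ l * jacobian F (at x) $ q $ j)"
    and \<rho>'_eq: "\<And>x. x \<in> \<Omega> \<Longrightarrow> \<rho>' (F x) = \<rho> x / complex_of_real (det (jacobian F (at x)))"
begin

lemma finite_measure_dom: "finite_measure (lebesgue_on \<Omega>)"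
  using bounded_dom open_dom by (intro finite_measure_lebesgue_on lmeasurable_open)

lemma flux_integrable:
  assumes u: "u \<in> H1 \<Omega>" shows "integrable (lebesgue_on \<Omega>) (flux \<Omega> C u i j)"
proof -
  have "integrable (lebesgue_on \<Omega>) (\<lambda>x. complex_of_real (C x i j k l) * weak_grad \<Omega> u x $ k $ l)" for k l
  proof -
    obtain B where "(\<lambda>x. C x i j k l) \<in> borel_measurable (lebesgue_on \<Omega>)" "AE x in lebesgue_on \<Omega>. norm (C x i j k l) \<le> B"
      using C_bounded[of i j k l] unfolding essentially_bounded_def by blast
    then show ?thesis
      using square_integrable_imp_integrable[OF finite_measure_dom square_integrable_mult_bounded[OF H1_weak_grad_square_integrable[OF open_dom u]]]
      by (auto simp: measurable_compose[OF _ borel_measurable_of_real])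
  qed
  then show ?thesis unfolding flux_def by (intro Bochner_Integration.integrable_minus Bochner_Integration.integrable_sum)
qed

lemma source_integrable:
  assumes u: "u \<in> H1 \<Omega>" shows "integrable (lebesgue_on \<Omega>) (\<lambda>x. c * (\<rho> x * u x $ i))"
proof -
  have su: "square_integrable (lebesgue_on \<Omega>) (\<lambda>x. u x $ i)"
    using u by (auto simp: H1_def intro: square_integrable_component)
  obtain B where "\<rho> \<in> borel_measurable (lebesgue_on \<Omega>)" "AE x in lebesgue_on \<Omega>. cmod (\<rho> x) \<le> B"
    using \<rho>_bounded by (auto simp: essentially_bounded_def)
  from square_integrable_imp_integrable[OF finite_measure_dom square_integrable_mult_bounded[OF su this]]
  show ?thesis by simp
qed

text \<open>By \<open>orient\<close>, \<open>dens\<close> equals the determinant and cancels the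
  factor \<open>1 / det\<close> in the coefficients. What remains is the contraction of
  \<open>push_tensor_contract\<close>, with the gradient of the composite supplied by
  \<open>weak_grad_compose\<close>. The free constant \<open>c\<close> becomes
  \<open>\<omega>\<^sup>2\<close> in the applications.\<close>

lemma transformed_flux:
  assumes v: "v \<in> H1 \<Omega>'"
  shows "AE x in lebesgue. x \<in> \<Omega> \<longrightarrow>
    dens x *\<^sub>R (c * (\<rho>' (F x) * v (F x) $ i)) = c * (\<rho> x * v (F x) $ i) \<and>
    (\<forall>q. dens x *\<^sub>R flux \<Omega>' C' v i q (F x) = (\<Sum>j\<in>UNIV. complex_of_real (jacobian F (at x) $ q $ j) * flux \<Omega> C (\<lambda>x. v (F x)) i j x))"
  using orient weak_grad_compose[OF v]
proof eventually_elim
  case (elim x)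
  show ?case
  proof (intro impI conjI allI)
    assume x: "x \<in> \<Omega>"
    let ?M = "jacobian F (at x)" and ?b = "\<lambda>k p. weak_grad \<Omega>' v (F x) $ k $ p"
    have D: "dens x = det ?M" "0 < det ?M" using elim x by (auto simp: dens_def)
    then show "dens x *\<^sub>R (c * (\<rho>' (F x) * v (F x) $ i)) = c * (\<rho> x * v (F x) $ i)"
      by (simp add: \<rho>'_eq[OF x] scaleR_conv_of_real)
    have "dens x *\<^sub>R flux \<Omega>' C' v i q (F x) =
        - (\<Sum>k\<in>UNIV. \<Sum>p\<in>UNIV. complex_of_real (\<Sum>l\<in>UNIV. \<Sum>j\<in>UNIV. C x i j k l * ?M$p$l * ?M$q$j) * ?b k p)" for q
    proof -
      have "det ?M *\<^sub>R (complex_of_real (1 / det ?M * s) * b) = complex_of_real s * b" for s b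
        using D(2) by (simp add: scaleR_conv_of_real)
      then show ?thesis
        by (simp only: flux_def C'_eq[OF x] scaleR_minus_right scaleR_sum_right D(1))
    qed
    then show "dens x *\<^sub>R flux \<Omega>' C' v i q (F x) = (\<Sum>j\<in>UNIV. complex_of_real (?M $ q $ j) * flux \<Omega> C (\<lambda>x. v (F x)) i j x)" for q
      unfolding push_tensor_contract flux_def using elim x by (simp add: sum_negf)
  qed
qed

text \<open>Pulled back and multiplied by \<open>dens\<close>, the new fields become the old flux
  times bounded Jacobian entries and the old source. Measurability of the new fields comes out of
  \<open>change_of_variables_AE\<close> at the same time.\<close>

lemma transformed_integrable:
  assumes v: "v \<in> H1 \<Omega>'"
  shows "integrable (lebesgue_on \<Omega>') (flux \<Omega>' C' v i q)" "integrable (lebesgue_on \<Omega>') (\<lambda>y. c * (\<rho>' y * v y $ i))"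
proof -
  have u: "(\<lambda>x. v (F x)) \<in> H1 \<Omega>" by (rule H1_compose[OF v])
  have Jb: "AE x in lebesgue_on \<Omega>. \<bar>jacobian F (at x) $ q $ j\<bar> \<le> L" for j
    unfolding AE_on_dom using Rademacher[OF F_lip] by eventually_elim (simp add: lipschitz_jacobian_bound[OF F_lip])
  have k: "integrable (lebesgue_on \<Omega>) (\<lambda>x. \<Sum>j\<in>UNIV. complex_of_real (jacobian F (at x) $ q $ j) * flux \<Omega> C (\<lambda>x. v (F x)) i j x)"
    using integrable_scaleR_bounded[OF flux_integrable[OF u] measurable_restrict_space1[OF lipschitz_jacobian_measurable[OF F_lip]] Jb]
    by (intro Bochner_Integration.integrable_sum) (simp add: scaleR_conv_of_real)
  show "integrable (lebesgue_on \<Omega>') (flux \<Omega>' C' v i q)"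
    by (rule change_of_variables_AE(1)[THEN iffD2, OF borel_measurable_integrable[OF k] _ k])
       (use transformed_flux[OF v, of 0 i] in \<open>auto elim: eventually_mono\<close>)
  show "integrable (lebesgue_on \<Omega>') (\<lambda>y. c * (\<rho>' y * v y $ i))"
    by (rule change_of_variables_AE(1)[THEN iffD2, OF borel_measurable_integrable[OF source_integrable[OF u]] _ source_integrable[OF u]])
       (use transformed_flux[OF v, of c i] in \<open>auto elim: eventually_mono\<close>)
qed

lemma elastic_eq_compose:
  assumes v: "v \<in> H1 \<Omega>'"
  shows "elastic_eq \<omega> \<Omega> C \<rho> (\<lambda>x. v (F x)) \<longleftrightarrow> elastic_eq \<omega> \<Omega>' C' \<rho>' v"
proof -
  have u: "(\<lambda>x. v (F x)) \<in> H1 \<Omega>" by (rule H1_compose[OF v])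
  show ?thesis
    unfolding elastic_eq_iff_flux[OF flux_integrable[OF u] source_integrable[OF u]]
      elastic_eq_iff_flux[OF transformed_integrable[OF v]]
    by (intro all_cong1 piola_iff transformed_integrable[OF v] flux_integrable[OF u] source_integrable[OF u] transformed_flux[OF v])
qed

text \<open>\<open>transformed_flux\<close> absorbs one Jacobian factor in the gradient of
  \<open>u\<close>; the other one goes into the gradient of \<open>v\<close> through
  \<open>weak_grad_compose\<close>. The integrands themselves correspond, without integration by
  parts, so \<open>v\<close> may be any element of \<open>H1\<close> and need not vanish at the
  boundary.\<close>

lemma elastic_form_compose:
  assumes u: "u \<in> H1 \<Omega>'" and v: "v \<in> H1 \<Omega>'"
  shows "elastic_form \<omega> \<Omega>' C' \<rho>' u v = elastic_form \<omega> \<Omega> C \<rho> (\<lambda>x. u (F x)) (\<lambda>x. v (F x))"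
  unfolding elastic_form_def
proof (rule change_of_variables_AE(2))
  let ?u = "\<lambda>x. u (F x)" and ?v = "\<lambda>x. v (F x)"
  have uF: "?u \<in> H1 \<Omega>" and vF: "?v \<in> H1 \<Omega>" using H1_compose u v by auto
  have wm: "(\<lambda>x. w x $ i) \<in> borel_measurable (lebesgue_on \<Omega>)" if "w \<in> H1 \<Omega>" for w i
    using that square_integrable_component by (auto simp: H1_def square_integrable_def)
  have cm: "(\<lambda>x. complex_of_real (C x i j k l)) \<in> borel_measurable (lebesgue_on \<Omega>)" for i j k l
    using C_bounded[of i j k l] by (auto simp: essentially_bounded_def)
  have rm: "\<rho> \<in> borel_measurable (lebesgue_on \<Omega>)" using \<rho>_bounded by (simp add: essentially_bounded_def)
  have cnjm: "(\<lambda>x. cnj (f x)) \<in> borel_measurable M" if "f \<in> borel_measurable M" for f and M :: "(real^'n) measure"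
    by (rule measurable_compose[OF that borel_measurable_continuous_onI]) (intro continuous_intros)
  have gm: "(\<lambda>x. weak_grad \<Omega> w x $ k $ l) \<in> borel_measurable (lebesgue_on \<Omega>)" if "w \<in> H1 \<Omega>" for w k l
    using H1_weak_grad_square_integrable[OF open_dom that] by (simp add: square_integrable_def)
  show "(\<lambda>x. (\<Sum>i\<in>UNIV. \<Sum>j\<in>UNIV. \<Sum>k\<in>UNIV. \<Sum>l\<in>UNIV. complex_of_real (C x i j k l) * weak_grad \<Omega> ?u x $ k $ l * cnj (weak_grad \<Omega> ?v x $ i $ j))
        - (complex_of_real \<omega>)\<^sup>2 * \<rho> x * (\<Sum>i\<in>UNIV. u (F x) $ i * cnj (v (F x) $ i))) \<in> borel_measurable (lebesgue_on \<Omega>)"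
    by (intro borel_measurable_diff borel_measurable_sum borel_measurable_times cnjm gm[OF uF] gm[OF vF] wm[OF uF] wm[OF vF] cm rm borel_measurable_const)
  show "AE x in lebesgue. x \<in> \<Omega> \<longrightarrow>
     (\<Sum>i\<in>UNIV. \<Sum>j\<in>UNIV. \<Sum>k\<in>UNIV. \<Sum>l\<in>UNIV. complex_of_real (C x i j k l) * weak_grad \<Omega> ?u x $ k $ l * cnj (weak_grad \<Omega> ?v x $ i $ j))
        - (complex_of_real \<omega>)\<^sup>2 * \<rho> x * (\<Sum>i\<in>UNIV. u (F x) $ i * cnj (v (F x) $ i))
     = dens x *\<^sub>R ((\<Sum>i\<in>UNIV. \<Sum>q\<in>UNIV. \<Sum>k\<in>UNIV. \<Sum>p\<in>UNIV. complex_of_real (C' (F x) i q k p) * weak_grad \<Omega>' u (F x) $ k $ p * cnj (weak_grad \<Omega>' v (F x) $ i $ q))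
        - (complex_of_real \<omega>)\<^sup>2 * \<rho>' (F x) * (\<Sum>i\<in>UNIV. u (F x) $ i * cnj (v (F x) $ i)))"
  proof -
    have "AE x in lebesgue. \<forall>i\<in>UNIV. x \<in> \<Omega> \<longrightarrow>
      dens x *\<^sub>R ((complex_of_real \<omega>)\<^sup>2 * (\<rho>' (F x) * u (F x) $ i)) = (complex_of_real \<omega>)\<^sup>2 * (\<rho> x * u (F x) $ i) \<and>
      (\<forall>q. dens x *\<^sub>R flux \<Omega>' C' u i q (F x) = (\<Sum>j\<in>UNIV. complex_of_real (jacobian F (at x) $ q $ j) * flux \<Omega> C ?u i j x))"
      by (rule AE_finite_allI[OF finite]) (rule transformed_flux[OF u])
    then show ?thesis
      using weak_grad_compose[OF v]
    proof eventually_elim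
      case (elim x)
      show ?case
      proof
        assume x: "x \<in> \<Omega>"
        let ?M = "jacobian F (at x)" and ?d = "\<lambda>i q. cnj (weak_grad \<Omega>' v (F x) $ i $ q)"
        have vg: "cnj (weak_grad \<Omega> ?v x $ i $ j) = (\<Sum>q\<in>UNIV. ?d i q * complex_of_real (?M $ q $ j))" for i j
          using elim(2) x by simp
        have "dens x *\<^sub>R (\<Sum>i\<in>UNIV. \<Sum>q\<in>UNIV. \<Sum>k\<in>UNIV. \<Sum>p\<in>UNIV. complex_of_real (C' (F x) i q k p) * weak_grad \<Omega>' u (F x) $ k $ p * ?d i q)
          = (\<Sum>i\<in>UNIV. \<Sum>q\<in>UNIV. (- (dens x *\<^sub>R flux \<Omega>' C' u i q (F x))) * ?d i q)"
          by (simp add: flux_def sum_distrib_right scaleR_sum_right)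
        also have "\<dots> = (\<Sum>i\<in>UNIV. \<Sum>q\<in>UNIV. \<Sum>j\<in>UNIV. - flux \<Omega> C ?u i j x * (?d i q * complex_of_real (?M $ q $ j)))"
          using elim(1) x by (simp add: sum_distrib_right sum_distrib_left sum_negf mult_ac)
        also have "\<dots> = (\<Sum>i\<in>UNIV. \<Sum>j\<in>UNIV. - flux \<Omega> C ?u i j x * cnj (weak_grad \<Omega> ?v x $ i $ j))"
          unfolding vg by (rule sum.cong[OF refl], subst sum.swap) (simp add: sum_distrib_left)
        also have "\<dots> = (\<Sum>i\<in>UNIV. \<Sum>j\<in>UNIV. \<Sum>k\<in>UNIV. \<Sum>l\<in>UNIV. complex_of_real (C x i j k l) * weak_grad \<Omega> ?u x $ k $ l * cnj (weak_grad \<Omega> ?v x $ i $ j))"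
          by (simp add: flux_def sum_distrib_right)
        finally have 1: "dens x *\<^sub>R (\<Sum>i\<in>UNIV. \<Sum>q\<in>UNIV. \<Sum>k\<in>UNIV. \<Sum>p\<in>UNIV. complex_of_real (C' (F x) i q k p) * weak_grad \<Omega>' u (F x) $ k $ p * ?d i q)
          = (\<Sum>i\<in>UNIV. \<Sum>j\<in>UNIV. \<Sum>k\<in>UNIV. \<Sum>l\<in>UNIV. complex_of_real (C x i j k l) * weak_grad \<Omega> ?u x $ k $ l * cnj (weak_grad \<Omega> ?v x $ i $ j))" .
        have "dens x *\<^sub>R ((complex_of_real \<omega>)\<^sup>2 * \<rho>' (F x) * (\<Sum>i\<in>UNIV. u (F x) $ i * cnj (v (F x) $ i)))
          = (\<Sum>i\<in>UNIV. (dens x *\<^sub>R ((complex_of_real \<omega>)\<^sup>2 * (\<rho>' (F x) * u (F x) $ i))) * cnj (v (F x) $ i))"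
          by (simp add: sum_distrib_left scaleR_sum_right mult.assoc)
        also have "\<dots> = (complex_of_real \<omega>)\<^sup>2 * \<rho> x * (\<Sum>i\<in>UNIV. u (F x) $ i * cnj (v (F x) $ i))"
          using elim(1) x by (simp add: sum_distrib_left mult.assoc del: mult_scaleR_left)
        finally show "(\<Sum>i\<in>UNIV. \<Sum>j\<in>UNIV. \<Sum>k\<in>UNIV. \<Sum>l\<in>UNIV. complex_of_real (C x i j k l) * weak_grad \<Omega> ?u x $ k $ l * cnj (weak_grad \<Omega> ?v x $ i $ j))
            - (complex_of_real \<omega>)\<^sup>2 * \<rho> x * (\<Sum>i\<in>UNIV. u (F x) $ i * cnj (v (F x) $ i))
          = dens x *\<^sub>R ((\<Sum>i\<in>UNIV. \<Sum>q\<in>UNIV. \<Sum>k\<in>UNIV. \<Sum>p\<in>UNIV. complex_of_real (C' (F x) i q k p) * weak_grad \<Omega>' u (F x) $ k $ p * ?d i q)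
            - (complex_of_real \<omega>)\<^sup>2 * \<rho>' (F x) * (\<Sum>i\<in>UNIV. u (F x) $ i * cnj (v (F x) $ i)))"
          by (simp only: scaleR_diff_right 1)
      qed
    qed
  qed
qed

context
  assumes fixed: "\<And>p. p \<in> frontier \<Omega> \<Longrightarrow> F p = p"
begin

text \<open>Test fields on the two domains correspond under composition with \<open>F\<close>, and
  corresponding fields have the same trace, so the datum \<psi> sees no difference. If
  \<open>v\<close> is outside \<open>H1\<close>, so is its composite, and both sides are
  false.\<close>

lemma neumann_solution_compose:
  "neumann_solution \<omega> \<Omega> C \<rho> \<psi> (\<lambda>x. v (F x)) \<longleftrightarrow> neumann_solution \<omega> \<Omega>' C' \<rho>' \<psi> v"
proof (cases "v \<in> H1 \<Omega>'")
  case v: True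
  have "(\<forall>t\<in>H1 \<Omega>. elastic_form \<omega> \<Omega> C \<rho> (\<lambda>x. v (F x)) t = \<psi> (\<lambda>x. \<chi> i. cnj (trace \<Omega> t x $ i)))
    \<longleftrightarrow> (\<forall>t\<in>H1 \<Omega>'. elastic_form \<omega> \<Omega>' C' \<rho>' v t = \<psi> (\<lambda>x. \<chi> i. cnj (trace \<Omega>' t x $ i)))" (is "?l \<longleftrightarrow> ?r")
  proof
    assume l: ?l
    show ?r
    proof
      fix t assume t: "t \<in> H1 \<Omega>'"
      show "elastic_form \<omega> \<Omega>' C' \<rho>' v t = \<psi> (\<lambda>x. \<chi> i. cnj (trace \<Omega>' t x $ i))"
        using l H1_compose[OF t] by (simp add: elastic_form_compose[OF v t] trace_compose[OF fixed t])
    qed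
  next
    assume r: ?r
    show ?l
    proof
      fix t assume t: "t \<in> H1 \<Omega>"
      have tG: "(\<lambda>y. t (G y)) \<in> H1 \<Omega>'" by (rule bilipschitz_pair.H1_compose[OF swap t])
      have "elastic_form \<omega> \<Omega> C \<rho> (\<lambda>x. v (F x)) t = elastic_form \<omega> \<Omega> C \<rho> (\<lambda>x. v (F x)) (\<lambda>x. t (G (F x)))"
        by (rule elastic_form_cong_AE[OF open_dom]) (auto simp: GF)
      also have "\<dots> = elastic_form \<omega> \<Omega>' C' \<rho>' v (\<lambda>y. t (G y))"
        by (rule elastic_form_compose[OF v tG, symmetric])
      also have "\<dots> = \<psi> (\<lambda>x. \<chi> i. cnj (trace \<Omega>' (\<lambda>y. t (G y)) x $ i))" using r tG by blast
      also have "trace \<Omega>' (\<lambda>y. t (G y)) = trace \<Omega> (\<lambda>x. t (G (F x)))" by (rule trace_compose[OF fixed tG, symmetric])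
      also have "\<dots> = trace \<Omega> t" by (rule trace_cong_AE[OF open_dom GF_AE])
      finally show "elastic_form \<omega> \<Omega> C \<rho> (\<lambda>x. v (F x)) t = \<psi> (\<lambda>x. \<chi> i. cnj (trace \<Omega> t x $ i))" .
    qed
  qed
  then show ?thesis using v H1_compose[OF v] by (simp add: neumann_solution_form)
next
  case False
  then show ?thesis using H1_compose_iff by (simp add: neumann_solution_form)
qed

text \<open>Existence, uniqueness and the a priori bound are carried over one by one; the new
  constant is the old one times the constant for composition with \<open>G\<close>.\<close>

lemma neumann_transform:
  assumes wp: "neumann_well_posed \<omega> \<Omega> C \<rho>"
  shows "neumann_well_posed \<omega> \<Omega>' C' \<rho>'"
    and "\<psi> \<in> H_minus_half (frontier \<Omega>) \<Longrightarrow> neumann_to_dirichlet \<omega> \<Omega> C \<rho> \<psi> = neumann_to_dirichlet \<omega> \<Omega>' C' \<rho>' \<psi>"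
proof -
  have ex: "\<exists>u. neumann_solution \<omega> \<Omega> C \<rho> \<psi> u" if "\<psi> \<in> H_minus_half (frontier \<Omega>)" for \<psi>
    using wp that by (simp add: neumann_well_posed_def)
  have un: "AE x in lebesgue. x \<in> \<Omega> \<longrightarrow> u x = w x"
    if "\<psi> \<in> H_minus_half (frontier \<Omega>)" "neumann_solution \<omega> \<Omega> C \<rho> \<psi> u" "neumann_solution \<omega> \<Omega> C \<rho> \<psi> w" for \<psi> u w
    using wp that unfolding neumann_well_posed_def AE_on_dom by blast
  have ex': "\<exists>v. neumann_solution \<omega> \<Omega>' C' \<rho>' \<psi> v" if \<psi>: "\<psi> \<in> H_minus_half (frontier \<Omega>)" for \<psi>
  proof -
    obtain u where "neumann_solution \<omega> \<Omega> C \<rho> \<psi> u" using ex[OF \<psi>] by blast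
    then have "neumann_solution \<omega> \<Omega> C \<rho> \<psi> (\<lambda>x. u (G (F x)))"
      using neumann_solution_cong_AE[OF open_dom GF_AE] by blast
    then show ?thesis using neumann_solution_compose[of \<omega> \<psi> "\<lambda>y. u (G y)"] by blast
  qed
  have un': "AE y in lebesgue_on \<Omega>'. v y = w y"
    if \<psi>: "\<psi> \<in> H_minus_half (frontier \<Omega>)" and vw: "neumann_solution \<omega> \<Omega>' C' \<rho>' \<psi> v" "neumann_solution \<omega> \<Omega>' C' \<rho>' \<psi> w" for \<psi> v w
  proof -
    have "AE x in lebesgue. x \<in> \<Omega> \<longrightarrow> v (F x) = w (F x)"
      by (rule un[OF \<psi>]) (simp_all add: neumann_solution_compose vw)
    from bilipschitz_pair.AE_pullback[OF swap this]
    have "AE y in lebesgue. y \<in> \<Omega>' \<longrightarrow> v y = w y" by eventually_elim (auto simp: FG)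
    then show ?thesis by (simp add: bilipschitz_pair.AE_on_dom[OF swap])
  qed
  have bound': "\<exists>K. \<forall>\<psi>\<in>H_minus_half (frontier \<Omega>). \<forall>u. neumann_solution \<omega> \<Omega>' C' \<rho>' \<psi> u \<longrightarrow>
        H1_norm \<Omega>' u \<le> K * H_minus_half_norm (frontier \<Omega>) \<psi>"
  proof -
    obtain K where K: "\<And>\<psi> u. \<psi> \<in> H_minus_half (frontier \<Omega>) \<Longrightarrow> neumann_solution \<omega> \<Omega> C \<rho> \<psi> u \<Longrightarrow>
        H1_norm \<Omega> u \<le> K * H_minus_half_norm (frontier \<Omega>) \<psi>"
      using wp unfolding neumann_well_posed_def by blast
    obtain K' where K': "0 \<le> K'" "\<And>u. u \<in> H1 \<Omega> \<Longrightarrow> H1_norm \<Omega>' (\<lambda>y. u (G y)) \<le> K' * H1_norm \<Omega> u"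
      using bilipschitz_pair.H1_norm_compose[OF swap] by blast
    have "H1_norm \<Omega>' v \<le> K' * K * H_minus_half_norm (frontier \<Omega>) \<psi>"
      if \<psi>: "\<psi> \<in> H_minus_half (frontier \<Omega>)" and v: "neumann_solution \<omega> \<Omega>' C' \<rho>' \<psi> v" for \<psi> v
    proof -
      have s: "neumann_solution \<omega> \<Omega> C \<rho> \<psi> (\<lambda>x. v (F x))" using v by (simp add: neumann_solution_compose)
      then have "(\<lambda>x. v (F x)) \<in> H1 \<Omega>" by (simp add: neumann_solution_form)
      have "H1_norm \<Omega>' v = H1_norm \<Omega>' (\<lambda>y. v (F (G y)))"
        by (rule H1_norm_cong_AE[OF open_ran]) (auto simp: FG)
      also have "\<dots> \<le> K' * H1_norm \<Omega> (\<lambda>x. v (F x))" by (rule K'(2)) fact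
      also have "\<dots> \<le> K' * (K * H_minus_half_norm (frontier \<Omega>) \<psi>)"
        using K[OF \<psi> s] K'(1) by (rule mult_left_mono)
      finally show ?thesis by (simp add: mult.assoc)
    qed
    then show ?thesis by blast
  qed
  have fr: "frontier \<Omega>' = frontier \<Omega>" by (rule frontier_eq) (rule fixed)
  show "neumann_well_posed \<omega> \<Omega>' C' \<rho>'"
    using ex' un' bound' unfolding neumann_well_posed_def fr by blast
  assume \<psi>: "\<psi> \<in> H_minus_half (frontier \<Omega>)"
  define u where "u = (SOME u. neumann_solution \<omega> \<Omega> C \<rho> \<psi> u)"
  define v where "v = (SOME v. neumann_solution \<omega> \<Omega>' C' \<rho>' \<psi> v)"
  have u: "neumann_solution \<omega> \<Omega> C \<rho> \<psi> u" unfolding u_def using ex[OF \<psi>] by (rule someI_ex)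
  have v: "neumann_solution \<omega> \<Omega>' C' \<rho>' \<psi> v" unfolding v_def using ex'[OF \<psi>] by (rule someI_ex)
  \<comment> \<open>The solutions picked by \<open>SOME\<close> on the two domains are a priori
    unrelated. Uniqueness on \<Omega> shows that \<open>u\<close> is the composite of
    \<open>v\<close> with \<open>F\<close> up to a null set.\<close>
  have "AE x in lebesgue. x \<in> \<Omega> \<longrightarrow> u x = v (F x)"
    by (rule un[OF \<psi> u]) (simp add: neumann_solution_compose v)
  then have "trace \<Omega> u = trace \<Omega> (\<lambda>x. v (F x))" by (rule trace_cong_AE[OF open_dom])
  also have "\<dots> = trace \<Omega>' v" using v by (intro trace_compose[OF fixed]) (simp_all add: neumann_solution_form)
  finally show "neumann_to_dirichlet \<omega> \<Omega> C \<rho> \<psi> = neumann_to_dirichlet \<omega> \<Omega>' C' \<rho>' \<psi>"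
    by (simp add: neumann_to_dirichlet_def u_def v_def)
qed

end

end

text \<open>In the second part, equality of the frontiers and well-posedness of the transformed
  problem are what give the equality of the two maps its meaning: the data range over the same
  space, and both maps are defined. Boundary values are classes of functions, hence the almost
  everywhere comparison on the surface.\<close>

theorem lemma2p1:
  fixes \<omega> :: real
    and \<Omega> \<Omega>' :: "(real^'n::finite) set"
    and C :: "'n tensor_field"
    and \<rho> :: "real^'n \<Rightarrow> complex"
    and F :: "real^'n \<Rightarrow> real^'n"
  assumes "CARD('n) = 2 \<or> CARD('n) = 3"
    and "0 < \<omega>"
    and "smooth_bounded_domain \<Omega>"
    and "elastic_medium \<Omega> C \<rho>"
    and "bi_lipschitz F \<Omega> \<Omega>'"
    and "orientation_preserving F \<Omega>"
  shows "(\<forall>u. (u \<in> H1 \<Omega> \<and> elastic_eq \<omega> \<Omega> C \<rho> u) \<longleftrightarrow>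
              (u \<circ> inv_into \<Omega> F \<in> H1 \<Omega>' \<and>
               elastic_eq \<omega> \<Omega>' (push_tensor F \<Omega> C) (push_density F \<Omega> \<rho>) (u \<circ> inv_into \<Omega> F)))
       \<and> (identity_on_boundary F \<Omega> \<and> neumann_well_posed \<omega> \<Omega> C \<rho> \<longrightarrow>
            frontier \<Omega>' = frontier \<Omega>
            \<and> neumann_well_posed \<omega> \<Omega>' (push_tensor F \<Omega> C) (push_density F \<Omega> \<rho>)
            \<and> (\<forall>\<psi>\<in>H_minus_half (frontier \<Omega>). AE x in surface_measure (frontier \<Omega>).
                 neumann_to_dirichlet \<omega> \<Omega> C \<rho> \<psi> x
                 = neumann_to_dirichlet \<omega> \<Omega>' (push_tensor F \<Omega> C) (push_density F \<Omega> \<rho>) \<psi> x))"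
proof -
  have op: "open \<Omega>" and bd: "bounded \<Omega>" using assms(3) by (auto simp: smooth_bounded_domain_def)
  have bij: "bij_betw F \<Omega> \<Omega>'" using assms(5) by (simp add: bi_lipschitz_def)
  obtain L1 L2 where L12: "L1-lipschitz_on \<Omega> F" "L2-lipschitz_on \<Omega>' (inv_into \<Omega> F)"
    using assms(5) by (auto simp: bi_lipschitz_def)
  \<comment> \<open>\<open>F\<close> and its inverse are known to be Lipschitz on their domains
    only; the extensions \<open>E\<close> and \<open>G\<close> supply the total maps of the
    locale.\<close>
  obtain M1 E where E: "M1-lipschitz_on UNIV E" "\<And>x. x \<in> \<Omega> \<Longrightarrow> E x = F x"
    using lipschitz_extension[OF L12(1)] by blast
  obtain M2 G where G: "M2-lipschitz_on UNIV G" "\<And>y. y \<in> \<Omega>' \<Longrightarrow> G y = inv_into \<Omega> F y"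
    using lipschitz_extension[OF L12(2)] by blast
  have im: "F ` \<Omega> = \<Omega>'" and inj: "inj_on F \<Omega>" using bij by (auto simp: bij_betw_def)
  have contF: "continuous_on \<Omega> F" using L12(1) by (rule lipschitz_on_continuous_on)
  have contE: "continuous_on UNIV E" using E(1) by (rule lipschitz_on_continuous_on)
  interpret bilipschitz_pair E G \<Omega> \<Omega>' "max M1 M2"
  proof
    show "CARD('n) = 2 \<or> CARD('n) = 3" by fact
    show "open \<Omega>" "bounded \<Omega>" by fact+
    show "open \<Omega>'" using invariance_of_domain[OF contF op inj] im by simp
    have "bounded (E ` closure \<Omega>)"
      using bd by (intro compact_imp_bounded compact_continuous_image continuous_on_subset[OF contE]) auto
    moreover have "\<Omega>' \<subseteq> E ` closure \<Omega>" using im E(2) closure_subset[of \<Omega>] by force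
    ultimately show "bounded \<Omega>'" by (rule bounded_subset)
    show "(max M1 M2)-lipschitz_on UNIV E" "(max M1 M2)-lipschitz_on UNIV G"
      using E(1) G(1) by (auto intro: lipschitz_on_mono)
    show "E x \<in> \<Omega>'" "G (E x) = x" if "x \<in> \<Omega>" for x
      using that E(2) G(2) im inj by (auto simp: inv_into_f_f)
    show "G y \<in> \<Omega>" "E (G y) = y" if "y \<in> \<Omega>'" for y
      using that E(2) G(2) im by (auto simp: inv_into_into f_inv_into_f)
  qed
  \<comment> \<open>Derivatives at a point of the open set \<Omega> depend only on values inside it,
    so \<open>F\<close> and its extension have the same Jacobian there.\<close>
  have fr: "frechet_derivative F (at x) = frechet_derivative E (at x)" and dif: "E differentiable (at x) \<Longrightarrow> F differentiable (at x)"
    if x: "x \<in> \<Omega>" for x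
  proof -
    have "(F has_derivative f') (at x) \<longleftrightarrow> (E has_derivative f') (at x)" for f'
      using has_derivative_transform_within_open[OF _ op x, of F f' UNIV E] has_derivative_transform_within_open[OF _ op x, of E f' UNIV F] E(2) by auto
    then show "frechet_derivative F (at x) = frechet_derivative E (at x)" "E differentiable (at x) \<Longrightarrow> F differentiable (at x)"
      by (simp_all add: frechet_derivative_def differentiable_def)
  qed
  have jac: "jacobian F (at x) = jacobian E (at x)" if "x \<in> \<Omega>" for x using fr[OF that] by (simp add: jacobian_def)
  have inv: "inv_into \<Omega> F (E x) = x" if "x \<in> \<Omega>" for x using that inj E(2) by (simp add: inv_into_f_f)
  interpret transformed_medium E G \<Omega> \<Omega>' "max M1 M2" C "push_tensor F \<Omega> C" \<rho> "push_density F \<Omega> \<rho>"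
  proof
    have "AE x in lebesgue. x \<in> \<Omega> \<longrightarrow> F differentiable (at x) \<longrightarrow> 0 < det (jacobian F (at x))"
      using assms(6) unfolding orientation_preserving_def AE_on_dom .
    with Rademacher[OF E(1)] show "AE x in lebesgue. x \<in> \<Omega> \<longrightarrow> 0 < det (jacobian E (at x))"
      by eventually_elim (auto simp: jac dif)
    show "essentially_bounded (lebesgue_on \<Omega>) (\<lambda>x. C x i j k l)" for i j k l using assms(4) by (simp add: elastic_medium_def)
    show "essentially_bounded (lebesgue_on \<Omega>) \<rho>" using assms(4) by (simp add: elastic_medium_def)
    show "push_tensor F \<Omega> C (E x) i q k p = 1 / det (jacobian E (at x)) * (\<Sum>l\<in>UNIV. \<Sum>j\<in>UNIV. C x i j k l * jacobian E (at x) $ p $ l * jacobian E (at x) $ q $ j)"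
      if "x \<in> \<Omega>" for x i q k p using that by (simp add: push_tensor_def inv jac Let_def)
    show "push_density F \<Omega> \<rho> (E x) = \<rho> x / complex_of_real (det (jacobian E (at x)))" if "x \<in> \<Omega>" for x
      using that by (simp add: push_density_def inv jac Let_def)
  qed
  have "(u \<in> H1 \<Omega> \<and> elastic_eq \<omega> \<Omega> C \<rho> u) \<longleftrightarrow> (u \<circ> inv_into \<Omega> F \<in> H1 \<Omega>' \<and>
     elastic_eq \<omega> \<Omega>' (push_tensor F \<Omega> C) (push_density F \<Omega> \<rho>) (u \<circ> inv_into \<Omega> F))" for u
  proof -
    \<comment> \<open>On \<Omega> the function \<open>u\<close> is the composite of \<open>v\<close>
      with \<open>E\<close>. The two may differ outside, which the congruence lemmas absorb, and the
      claim becomes the equivalence for \<open>v\<close>.\<close>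
    define v where "v = u \<circ> inv_into \<Omega> F"
    have "AE x in lebesgue. x \<in> \<Omega> \<longrightarrow> u x = v (E x)" by (auto simp: v_def inv)
    note cong = H1_cong_AE[OF op this] elastic_eq_cong_AE[OF op this]
    show ?thesis
      unfolding cong v_def[symmetric] H1_compose_iff using elastic_eq_compose by blast
  qed
  moreover have "frontier \<Omega>' = frontier \<Omega> \<and> neumann_well_posed \<omega> \<Omega>' (push_tensor F \<Omega> C) (push_density F \<Omega> \<rho>)
      \<and> (\<forall>\<psi>\<in>H_minus_half (frontier \<Omega>). AE x in surface_measure (frontier \<Omega>).
           neumann_to_dirichlet \<omega> \<Omega> C \<rho> \<psi> x = neumann_to_dirichlet \<omega> \<Omega>' (push_tensor F \<Omega> C) (push_density F \<Omega> \<rho>) \<psi> x)"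
    if id: "identity_on_boundary F \<Omega>" and wp: "neumann_well_posed \<omega> \<Omega> C \<rho>"
  proof -
    \<comment> \<open>The extension is continuous at \<open>p\<close>, so \<open>E p\<close> is its
      limit from inside \<Omega>, which is \<open>p\<close> by assumption. Limits are unique because
      a frontier point of an open set is a limit point of it.\<close>
    have fixed: "E p = p" if p: "p \<in> frontier \<Omega>" for p
    proof -
      have "(F \<longlongrightarrow> p) (at p within \<Omega>)" using id p by (simp add: identity_on_boundary_def)
      then have "(E \<longlongrightarrow> p) (at p within \<Omega>)"
        by (rule Lim_transform_eventually) (auto simp: eventually_at_filter E(2))
      moreover have "(E \<longlongrightarrow> E p) (at p within \<Omega>)"
        using contE by (metis UNIV_I continuous_on_def subset_UNIV tendsto_within_subset)
      moreover have "at p within \<Omega> \<noteq> bot"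
        using p op by (auto simp: frontier_def interior_open trivial_limit_within closure_def)
      ultimately show ?thesis using tendsto_unique by blast
    qed
    show ?thesis
      using frontier_eq[OF fixed] neumann_transform[OF fixed wp] by simp
  qed
  ultimately show ?thesis by blast
qed

end
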